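(* Let $p\ge 2$ and let $\varphi$ be a holomorphic self-map of the unit disc $\mathbb{D}$. If $$\int_0^1\frac{|E_\varphi(s)|^{p/2}}{(1-s)^{1+p/2}}\,ds<\infty,$$ then the composition operator $C_\varphi$ belongs to the Schatten class $\mathcal{S}_p(\mathrm{H}^2)$.
   Context: $\mathbb{D}$ is the open unit disc, $\mathbb{T}=\partial\mathbb{D}$, and $\mathrm{H}^2$ is the Hardy space of analytic functions on $\mathbb{D}$ with square-summable Taylor coefficients. For a holomorphic $\varphi:\mathbb{D}\to\mathbb{D}$, $C_\varphi f=f\circ\varphi$, and $\varphi(\zeta)$ denotes the non-tangential limit of $\varphi$ at $\zeta\in\mathbb{T}$ (it exists for almost every $\zeta$). For $s\in(0,1)$ the level set is $E_\varphi(s)=\{\zeta\in\mathbb{T}: |\varphi(\zeta)|\ge s\}$, and $|E|$ denotes the normalized Lebesgue measure of a Borel set $E\subset\mathbb{T}$. A compact operator on a Hilbert space $\mathcal{H}$ belongs to $\mathcal{S}_p(\mathcal{H})$ if its sequence of singular numbers belongs to $\ell^p$. *)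

theory Defs
  imports "HOL-Complex_Analysis.Complex_Analysis" "HOL-Library.Function_Algebras"
begin

abbreviation unit_disc :: "complex set" where
  "unit_disc \<equiv> ball 0 1"

definition taylor_coeff :: "(complex \<Rightarrow> complex) \<Rightarrow> nat \<Rightarrow> complex" where
  "taylor_coeff f n = (deriv ^^ n) f 0 / fact n"

text \<open>
  Functions on the disc are represented by total functions that vanish off the disc, so that
  equality of elements of the Hardy space is equality in HOL.
\<close>

definition hardy :: "(complex \<Rightarrow> complex) set" where
  "hardy = {f. f holomorphic_on unit_disc \<and> (\<forall>z. z \<notin> unit_disc \<longrightarrow> f z = 0)
              \<and> summable (\<lambda>n. (cmod (taylor_coeff f n))\<^sup>2)}"

definition hardy_inner :: "(complex \<Rightarrow> complex) \<Rightarrow> (complex \<Rightarrow> complex) \<Rightarrow> complex" where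
  "hardy_inner f g = (\<Sum>n. taylor_coeff f n * cnj (taylor_coeff g n))"

definition hardy_norm :: "(complex \<Rightarrow> complex) \<Rightarrow> real" where
  "hardy_norm f = sqrt (\<Sum>n. (cmod (taylor_coeff f n))\<^sup>2)"

definition cscale :: "complex \<Rightarrow> (complex \<Rightarrow> complex) \<Rightarrow> complex \<Rightarrow> complex" where
  "cscale c f = (\<lambda>z. c * f z)"

interpretation cfun: vector_space cscale
  by unfold_locales (auto simp: cscale_def fun_eq_iff algebra_simps)

definition hardy_operator :: "((complex \<Rightarrow> complex) \<Rightarrow> complex \<Rightarrow> complex) \<Rightarrow> bool" where
  "hardy_operator T \<longleftrightarrow>
     (\<forall>f\<in>hardy. T f \<in> hardy) \<and>
     (\<forall>f\<in>hardy. \<forall>g\<in>hardy. T (f + g) = T f + T g) \<and>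
     (\<forall>c. \<forall>f\<in>hardy. T (cscale c f) = cscale c (T f))"

definition hardy_compact :: "((complex \<Rightarrow> complex) \<Rightarrow> complex \<Rightarrow> complex) \<Rightarrow> bool" where
  "hardy_compact T \<longleftrightarrow>
     hardy_operator T \<and>
     (\<forall>F::nat \<Rightarrow> complex \<Rightarrow> complex.
        (\<forall>n. F n \<in> hardy \<and> hardy_norm (F n) \<le> 1) \<longrightarrow>
        (\<exists>g\<in>hardy. \<exists>r. strict_mono r \<and> (\<lambda>k. hardy_norm (T (F (r k)) - g)) \<longlonglongrightarrow> 0))"

definition hardy_adjoint ::
  "((complex \<Rightarrow> complex) \<Rightarrow> complex \<Rightarrow> complex) \<Rightarrow> (complex \<Rightarrow> complex) \<Rightarrow> complex \<Rightarrow> complex" where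
  "hardy_adjoint T g =
     (THE h. h \<in> hardy \<and> (\<forall>f\<in>hardy. hardy_inner (T f) g = hardy_inner f h))"

definition hardy_eigenspace ::
  "((complex \<Rightarrow> complex) \<Rightarrow> complex \<Rightarrow> complex) \<Rightarrow> complex \<Rightarrow> (complex \<Rightarrow> complex) set" where
  "hardy_eigenspace A c = {f \<in> hardy. A f = cscale c f}"

text \<open>
  For a compact operator \<open>T\<close>, the sequence \<open>s\<close> of singular numbers lists in decreasing order the
  square roots of the nonzero eigenvalues of \<open>T\<^sup>*T\<close>, each repeated according to its (finite)
  multiplicity, and is padded with zeros if there are only finitely many of them.
  Compactness determines \<open>s\<close> uniquely.
\<close>

definition singular_numbers ::
  "((complex \<Rightarrow> complex) \<Rightarrow> complex \<Rightarrow> complex) \<Rightarrow> (nat \<Rightarrow> real) \<Rightarrow> bool" where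
  "singular_numbers T s \<longleftrightarrow>
     decseq s \<and> (\<forall>n. 0 \<le> s n) \<and>
     (\<forall>x>0. finite {n. s n = x} \<and>
        card {n. s n = x} =
          cfun.dim (hardy_eigenspace (hardy_adjoint T \<circ> T) (complex_of_real (x\<^sup>2))))"

definition schatten :: "real \<Rightarrow> ((complex \<Rightarrow> complex) \<Rightarrow> complex \<Rightarrow> complex) set" where
  "schatten p = {T. hardy_compact T \<and>
                    (\<exists>s. singular_numbers T s \<and> summable (\<lambda>n. s n powr p))}"

definition composition_operator ::
  "(complex \<Rightarrow> complex) \<Rightarrow> (complex \<Rightarrow> complex) \<Rightarrow> complex \<Rightarrow> complex" where
  "composition_operator \<phi> f = (\<lambda>z. if z \<in> unit_disc then f (\<phi> z) else 0)"

definition stolz_region :: "real \<Rightarrow> complex \<Rightarrow> complex set" where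
  "stolz_region M \<zeta> = {z \<in> unit_disc. cmod (z - \<zeta>) < M * (1 - cmod z)}"

definition has_nontangential_limit ::
  "(complex \<Rightarrow> complex) \<Rightarrow> complex \<Rightarrow> complex \<Rightarrow> bool" where
  "has_nontangential_limit \<phi> \<zeta> w \<longleftrightarrow> (\<forall>M>1. (\<phi> \<longlongrightarrow> w) (at \<zeta> within stolz_region M \<zeta>))"

text \<open>Points of the circle without a non-tangential limit belong to no level set.\<close>

definition level_set :: "(complex \<Rightarrow> complex) \<Rightarrow> real \<Rightarrow> complex set" where
  "level_set \<phi> s = {\<zeta> \<in> sphere 0 1. \<exists>w. has_nontangential_limit \<phi> \<zeta> w \<and> s \<le> cmod w}"

definition circle_measure :: "complex set \<Rightarrow> real" where
  "circle_measure E = measure lebesgue {t \<in> {0..<2 * pi}. cis t \<in> E} / (2 * pi)"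

end

theory Submission imports Defs begin

text \<open>
  Let \<open>q = p / 2\<close>, let \<open>T\<close> be composition with \<open>\<phi>\<close>, and let \<open>|E(s)|\<close> be the measure of the level set.

  If \<open>e\<^sub>j\<close> are orthonormal eigenvectors of \<open>T\<^sup>*T\<close> with eigenvalues \<open>s\<^sub>j\<^sup>2\<close>, then \<open>s\<^sub>j = \<parallel>T e\<^sub>j\<parallel>\<close>. So a
  bound on \<open>\<Sum>\<^sub>j \<parallel>T e\<^sub>j\<parallel>\<^sup>p\<close> that is uniform over finite orthonormal families bounds the number of
  eigenvalues above every positive threshold, counted with multiplicity, and the sum of the \<open>p\<close>-th
  powers of the singular numbers (\<open>singular_numbers_of_orthonormal_bound\<close>).

  The uniform bound comes from localising in frequency and in modulus at the same dyadic scales.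
  Write \<open>f = \<Sum>\<^sub>m f\<^sub>m\<close>, where \<open>f\<^sub>m\<close> collects the Taylor terms of index \<open>k\<close> with
  \<open>2\<^sup>m \<le> k + 1 < 2\<^sup>m\<^sup>+\<^sup>1\<close>, and cut the circle into the pieces where
  \<open>1 - 2\<^sup>-\<^sup>n \<le> |\<phi>| < 1 - 2\<^sup>-\<^sup>n\<^sup>-\<^sup>1\<close>. On the \<open>n\<close>-th piece the block \<open>m = n\<close> dominates: by Cauchy-Schwarz,
  \<open>|f\<^sub>m|\<^sup>2\<close> is at most the energy of the block times \<open>8 \<cdot> 2\<^sup>n \<cdot> 2\<^sup>-\<^sup>|\<^sup>m\<^sup>-\<^sup>n\<^sup>|\<close>. Part of this off-diagonal
  decay pays for separating the blocks, the rest survives. The outcome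
  (\<open>composition_block_estimate\<close>) is a splitting \<open>\<parallel>T f\<parallel>\<^sup>2 \<le> \<Sum>\<^sub>m Q\<^sub>m(f)\<close> in which \<open>Q\<^sub>m(f)\<close> is at most \<open>B\<^sub>m\<close>
  times the energy of the \<open>m\<close>-th block of \<open>f\<close>, while Bessel's inequality gives \<open>\<Sum>\<^sub>j Q\<^sub>m(e\<^sub>j) \<le> B\<^sub>m\<close> for
  orthonormal \<open>e\<^sub>j\<close>; here \<open>B\<^sub>m = 48 \<Sum>\<^sub>n (3/4)\<^sup>|\<^sup>m\<^sup>-\<^sup>n\<^sup>| x\<^sub>n\<close> with \<open>x\<^sub>n = 2\<^sup>n |E(1 - 2\<^sup>-\<^sup>n)|\<close>.

  Since the block energies of a unit vector sum to at most 1, Jensen's inequality turns this into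
  \<open>\<parallel>T e\<^sub>j\<parallel>\<^sup>p \<le> \<Sum>\<^sub>m B\<^sub>m\<^sup>q\<^sup>-\<^sup>1 Q\<^sub>m(e\<^sub>j)\<close>, and summing over \<open>j\<close> leaves \<open>\<Sum>\<^sub>m B\<^sub>m\<^sup>q\<close>. The sequence \<open>B\<close> is a
  convolution of \<open>x\<close> with a summable kernel, hence \<open>q\<close>-summable when \<open>x\<close> is
  (\<open>convolution_powr_summable\<close>); and \<open>\<Sum>\<^sub>n x\<^sub>n\<^sup>q\<close> is controlled by the integral in the hypothesis, cut
  into dyadic intervals (\<open>level_mass_powr_summable\<close>). Compactness follows from \<open>B\<^sub>m \<rightarrow> 0\<close>.

  Passing from the disc to boundary values rests on the theorem of Fatou
  (\<open>fatou_nontangential_limits\<close>): a bounded holomorphic function has non-tangential limits almost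
  everywhere. Its primitive is continuous up to the circle and is there an indefinite integral of a
  bounded function, so Lebesgue's differentiation theorem gives a boundary derivative almost
  everywhere; a reflected Cauchy kernel, controlled by the Poisson kernel, transports this
  derivative into the disc.
\<close>

section \<open>Power series and the Hardy space\<close>

definition square_summable :: "(nat \<Rightarrow> complex) \<Rightarrow> bool" where
  "square_summable a \<longleftrightarrow> summable (\<lambda>n. (cmod (a n))\<^sup>2)"

text \<open>
  The inverse of \<open>taylor_coeff\<close> on square-summable sequences; the value 0 off the disc matches the
  convention for elements of \<open>hardy\<close>.
\<close>

definition of_coeffs :: "(nat \<Rightarrow> complex) \<Rightarrow> complex \<Rightarrow> complex" where
  "of_coeffs a z = (if z \<in> unit_disc then \<Sum>n. a n * z ^ n else 0)"

lemma square_summable_imp_abs_summable: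
  assumes a: "square_summable a" and z: "0 \<le> r" "r < 1"
  shows "summable (\<lambda>n. cmod (a n) * r ^ n)"
proof -
  have "r\<^sup>2 < 1" using z by (simp add: power_less_one_iff)
  then have "summable (\<lambda>n. (r\<^sup>2) ^ n)" by (intro summable_geometric) simp
  with a have "summable (\<lambda>n. (cmod (a n))\<^sup>2 + (r\<^sup>2) ^ n)"
    unfolding square_summable_def by (rule summable_add)
  then show ?thesis
  proof (rule summable_comparison_test'[of _ 0])
    fix n
    have "2 * (cmod (a n) * r ^ n) \<le> (cmod (a n))\<^sup>2 + (r\<^sup>2) ^ n"
      using sum_squares_bound[of "cmod (a n)" "r ^ n"] by (simp add: power_mult[symmetric] mult.commute)
    moreover have "0 \<le> cmod (a n) * r ^ n" using z by simp
    ultimately show "norm (cmod (a n) * r ^ n) \<le> (cmod (a n))\<^sup>2 + (r\<^sup>2) ^ n" by simp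
  qed
qed

lemma square_summable_power_series:
  assumes a: "square_summable a" and z: "z \<in> unit_disc"
  shows "summable (\<lambda>n. norm (a n * z ^ n))"
  using square_summable_imp_abs_summable[OF a, of "cmod z"] z by (simp add: norm_mult norm_power)

text \<open>
  Uniqueness of power series expansions, the source of all coefficient identities below.
\<close>

lemma taylor_coeff_power_series:
  assumes s: "\<And>z. z \<in> unit_disc \<Longrightarrow> (\<lambda>n. a n * z ^ n) sums f z"
  shows "taylor_coeff f n = a n"
proof -
  define F where "F = Abs_fps a"
  have rad: "fps_conv_radius F \<ge> ereal (norm (1/2::complex))"
    unfolding fps_conv_radius_def F_def
    by (rule conv_radius_geI) (use s[of "1/2"] in \<open>auto simp: sums_iff\<close>)
  then have "fps_conv_radius F > 0"
    by (rule less_le_trans[rotated]) simp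
  moreover have "eventually (\<lambda>z. z \<in> unit_disc) (nhds (0::complex))"
    by (rule eventually_nhds_in_open) auto
  then have "eventually (\<lambda>z. eval_fps F z = f z) (nhds 0)"
    by eventually_elim (use s in \<open>auto simp: eval_fps_def F_def sums_iff\<close>)
  ultimately have "f has_fps_expansion F" by (simp add: has_fps_expansion_def)
  from fps_nth_fps_expansion[OF this] show ?thesis by (simp add: taylor_coeff_def F_def)
qed

lemma taylor_series_sums:
  assumes "f holomorphic_on unit_disc" "z \<in> unit_disc"
  shows "(\<lambda>n. taylor_coeff f n * z ^ n) sums f z"
  using holomorphic_power_series[OF assms] by (simp add: taylor_coeff_def)

lemma of_coeffs_sums:
  assumes "square_summable a" "z \<in> unit_disc"
  shows "(\<lambda>n. a n * z ^ n) sums of_coeffs a z"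
  using square_summable_power_series[OF assms] assms(2)
  by (simp add: of_coeffs_def summable_norm_cancel summable_sums)

lemma taylor_coeff_of_coeffs [simp]: "square_summable a \<Longrightarrow> taylor_coeff (of_coeffs a) n = a n"
  by (rule taylor_coeff_power_series) (rule of_coeffs_sums)

lemma of_coeffs_in_hardy: "square_summable a \<Longrightarrow> of_coeffs a \<in> hardy"
  unfolding hardy_def
proof (safe, goal_cases)
  case 1
  show ?case by (rule power_series_holomorphic[of 0 1 a]) (use of_coeffs_sums[OF 1] in auto)
qed (auto simp: of_coeffs_def square_summable_def)

lemma square_summable_taylor: "f \<in> hardy \<Longrightarrow> square_summable (taylor_coeff f)"
  by (simp add: hardy_def square_summable_def)

lemma hardy_sums: "f \<in> hardy \<Longrightarrow> z \<in> unit_disc \<Longrightarrow> (\<lambda>n. taylor_coeff f n * z ^ n) sums f z"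
  using taylor_series_sums unfolding hardy_def by blast

lemma hardy_off_disc: "f \<in> hardy \<Longrightarrow> z \<notin> unit_disc \<Longrightarrow> f z = 0"
  unfolding hardy_def by blast

lemma hardy_eqI:
  assumes f: "f \<in> hardy" and g: "g \<in> hardy" and eq: "\<And>n. taylor_coeff f n = taylor_coeff g n"
  shows "f = g"
proof
  fix z show "f z = g z"
    using hardy_sums[OF f, of z] hardy_sums[OF g, of z] hardy_off_disc[OF f, of z] hardy_off_disc[OF g, of z] eq
    by (cases "z \<in> unit_disc") (auto dest: sums_unique2)
qed

lemma square_summable_add:
  assumes "square_summable a" "square_summable b" shows "square_summable (\<lambda>n. a n + b n)"
  unfolding square_summable_def
proof (rule summable_comparison_test'[of _ 0])
  show "summable (\<lambda>n. 2 * (cmod (a n))\<^sup>2 + 2 * (cmod (b n))\<^sup>2)"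
    using assms unfolding square_summable_def by (intro summable_add summable_mult)
  fix n
  have "(cmod (a n + b n))\<^sup>2 \<le> (cmod (a n) + cmod (b n))\<^sup>2"
    by (intro power_mono norm_triangle_ineq) auto
  also have "\<dots> \<le> 2 * (cmod (a n))\<^sup>2 + 2 * (cmod (b n))\<^sup>2"
    using sum_squares_bound[of "cmod (a n)" "cmod (b n)"] by (simp add: power2_sum)
  finally show "norm ((cmod (a n + b n))\<^sup>2) \<le> 2 * (cmod (a n))\<^sup>2 + 2 * (cmod (b n))\<^sup>2" by simp
qed

lemma square_summable_mult: "square_summable a \<Longrightarrow> square_summable (\<lambda>n. c * a n)"
  unfolding square_summable_def by (simp add: norm_mult power_mult_distrib summable_mult)

lemma square_summable_finite: "(\<And>n. n \<ge> N \<Longrightarrow> a n = 0) \<Longrightarrow> square_summable a"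
  unfolding square_summable_def by (rule summable_finite[of "{..<N}"]) (auto simp: not_less)

lemma taylor_coeff_add:
  assumes "f holomorphic_on unit_disc" "g holomorphic_on unit_disc"
  shows "taylor_coeff (f + g) n = taylor_coeff f n + taylor_coeff g n"
  by (rule taylor_coeff_power_series)
     (use taylor_series_sums[OF assms(1)] taylor_series_sums[OF assms(2)] in \<open>auto simp: distrib_right intro!: sums_add\<close>)

lemma taylor_coeff_cscale:
  assumes "f holomorphic_on unit_disc"
  shows "taylor_coeff (cscale c f) n = c * taylor_coeff f n"
  by (rule taylor_coeff_power_series)
     (use taylor_series_sums[OF assms(1)] in \<open>auto simp: mult.assoc cscale_def intro!: sums_mult\<close>)

lemma hardy_holomorphic: "f \<in> hardy \<Longrightarrow> f holomorphic_on unit_disc"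
  by (simp add: hardy_def)

lemma taylor_coeff_hardy [simp]:
  "f \<in> hardy \<Longrightarrow> g \<in> hardy \<Longrightarrow> taylor_coeff (f + g) n = taylor_coeff f n + taylor_coeff g n"
  "f \<in> hardy \<Longrightarrow> taylor_coeff (cscale c f) n = c * taylor_coeff f n"
  by (simp_all add: taylor_coeff_add taylor_coeff_cscale hardy_holomorphic)

lemma taylor_coeff_0 [simp]: "taylor_coeff 0 n = 0"
  by (rule taylor_coeff_power_series) auto

lemma hardy_add_closed: "f \<in> hardy \<Longrightarrow> g \<in> hardy \<Longrightarrow> f + g \<in> hardy"
proof -
  assume f: "f \<in> hardy" and g: "g \<in> hardy"
  have "(\<lambda>z. f z + g z) holomorphic_on unit_disc" using f g by (intro holomorphic_intros hardy_holomorphic)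
  moreover have "summable (\<lambda>n. (cmod (taylor_coeff (f + g) n))\<^sup>2)"
    using square_summable_add[OF square_summable_taylor[OF f] square_summable_taylor[OF g]] f g
    by (simp add: square_summable_def)
  ultimately show ?thesis using hardy_off_disc[OF f] hardy_off_disc[OF g]
    by (auto simp: hardy_def plus_fun_def)
qed

lemma hardy_cscale_closed: "f \<in> hardy \<Longrightarrow> cscale c f \<in> hardy"
proof -
  assume f: "f \<in> hardy"
  have "(\<lambda>z. c * f z) holomorphic_on unit_disc" using f by (intro holomorphic_intros hardy_holomorphic)
  moreover have "summable (\<lambda>n. (cmod (taylor_coeff (cscale c f) n))\<^sup>2)"
    using square_summable_mult[OF square_summable_taylor[OF f]] f
    by (simp add: square_summable_def)
  ultimately show ?thesis using hardy_off_disc[OF f]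
    by (auto simp: hardy_def cscale_def)
qed

lemma zero_in_hardy: "0 \<in> hardy"
proof -
  have "of_coeffs (\<lambda>_. 0) \<in> hardy"
    by (rule of_coeffs_in_hardy) (simp add: square_summable_def)
  moreover have "of_coeffs (\<lambda>_. 0) = 0" by (auto simp: of_coeffs_def fun_eq_iff)
  ultimately show ?thesis by simp
qed

lemma subspace_hardy: "cfun.subspace hardy"
  by (rule cfun.subspaceI) (fact zero_in_hardy hardy_add_closed hardy_cscale_closed)+

lemma hardy_sum_closed: "(\<And>i. i \<in> I \<Longrightarrow> f i \<in> hardy) \<Longrightarrow> (\<Sum>i\<in>I. cscale (c i) (f i)) \<in> hardy"
  by (intro cfun.subspace_sum subspace_hardy hardy_cscale_closed)

lemma hardy_sum_coeff:
  assumes "\<And>i. i \<in> I \<Longrightarrow> f i \<in> hardy"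
  shows "taylor_coeff (\<Sum>i\<in>I. cscale (c i) (f i)) n = (\<Sum>i\<in>I. c i * taylor_coeff (f i) n)"
  using assms
proof (induction I rule: infinite_finite_induct)
  case (insert i I)
  have "(\<Sum>i\<in>I. cscale (c i) (f i)) \<in> hardy"
    using insert by (intro cfun.subspace_sum subspace_hardy cfun.subspace_scale) auto
  moreover have "cscale (c i) (f i) \<in> hardy" using insert by (simp add: hardy_cscale_closed)
  ultimately have "taylor_coeff (cscale (c i) (f i) + (\<Sum>i\<in>I. cscale (c i) (f i))) n
      = c i * taylor_coeff (f i) n + (\<Sum>i\<in>I. c i * taylor_coeff (f i) n)"
    using insert by (subst taylor_coeff_hardy(1)) auto
  then show ?case unfolding sum.insert[OF insert.hyps] .
qed auto

lemma hardy_diff_coeff: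
  assumes "f \<in> hardy" "g \<in> hardy"
  shows "f - g \<in> hardy" "taylor_coeff (f - g) n = taylor_coeff f n - taylor_coeff g n"
proof -
  have eq: "f - g = f + cscale (-1) g" by (auto simp: fun_eq_iff cscale_def)
  show "f - g \<in> hardy" unfolding eq by (intro hardy_add_closed hardy_cscale_closed assms)
  show "taylor_coeff (f - g) n = taylor_coeff f n - taylor_coeff g n" unfolding eq
    using assms by (subst taylor_coeff_hardy(1)) (auto simp: hardy_cscale_closed simp del: cfun.scale_minus_left)
qed

lemma hardy_inner_summable:
  assumes "f \<in> hardy" "g \<in> hardy"
  shows "summable (\<lambda>n. cmod (taylor_coeff f n * cnj (taylor_coeff g n)))"
proof (rule summable_comparison_test'[of _ 0])
  show "summable (\<lambda>n. (cmod (taylor_coeff f n))\<^sup>2 + (cmod (taylor_coeff g n))\<^sup>2)"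
    using assms by (intro summable_add) (auto simp: hardy_def)
  fix n
  show "norm (cmod (taylor_coeff f n * cnj (taylor_coeff g n))) \<le> (cmod (taylor_coeff f n))\<^sup>2 + (cmod (taylor_coeff g n))\<^sup>2"
  proof -
    have "2 * (cmod (taylor_coeff f n) * cmod (taylor_coeff g n)) \<le> (cmod (taylor_coeff f n))\<^sup>2 + (cmod (taylor_coeff g n))\<^sup>2"
      using sum_squares_bound[of "cmod (taylor_coeff f n)" "cmod (taylor_coeff g n)"] by simp
    moreover have "0 \<le> cmod (taylor_coeff f n) * cmod (taylor_coeff g n)" by simp
    ultimately show ?thesis by (simp only: norm_mult real_norm_def abs_norm_cancel complex_mod_cnj)
  qed
qed

lemma hardy_inner_sums:
  assumes "f \<in> hardy" "g \<in> hardy"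
  shows "(\<lambda>n. taylor_coeff f n * cnj (taylor_coeff g n)) sums hardy_inner f g"
  unfolding hardy_inner_def by (rule summable_sums[OF summable_norm_cancel[OF hardy_inner_summable[OF assms]]])

lemma hardy_norm_sq_sums:
  assumes "f \<in> hardy"
  shows "(\<lambda>n. (cmod (taylor_coeff f n))\<^sup>2) sums (hardy_norm f)\<^sup>2"
proof -
  have s: "summable (\<lambda>n. (cmod (taylor_coeff f n))\<^sup>2)" using assms by (simp add: hardy_def)
  then have "(hardy_norm f)\<^sup>2 = (\<Sum>n. (cmod (taylor_coeff f n))\<^sup>2)"
    unfolding hardy_norm_def by (intro real_sqrt_pow2 suminf_nonneg) auto
  with s show ?thesis by (simp add: summable_sums)
qed

lemma hardy_partial_energy_le:
  assumes "f \<in> hardy" "finite I"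
  shows "(\<Sum>k\<in>I. (cmod (taylor_coeff f k))\<^sup>2) \<le> (hardy_norm f)\<^sup>2"
  using hardy_norm_sq_sums[OF assms(1)] sum_le_suminf[of "\<lambda>k. (cmod (taylor_coeff f k))\<^sup>2" I] assms(2)
  by (simp add: sums_iff)

lemma hardy_inner_self:
  assumes "f \<in> hardy" shows "hardy_inner f f = of_real ((hardy_norm f)\<^sup>2)"
proof -
  have "(\<lambda>n. complex_of_real ((cmod (taylor_coeff f n))\<^sup>2)) sums of_real ((hardy_norm f)\<^sup>2)"
    by (rule sums_of_real[OF hardy_norm_sq_sums[OF assms]])
  then show ?thesis using hardy_inner_sums[OF assms assms]
    unfolding complex_norm_square by (rule sums_unique2[symmetric])
qed

lemma hardy_norm_nonneg: "f \<in> hardy \<Longrightarrow> 0 \<le> hardy_norm f"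
  unfolding hardy_norm_def by (intro real_sqrt_ge_zero suminf_nonneg) (auto simp: hardy_def)

lemma hardy_inner_cnj:
  assumes "f \<in> hardy" "g \<in> hardy"
  shows "hardy_inner g f = cnj (hardy_inner f g)"
proof -
  have "(\<lambda>n. cnj (taylor_coeff f n * cnj (taylor_coeff g n))) sums cnj (hardy_inner f g)"
    using hardy_inner_sums[OF assms] by (simp only: sums_cnj)
  then show ?thesis using hardy_inner_sums[OF assms(2,1)] by (simp add: mult.commute sums_unique2)
qed

lemma hardy_inner_add_left:
  assumes "f \<in> hardy" "g \<in> hardy" "h \<in> hardy"
  shows "hardy_inner (f + g) h = hardy_inner f h + hardy_inner g h"
  using sums_add[OF hardy_inner_sums[OF assms(1,3)] hardy_inner_sums[OF assms(2,3)]]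
    hardy_inner_sums[OF hardy_add_closed[OF assms(1,2)] assms(3)] assms
  by (simp add: distrib_right sums_unique2)

lemma hardy_inner_cscale_left:
  assumes "f \<in> hardy" "h \<in> hardy"
  shows "hardy_inner (cscale c f) h = c * hardy_inner f h"
  using sums_mult[OF hardy_inner_sums[OF assms], of c]
    hardy_inner_sums[OF hardy_cscale_closed[OF assms(1), where c=c] assms(2)] assms
  by (simp add: mult.assoc sums_unique2)

lemma hardy_inner_add_right:
  assumes "f \<in> hardy" "g \<in> hardy" "h \<in> hardy"
  shows "hardy_inner h (f + g) = hardy_inner h f + hardy_inner h g"
  using assms hardy_inner_add_left[OF assms]
  by (metis complex_cnj_add hardy_add_closed hardy_inner_cnj)

lemma hardy_inner_cscale_right:
  assumes "f \<in> hardy" "h \<in> hardy"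
  shows "hardy_inner h (cscale c f) = cnj c * hardy_inner h f"
  using assms hardy_inner_cscale_left[OF assms]
  by (metis complex_cnj_mult hardy_cscale_closed hardy_inner_cnj)

lemma hardy_cauchy_schwarz:
  assumes f: "f \<in> hardy" and g: "g \<in> hardy"
  shows "cmod (hardy_inner f g) \<le> hardy_norm f * hardy_norm g"
proof (rule LIMSEQ_le_const2)
  show "(\<lambda>N. cmod (\<Sum>n<N. taylor_coeff f n * cnj (taylor_coeff g n))) \<longlonglongrightarrow> cmod (hardy_inner f g)"
    using hardy_inner_sums[OF f g] unfolding sums_def by (rule tendsto_norm)
  have L2: "L2_set (\<lambda>n. cmod (taylor_coeff h n)) {..<N} \<le> hardy_norm h" if "h \<in> hardy" for h N
  proof -
    have "(\<Sum>n<N. (cmod (taylor_coeff h n))\<^sup>2) \<le> (hardy_norm h)\<^sup>2"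
      by (rule hardy_partial_energy_le[OF that]) simp
    from real_sqrt_le_mono[OF this] show ?thesis unfolding L2_set_def
      using hardy_norm_nonneg[OF that] by simp
  qed
  have "cmod (\<Sum>n<N. taylor_coeff f n * cnj (taylor_coeff g n)) \<le> hardy_norm f * hardy_norm g" for N
  proof -
    have "cmod (\<Sum>n<N. taylor_coeff f n * cnj (taylor_coeff g n)) \<le> (\<Sum>n<N. \<bar>cmod (taylor_coeff f n)\<bar> * \<bar>cmod (taylor_coeff g n)\<bar>)"
      by (rule order_trans[OF norm_sum]) (simp add: norm_mult)
    also have "\<dots> \<le> L2_set (\<lambda>n. cmod (taylor_coeff f n)) {..<N} * L2_set (\<lambda>n. cmod (taylor_coeff g n)) {..<N}"
      by (rule L2_set_mult_ineq)
    also have "\<dots> \<le> hardy_norm f * hardy_norm g"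
      by (intro mult_mono L2 f g hardy_norm_nonneg L2_set_nonneg)
    finally show ?thesis .
  qed
  then show "\<exists>N. \<forall>n\<ge>N. cmod (\<Sum>n<n. taylor_coeff f n * cnj (taylor_coeff g n)) \<le> hardy_norm f * hardy_norm g"
    by blast
qed

section \<open>Adjoints of bounded operators on the Hardy space\<close>

lemma hardy_norm_eq_0:
  assumes f: "f \<in> hardy" and "hardy_norm f = 0" shows "f = 0"
proof (rule hardy_eqI[OF f zero_in_hardy])
  have "(\<lambda>n. (cmod (taylor_coeff f n))\<^sup>2) sums 0" using hardy_norm_sq_sums[OF f] assms(2) by simp
  then have "(cmod (taylor_coeff f n))\<^sup>2 = 0" for n
    using suminf_eq_zero_iff[of "\<lambda>n. (cmod (taylor_coeff f n))\<^sup>2"] by (simp add: sums_iff)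
  then show "taylor_coeff f n = taylor_coeff 0 n" for n by simp
qed

definition hardy_monomial :: "nat \<Rightarrow> complex \<Rightarrow> complex" where
  "hardy_monomial n = of_coeffs (\<lambda>k. if k = n then 1 else 0)"

lemma hardy_monomial [simp]:
  "hardy_monomial n \<in> hardy" "taylor_coeff (hardy_monomial n) k = (if k = n then 1 else 0)"
proof -
  have "square_summable (\<lambda>k. if k = n then 1 else 0)"
    by (rule square_summable_finite[of "Suc n"]) auto
  then show "hardy_monomial n \<in> hardy" "taylor_coeff (hardy_monomial n) k = (if k = n then 1 else 0)"
    unfolding hardy_monomial_def by (simp_all add: of_coeffs_in_hardy)
qed

lemma hardy_inner_monomial:
  assumes "h \<in> hardy" shows "hardy_inner (hardy_monomial n) h = cnj (taylor_coeff h n)"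
proof -
  have "(\<lambda>k. if k = n then cnj (taylor_coeff h k) else 0) sums cnj (taylor_coeff h n)"
    by (rule sums_single)
  moreover have "(\<lambda>k. taylor_coeff (hardy_monomial n) k * cnj (taylor_coeff h k)) = (\<lambda>k. if k = n then cnj (taylor_coeff h k) else 0)"
    by auto
  ultimately show ?thesis using hardy_inner_sums[OF hardy_monomial(1) assms, of n] by (metis sums_unique2)
qed

lemma hardy_inner_sum_left:
  assumes "\<And>i. i \<in> I \<Longrightarrow> f i \<in> hardy" "h \<in> hardy"
  shows "hardy_inner (\<Sum>i\<in>I. cscale (c i) (f i)) h = (\<Sum>i\<in>I. c i * hardy_inner (f i) h)"
  using assms(1)
proof (induction I rule: infinite_finite_induct)
  case (insert i I)
  have "(\<Sum>i\<in>I. cscale (c i) (f i)) \<in> hardy" "cscale (c i) (f i) \<in> hardy"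
    using insert by (auto intro!: hardy_sum_closed hardy_cscale_closed)
  then show ?case unfolding sum.insert[OF insert.hyps]
    using insert assms(2) by (subst hardy_inner_add_left) (auto simp: hardy_inner_cscale_left)
qed (auto simp: hardy_inner_def)

lemma hardy_inner_nondegenerate:
  assumes "h \<in> hardy" "h' \<in> hardy" "\<And>f. f \<in> hardy \<Longrightarrow> hardy_inner f h = hardy_inner f h'"
  shows "h = h'"
proof (rule hardy_eqI[OF assms(1,2)])
  fix n show "taylor_coeff h n = taylor_coeff h' n"
    using assms(3)[OF hardy_monomial(1), of n] assms(1,2) by (simp add: hardy_inner_monomial)
qed

definition hardy_bounded :: "((complex \<Rightarrow> complex) \<Rightarrow> complex \<Rightarrow> complex) \<Rightarrow> bool" where
  "hardy_bounded T \<longleftrightarrow> hardy_operator T \<and> (\<exists>K\<ge>0. \<forall>f\<in>hardy. hardy_norm (T f) \<le> K * hardy_norm f)"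

lemma hardy_operatorD:
  assumes "hardy_operator T"
  shows "f \<in> hardy \<Longrightarrow> T f \<in> hardy"
    "f \<in> hardy \<Longrightarrow> g \<in> hardy \<Longrightarrow> T (f + g) = T f + T g"
    "f \<in> hardy \<Longrightarrow> T (cscale c f) = cscale c (T f)"
  using assms unfolding hardy_operator_def by blast+

lemma hardy_operator_sum:
  assumes T: "hardy_operator T" and "\<And>i. i \<in> I \<Longrightarrow> f i \<in> hardy"
  shows "T (\<Sum>i\<in>I. cscale (c i) (f i)) = (\<Sum>i\<in>I. cscale (c i) (T (f i)))"
  using assms(2)
proof (induction I rule: infinite_finite_induct)
  case (insert i I)
  have h: "(\<Sum>i\<in>I. cscale (c i) (f i)) \<in> hardy" "cscale (c i) (f i) \<in> hardy" "f i \<in> hardy"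
    using insert by (auto intro!: hardy_sum_closed hardy_cscale_closed)
  have IH: "T (\<Sum>i\<in>I. cscale (c i) (f i)) = (\<Sum>i\<in>I. cscale (c i) (T (f i)))" using insert by auto
  show ?case unfolding sum.insert[OF insert.hyps] hardy_operatorD(2)[OF T h(2,1)] hardy_operatorD(3)[OF T h(3)] IH ..
next
  have z: "T 0 = 0" using hardy_operatorD(3)[OF T zero_in_hardy, of 0] unfolding cfun.scale_zero_left .
  {
    case (infinite A)
    show ?case unfolding sum.infinite[OF infinite(1)] by (rule z)
  next
    case empty
    show ?case unfolding sum.empty by (rule z)
  }
qed

lemma hardy_norm_sq_truncation:
  assumes f: "f \<in> hardy"
  shows "(hardy_norm (\<Sum>n<N. cscale (taylor_coeff f n) (hardy_monomial n)))\<^sup>2 = (\<Sum>n<N. (cmod (taylor_coeff f n))\<^sup>2)"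
    and "(hardy_norm (f - (\<Sum>n<N. cscale (taylor_coeff f n) (hardy_monomial n))))\<^sup>2 = (hardy_norm f)\<^sup>2 - (\<Sum>n<N. (cmod (taylor_coeff f n))\<^sup>2)"
proof -
  let ?S = "\<Sum>n<N. cscale (taylor_coeff f n) (hardy_monomial n)"
  have S: "?S \<in> hardy" by (auto intro!: hardy_sum_closed hardy_cscale_closed)
  have c: "taylor_coeff ?S n = (if n < N then taylor_coeff f n else 0)" for n
    by (subst hardy_sum_coeff) (auto simp: if_distrib[of "\<lambda>x. _ * x"] sum.delta cong: if_cong)
  have s1: "(\<lambda>n. if n \<in> {..<N} then (cmod (taylor_coeff f n))\<^sup>2 else 0) sums (\<Sum>n<N. (cmod (taylor_coeff f n))\<^sup>2)"
    by (rule sums_If_finite_set) simp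
  show "(hardy_norm ?S)\<^sup>2 = (\<Sum>n<N. (cmod (taylor_coeff f n))\<^sup>2)"
  proof (rule sums_unique2[OF hardy_norm_sq_sums[OF S]])
    have "(\<lambda>n. (cmod (taylor_coeff ?S n))\<^sup>2) = (\<lambda>n. if n \<in> {..<N} then (cmod (taylor_coeff f n))\<^sup>2 else 0)"
      by (auto simp: c)
    then show "(\<lambda>n. (cmod (taylor_coeff ?S n))\<^sup>2) sums (\<Sum>n<N. (cmod (taylor_coeff f n))\<^sup>2)"
      using s1 by simp
  qed
  have "(\<lambda>n. (cmod (taylor_coeff f n))\<^sup>2 - (if n \<in> {..<N} then (cmod (taylor_coeff f n))\<^sup>2 else 0)) sums
     ((hardy_norm f)\<^sup>2 - (\<Sum>n<N. (cmod (taylor_coeff f n))\<^sup>2))"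
    by (rule sums_diff[OF hardy_norm_sq_sums[OF f] s1])
  also have "(\<lambda>n. (cmod (taylor_coeff f n))\<^sup>2 - (if n \<in> {..<N} then (cmod (taylor_coeff f n))\<^sup>2 else 0))
     = (\<lambda>n. (cmod (taylor_coeff (f - ?S) n))\<^sup>2)"
    by (auto simp: hardy_diff_coeff(2)[OF f S] c)
  finally show "(hardy_norm (f - ?S))\<^sup>2 = (hardy_norm f)\<^sup>2 - (\<Sum>n<N. (cmod (taylor_coeff f n))\<^sup>2)"
    using hardy_norm_sq_sums[OF hardy_diff_coeff(1)[OF f S]] by (rule sums_unique2[symmetric])
qed

text \<open>
  This is the Riesz representation of the functional \<open>f \<mapsto> \<langle>T f, g\<rangle>\<close> in coordinates. The coefficients of
  the representing function are forced by the monomials; testing the functional on their own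
  truncations shows that they are square-summable.
\<close>

lemma hardy_adjoint_exists:
  assumes T: "hardy_bounded T" and g: "g \<in> hardy"
  shows "\<exists>h\<in>hardy. \<forall>f\<in>hardy. hardy_inner (T f) g = hardy_inner f h"
proof -
  obtain K where op: "hardy_operator T" and K: "K \<ge> 0" "\<And>f. f \<in> hardy \<Longrightarrow> hardy_norm (T f) \<le> K * hardy_norm f"
    using T unfolding hardy_bounded_def by blast
  have bd: "cmod (hardy_inner (T f) g) \<le> K * hardy_norm g * hardy_norm f" if f: "f \<in> hardy" for f
  proof -
    have "cmod (hardy_inner (T f) g) \<le> hardy_norm (T f) * hardy_norm g"
      by (intro hardy_cauchy_schwarz g hardy_operatorD(1)[OF op] f)
    also have "\<dots> \<le> (K * hardy_norm f) * hardy_norm g" by (intro mult_right_mono K f hardy_norm_nonneg g)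
    finally show ?thesis by (simp add: mult_ac)
  qed
  define b where "b n = cnj (hardy_inner (T (hardy_monomial n)) g)" for n
  have fin: "hardy_inner (T (\<Sum>n<N. cscale (a n) (hardy_monomial n))) g = (\<Sum>n<N. a n * cnj (b n))" for a and N :: nat
    by (simp add: hardy_operator_sum[OF op] hardy_inner_sum_left hardy_operatorD(1)[OF op] g b_def)
  have sq: "(\<Sum>n<N. (cmod (b n))\<^sup>2) \<le> (K * hardy_norm g)\<^sup>2" for N
  proof -
    let ?u = "\<Sum>n<N. cscale (b n) (hardy_monomial n)"
    let ?a = "\<lambda>n. if n < N then b n else 0"
    have ss: "square_summable ?a" by (rule square_summable_finite[of N]) auto
    have u: "?u = (\<Sum>n<N. cscale (taylor_coeff (of_coeffs ?a) n) (hardy_monomial n))"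
      by (intro sum.cong refl) (simp add: taylor_coeff_of_coeffs[OF ss])
    have un: "(hardy_norm ?u)\<^sup>2 = (\<Sum>n<N. (cmod (b n))\<^sup>2)"
    proof -
      have "(hardy_norm ?u)\<^sup>2 = (\<Sum>n<N. (cmod (taylor_coeff (of_coeffs ?a) n))\<^sup>2)"
        by (subst u) (rule hardy_norm_sq_truncation(1)[OF of_coeffs_in_hardy[OF ss]])
      then show ?thesis by (simp add: taylor_coeff_of_coeffs[OF ss])
    qed
    have uh: "?u \<in> hardy" by (auto intro!: hardy_sum_closed hardy_cscale_closed)
    have "complex_of_real ((hardy_norm ?u)\<^sup>2) = hardy_inner (T ?u) g"
      unfolding un fin of_real_sum complex_norm_square ..
    then have "(hardy_norm ?u)\<^sup>2 = cmod (hardy_inner (T ?u) g)"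
      by (metis abs_of_nonneg norm_of_real zero_le_power2)
    also have "\<dots> \<le> K * hardy_norm g * hardy_norm ?u" by (rule bd[OF uh])
    finally have "hardy_norm ?u \<le> K * hardy_norm g"
      using hardy_norm_nonneg[OF uh] K(1) hardy_norm_nonneg[OF g]
      by (cases "hardy_norm ?u = 0") (auto simp: power2_eq_square)
    then show ?thesis unfolding un[symmetric] using hardy_norm_nonneg[OF uh] by (intro power_mono) auto
  qed
  have ssb: "square_summable b"
    unfolding square_summable_def
  proof (rule bounded_imp_summable)
    show "(\<Sum>n\<le>N. (cmod (b n))\<^sup>2) \<le> (K * hardy_norm g)\<^sup>2" for N
      using sq[of "Suc N"] by (simp only: lessThan_Suc_atMost)
  qed simp
  define h where "h = of_coeffs b"
  have h: "h \<in> hardy" and hc: "taylor_coeff h n = b n" for n using ssb by (auto simp: h_def of_coeffs_in_hardy)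
  have "hardy_inner (T f) g = hardy_inner f h" if f: "f \<in> hardy" for f
  proof -
    let ?S = "\<lambda>N. \<Sum>n<N. cscale (taylor_coeff f n) (hardy_monomial n)"
    have S: "?S N \<in> hardy" for N by (auto intro!: hardy_sum_closed hardy_cscale_closed)
    have lim1: "(\<lambda>N. hardy_inner (T (?S N)) g) \<longlonglongrightarrow> hardy_inner f h"
      unfolding fin using hardy_inner_sums[OF f h] by (simp add: hc sums_def)
    have "(\<lambda>N. (hardy_norm (f - ?S N))\<^sup>2) \<longlonglongrightarrow> (hardy_norm f)\<^sup>2 - (hardy_norm f)\<^sup>2"
      unfolding hardy_norm_sq_truncation(2)[OF f]
      by (intro tendsto_diff tendsto_const) (use hardy_norm_sq_sums[OF f] in \<open>simp add: sums_def\<close>)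
    then have "(\<lambda>N. sqrt ((hardy_norm (f - ?S N))\<^sup>2)) \<longlonglongrightarrow> sqrt 0"
      by (intro tendsto_real_sqrt) simp
    then have "(\<lambda>N. hardy_norm (f - ?S N)) \<longlonglongrightarrow> 0"
      by (simp add: hardy_norm_nonneg hardy_diff_coeff(1)[OF f S])
    then have "(\<lambda>N. K * hardy_norm g * hardy_norm (f - ?S N)) \<longlonglongrightarrow> 0"
      by (rule tendsto_mult_right_zero)
    then have lim2: "(\<lambda>N. hardy_inner (T (f - ?S N)) g) \<longlonglongrightarrow> 0"
      by (rule Lim_null_comparison[rotated]) (intro always_eventually allI bd hardy_diff_coeff(1)[OF f S])
    have "hardy_inner (T f) g = hardy_inner (T (?S N)) g + hardy_inner (T (f - ?S N)) g" for N
    proof -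
      have "T f = T (?S N + (f - ?S N))" by (rule arg_cong[of _ _ T]) (simp add: algebra_simps)
      also have "\<dots> = T (?S N) + T (f - ?S N)" by (intro hardy_operatorD(2)[OF op] S hardy_diff_coeff(1)[OF f S])
      finally show ?thesis by (simp only: hardy_inner_add_left hardy_operatorD(1)[OF op] S hardy_diff_coeff(1)[OF f S] g)
    qed
    then have "(\<lambda>N. hardy_inner (T f) g) \<longlonglongrightarrow> hardy_inner f h + 0"
      using tendsto_add[OF lim1 lim2] by simp
    then show ?thesis by (simp add: LIMSEQ_const_iff)
  qed
  with h show ?thesis by blast
qed

text \<open>
  The definite description in \<open>hardy_adjoint\<close> denotes: existence is Riesz representation, uniqueness holds
  because the monomials separate points.
\<close>

lemma hardy_adjoint:
  assumes T: "hardy_bounded T" and g: "g \<in> hardy"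
  shows "hardy_adjoint T g \<in> hardy" "\<And>f. f \<in> hardy \<Longrightarrow> hardy_inner f (hardy_adjoint T g) = hardy_inner (T f) g"
proof -
  obtain h where h: "h \<in> hardy" "\<And>f. f \<in> hardy \<Longrightarrow> hardy_inner (T f) g = hardy_inner f h"
    using hardy_adjoint_exists[OF T g] by blast
  have "hardy_adjoint T g = h" unfolding hardy_adjoint_def
  proof (rule the_equality)
    fix h' assume h': "h' \<in> hardy \<and> (\<forall>f\<in>hardy. hardy_inner (T f) g = hardy_inner f h')"
    show "h' = h" by (rule hardy_inner_nondegenerate) (use h h' in auto)
  qed (use h in blast)
  with h show "hardy_adjoint T g \<in> hardy" "\<And>f. f \<in> hardy \<Longrightarrow> hardy_inner f (hardy_adjoint T g) = hardy_inner (T f) g"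
    by auto
qed

text \<open>
  A weak form of the eigenvalue equation, linear in \<open>f\<close>, that mentions \<open>T\<close> but not its adjoint.
\<close>

lemma eigenspace_iff:
  assumes T: "hardy_bounded T"
  shows "f \<in> hardy_eigenspace (hardy_adjoint T \<circ> T) (complex_of_real c) \<longleftrightarrow>
    f \<in> hardy \<and> (\<forall>g\<in>hardy. hardy_inner (T g) (T f) = complex_of_real c * hardy_inner g f)"
proof (cases "f \<in> hardy")
  case f: True
  have op: "hardy_operator T" using T by (simp add: hardy_bounded_def)
  note Tf = hardy_operatorD(1)[OF op f]
  show ?thesis
  proof
    assume "f \<in> hardy_eigenspace (hardy_adjoint T \<circ> T) (complex_of_real c)"
    then have e: "hardy_adjoint T (T f) = cscale (complex_of_real c) f" by (simp add: hardy_eigenspace_def)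
    show "f \<in> hardy \<and> (\<forall>g\<in>hardy. hardy_inner (T g) (T f) = complex_of_real c * hardy_inner g f)"
      using f by (auto simp: hardy_adjoint(2)[OF T Tf, symmetric] e hardy_inner_cscale_right)
  next
    assume r: "f \<in> hardy \<and> (\<forall>g\<in>hardy. hardy_inner (T g) (T f) = complex_of_real c * hardy_inner g f)"
    have "hardy_adjoint T (T f) = cscale (complex_of_real c) f"
      by (rule hardy_inner_nondegenerate)
         (use r f in \<open>auto simp: hardy_adjoint[OF T Tf] hardy_cscale_closed hardy_inner_cscale_right\<close>)
    then show "f \<in> hardy_eigenspace (hardy_adjoint T \<circ> T) (complex_of_real c)"
      using f by (simp add: hardy_eigenspace_def)
  qed
qed (auto simp: hardy_eigenspace_def)

lemma subspace_eigenspace: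
  assumes T: "hardy_bounded T"
  shows "cfun.subspace (hardy_eigenspace (hardy_adjoint T \<circ> T) (complex_of_real c))"
proof -
  have op: "hardy_operator T" using T by (simp add: hardy_bounded_def)
  note D = hardy_operatorD[OF op]
  have z: "T 0 = 0" using D(3)[OF zero_in_hardy, of 0] by simp
  show ?thesis
  proof (rule cfun.subspaceI, unfold eigenspace_iff[OF T])
    show "0 \<in> hardy \<and> (\<forall>g\<in>hardy. hardy_inner (T g) (T 0) = complex_of_real c * hardy_inner g 0)"
      by (auto simp: zero_in_hardy z) (simp_all add: hardy_inner_def)
  qed (auto simp: hardy_add_closed hardy_cscale_closed D hardy_inner_add_right hardy_inner_cscale_right algebra_simps
       simp del: cfun.scale_minus_left)
qed

section \<open>Orthonormal families and singular numbers\<close>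

text \<open>
  Let \<open>c y\<close> be the number of values at least \<open>y\<close>, counted with multiplicity; the bound makes it finite
  for \<open>y > 0\<close>. The decreasing rearrangement is characterised by \<open>y \<le> s n \<longleftrightarrow> n < c y\<close>, and every claim about
  \<open>s\<close> can be read off from this equivalence. For instance, \<open>s n = x\<close> holds exactly when \<open>n\<close> lies between
  the counts of values above \<open>x\<close> and of values at least \<open>x\<close>.
\<close>

lemma decreasing_rearrangement_of_multiplicities:
  fixes N :: "real \<Rightarrow> nat"
  assumes p: "p > 0"
    and bound: "\<And>X. finite X \<Longrightarrow> X \<subseteq> {0<..} \<Longrightarrow> (\<Sum>x\<in>X. real (N x) * x powr p) \<le> S"
  obtains s :: "nat \<Rightarrow> real" where "decseq s" "\<And>n. 0 \<le> s n"
    "\<And>x. x > 0 \<Longrightarrow> finite {n. s n = x} \<and> card {n. s n = x} = N x"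
    "summable (\<lambda>n. s n powr p)"
proof -
  define P where "P y = {x. y \<le> x \<and> N x > 0}" for y
  have finP: "finite (P y)" if y: "y > 0" for y
  proof -
    have "finite (P y) \<and> card (P y) \<le> nat \<lfloor>S / y powr p\<rfloor>"
    proof (rule finite_if_finite_subsets_card_bdd)
      fix G assume G: "G \<subseteq> P y" "finite G"
      have "real (card G) * y powr p = (\<Sum>x\<in>G. 1 * y powr p)" by simp
      also have "\<dots> \<le> (\<Sum>x\<in>G. real (N x) * x powr p)"
        using G y p by (intro sum_mono mult_mono powr_mono2) (auto simp: P_def)
      also have "\<dots> \<le> S" using G y by (intro bound) (auto simp: P_def)
      finally have "real (card G) \<le> S / y powr p" using y by (simp add: field_simps)
      then show "card G \<le> nat \<lfloor>S / y powr p\<rfloor>" by (simp add: le_nat_floor)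
    qed
    then show ?thesis ..
  qed
  define c where "c y = (\<Sum>x\<in>P y. N x)" for y
  have P_anti: "P y \<subseteq> P x" if "x \<le> y" for x y using that by (auto simp: P_def)
  have c_anti: "c y \<le> c x" if "0 < x" "x \<le> y" for x y
    unfolding c_def using that by (intro sum_mono2 finP P_anti) auto
  have P_Min: "P (Min (P y)) = P y" "Min (P y) \<in> P y" if "y > 0" "P y \<noteq> {}" for y
  proof -
    show m: "Min (P y) \<in> P y" using that finP by (intro Min_in) auto
    define m where "m = Min (P y)"
    have "m \<in> P y" "\<And>x. x \<in> P y \<Longrightarrow> m \<le> x"
      using m Min_le[OF finP[OF that(1)]] by (auto simp: m_def)
    then have "P m = P y" by (auto simp: P_def)
    then show "P (Min (P y)) = P y" by (simp add: m_def)
  qed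
  \<comment> \<open>The supremum of all \<open>y\<close> with \<open>n < c y\<close> is attained, because \<open>c\<close> only jumps at points of finite sets \<open>P y\<close>.\<close>
  have "\<exists>s\<ge>0. \<forall>y>0. y \<le> s \<longleftrightarrow> n < c y" for n
  proof (cases "\<exists>y>0. n < c y")
    case False
    then show ?thesis by (intro exI[of _ 0]) auto
  next
    case True
    then obtain y0 where y0: "y0 > 0" "n < c y0" by blast
    define A where "A = {x \<in> P y0. n < c x}"
    have ne: "P y \<noteq> {}" if "n < c y" for y using that by (auto simp: c_def)
    have finA: "finite A" unfolding A_def using finP[OF y0(1)] by simp
    have "Min (P y0) \<in> A" using P_Min[OF y0(1) ne[OF y0(2)]] y0(2) by (simp add: A_def c_def)
    then have "Max A \<in> A" using finA by (intro Max_in) auto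
    then have Mpos: "Max A > 0" "n < c (Max A)" "y0 \<le> Max A" using y0(1) by (auto simp: A_def P_def)
    show ?thesis
    proof (intro exI[of _ "Max A"] conjI allI impI iffI)
      fix y :: real assume y: "y > 0" "y \<le> Max A"
      then show "n < c y" using c_anti[OF y] Mpos by simp
    next
      fix y :: real assume y: "y > 0" "n < c y"
      have m: "P (Min (P y)) = P y" "Min (P y) \<in> P y" using P_Min[OF y(1) ne[OF y(2)]] .
      show "y \<le> Max A"
      proof (rule ccontr)
        assume lt: "\<not> y \<le> Max A"
        then have "Min (P y) \<in> A" using m y Mpos unfolding A_def c_def by (auto simp: P_def)
        then have "Min (P y) \<le> Max A" using finA by simp
        then show False using m(2) lt by (simp add: P_def)
      qed
    qed (use Mpos in simp)
  qed
  then obtain s where s0: "\<And>n. 0 \<le> s n" and s: "\<And>n y. y > 0 \<Longrightarrow> y \<le> s n \<longleftrightarrow> n < c y"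
    by metis
  have dec: "decseq s"
  proof (rule decseq_SucI)
    fix n show "s (Suc n) \<le> s n"
      using s[of "s (Suc n)" "Suc n"] s[of "s (Suc n)" n] s0[of n] s0[of "Suc n"]
      by (cases "s (Suc n) = 0") auto
  qed
  have card: "finite {n. s n = x} \<and> card {n. s n = x} = N x" if x: "x > 0" for x
  proof -
    define P' where "P' = {y \<in> P x. y > x}"
    have finP': "finite P'" unfolding P'_def using finP[OF x] by simp
    define c' where "c' = (\<Sum>y\<in>P'. N y)"
    have gt: "s n > x \<longleftrightarrow> n < c'" for n
    proof
      assume sx: "s n > x"
      then have "n < c (s n)" using x s[of "s n" n] by simp
      also have "c (s n) \<le> c'" unfolding c_def c'_def
        using sx finP' by (intro sum_mono2) (auto simp: P_def P'_def)
      finally show "n < c'" .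
    next
      assume n: "n < c'"
      then have ne: "P' \<noteq> {}" by (auto simp: c'_def)
      define z where "z = Min P'"
      have z: "z \<in> P'" unfolding z_def using ne finP' by simp
      then have zx: "z > x" by (simp add: P'_def)
      have "z \<le> y" if "y \<in> P'" for y using Min_le[OF finP' that] by (simp add: z_def)
      then have "P z = P'" using z by (auto simp: P_def P'_def)
      then have "n < c z" using n by (simp add: c_def c'_def)
      then show "s n > x" using s[of z n] zx x by simp
    qed
    have "c x = c' + N x"
    proof (cases "N x > 0")
      case True
      then have "P x = insert x P'" "x \<notin> P'" unfolding P_def P'_def by auto
      then show ?thesis using finP' by (simp add: c_def c'_def)
    next
      case False
      then have "P x = P'" unfolding P_def P'_def by (auto simp: order.order_iff_strict)
      then show ?thesis using False by (simp add: c_def c'_def)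
    qed
    moreover have "{n. s n = x} = {c'..<c x}"
    proof (rule set_eqI)
      fix n
      have "s n = x \<longleftrightarrow> x \<le> s n \<and> \<not> x < s n" by auto
      then show "n \<in> {n. s n = x} \<longleftrightarrow> n \<in> {c'..<c x}" unfolding gt s[OF x] by auto
    qed
    ultimately show ?thesis by simp
  qed
  have "summable (\<lambda>n. s n powr p)"
  proof (rule bounded_imp_summable)
    fix K
    let ?A = "{n \<in> {..K}. s n > 0}"
    have "(\<Sum>n\<le>K. s n powr p) = (\<Sum>n\<in>?A. s n powr p)"
      using s0 by (intro sum.mono_neutral_right) (auto simp: order.order_iff_strict)
    also have "\<dots> = (\<Sum>x\<in>s ` ?A. \<Sum>n\<in>{n \<in> ?A. s n = x}. s n powr p)"
      by (rule sum.image_gen) simp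
    also have "\<dots> = (\<Sum>x\<in>s ` ?A. real (card {n \<in> ?A. s n = x}) * x powr p)"
      by (intro sum.cong refl) simp
    also have "\<dots> \<le> (\<Sum>x\<in>s ` ?A. real (N x) * x powr p)"
    proof (intro sum_mono mult_right_mono)
      fix x assume "x \<in> s ` ?A"
      then have x: "x > 0" by auto
      have "card {n \<in> ?A. s n = x} \<le> card {n. s n = x}"
        using card[OF x] by (intro card_mono) auto
      then show "real (card {n \<in> ?A. s n = x}) \<le> real (N x)" using card[OF x] by simp
    qed simp
    also have "\<dots> \<le> S" by (intro bound) auto
    finally show "(\<Sum>n\<le>K. s n powr p) \<le> S" .
  qed simp
  then show ?thesis using that dec s0 card by blast
qed

definition hardy_orthonormal :: "'i set \<Rightarrow> ('i \<Rightarrow> complex \<Rightarrow> complex) \<Rightarrow> bool" where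
  "hardy_orthonormal J e \<longleftrightarrow> (\<forall>i\<in>J. e i \<in> hardy) \<and>
     (\<forall>i\<in>J. \<forall>j\<in>J. hardy_inner (e i) (e j) = (if i = j then 1 else 0))"

text \<open>
  One Gram-Schmidt step at a time: as long as fewer than \<open>card B\<close> vectors have been chosen, they cannot
  span \<open>B\<close>, and the part of a missing basis vector orthogonal to them can be normalised. For infinite
  \<open>B\<close> the value \<open>card B = 0\<close> leaves only the trivial case, which matches the convention for \<open>cfun.dim\<close>.
\<close>

lemma gram_schmidt_in_subspace:
  assumes V: "cfun.subspace V" "V \<subseteq> hardy" and B: "B \<subseteq> V" "cfun.independent B" and n: "n \<le> card B"
  shows "\<exists>e. hardy_orthonormal {..<n} e \<and> (\<forall>i<n. e i \<in> V)"
  using n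
proof (induction n)
  case 0 then show ?case by (simp add: hardy_orthonormal_def)
next
  case (Suc n)
  then obtain e where e: "hardy_orthonormal {..<n} e" "\<And>i. i < n \<Longrightarrow> e i \<in> V" by auto
  have eh: "e i \<in> hardy" if "i < n" for i using e(2)[OF that] V by auto
  have "\<not> B \<subseteq> cfun.span (e ` {..<n})"
  proof
    assume "B \<subseteq> cfun.span (e ` {..<n})"
    then have "card B \<le> card (e ` {..<n})" using cfun.independent_span_bound[OF _ B(2)] by blast
    also have "\<dots> \<le> n" using card_image_le[of "{..<n}" e] by simp
    finally show False using Suc.prems by simp
  qed
  then obtain b where b: "b \<in> B" "b \<notin> cfun.span (e ` {..<n})" by blast
  have bV: "b \<in> V" and bh: "b \<in> hardy" using b B V by auto
  define w where "w = (\<Sum>i<n. cscale (hardy_inner b (e i)) (e i))"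
  have wV: "w \<in> V" unfolding w_def using e(2) by (intro cfun.subspace_sum V cfun.subspace_scale) auto
  have wh: "w \<in> hardy" using wV V by auto
  have wsp: "w \<in> cfun.span (e ` {..<n})"
    unfolding w_def by (intro cfun.span_sum cfun.span_scale cfun.span_base) auto
  define v where "v = b + cscale (-1) w"
  have vV: "v \<in> V" unfolding v_def by (intro cfun.subspace_add V bV cfun.subspace_scale wV)
  have vh: "v \<in> hardy" using vV V by auto
  have "v \<noteq> 0"
  proof
    assume "v = 0"
    then have "b = w" by (simp add: v_def)
    then show False using b wsp by simp
  qed
  then have nv: "hardy_norm v > 0" using hardy_norm_eq_0[OF vh] hardy_norm_nonneg[OF vh] by fastforce
  have orth: "hardy_inner v (e j) = 0" if j: "j < n" for j
  proof -
    have "hardy_inner w (e j) = (\<Sum>i<n. hardy_inner b (e i) * hardy_inner (e i) (e j))"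
      unfolding w_def by (rule hardy_inner_sum_left) (use eh j in auto)
    also have "\<dots> = (\<Sum>i<n. hardy_inner b (e i) * (if i = j then 1 else 0))"
      using e(1) j by (intro sum.cong refl) (auto simp: hardy_orthonormal_def)
    also have "\<dots> = hardy_inner b (e j)" using j by (simp add: if_distrib sum.delta cong: if_cong)
    finally show ?thesis unfolding v_def
      by (subst hardy_inner_add_left) (auto simp: bh hardy_cscale_closed wh eh[OF j] hardy_inner_cscale_left simp del: cfun.scale_minus_left)
  qed
  define u where "u = cscale (of_real (1 / hardy_norm v)) v"
  have uV: "u \<in> V" unfolding u_def by (intro V cfun.subspace_scale vV)
  have uh: "u \<in> hardy" using uV V by auto
  have u_e: "hardy_inner u (e j) = 0" if j: "j < n" for j
    unfolding u_def by (simp add: hardy_inner_cscale_left vh eh[OF j] orth[OF j])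
  have e_u: "hardy_inner (e j) u = 0" if j: "j < n" for j
    using hardy_inner_cnj[OF uh eh[OF j]] u_e[OF j] by simp
  have uu: "hardy_inner u u = 1"
  proof -
    have "hardy_inner u u = of_real (1 / hardy_norm v) * (cnj (of_real (1 / hardy_norm v)) * hardy_inner v v)"
      unfolding u_def hardy_inner_cscale_left[OF vh hardy_cscale_closed[OF vh]] hardy_inner_cscale_right[OF vh vh] ..
    then show ?thesis using nv by (simp add: hardy_inner_self[OF vh] power2_eq_square)
  qed
  show ?case
    by (intro exI[of _ "e(n := u)"]) (use e eh uV uh u_e e_u uu in \<open>auto simp: hardy_orthonormal_def less_Suc_eq\<close>)
qed

lemma hardy_norm_eigenvector:
  assumes T: "hardy_bounded T" and f: "f \<in> hardy_eigenspace (hardy_adjoint T \<circ> T) (complex_of_real (x\<^sup>2))"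
    and x: "x \<ge> 0" and nf: "hardy_inner f f = 1"
  shows "hardy_norm (T f) = x"
proof -
  have op: "hardy_operator T" using T by (simp add: hardy_bounded_def)
  have fh: "f \<in> hardy" using f by (simp add: hardy_eigenspace_def)
  note Tf = hardy_operatorD(1)[OF op fh]
  have "hardy_inner (T f) (T f) = complex_of_real (x\<^sup>2)"
    using f nf fh unfolding eigenspace_iff[OF T] by auto
  then have "(hardy_norm (T f))\<^sup>2 = x\<^sup>2" unfolding hardy_inner_self[OF Tf] of_real_eq_iff .
  then show ?thesis using x hardy_norm_nonneg[OF Tf] by simp
qed

lemma eigenvectors_orthogonal:
  assumes T: "hardy_bounded T" and "x > 0" "y > 0" "x \<noteq> y"
    and f: "f \<in> hardy_eigenspace (hardy_adjoint T \<circ> T) (complex_of_real (x\<^sup>2))"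
    and g: "g \<in> hardy_eigenspace (hardy_adjoint T \<circ> T) (complex_of_real (y\<^sup>2))"
  shows "hardy_inner g f = 0"
proof -
  have op: "hardy_operator T" using T by (simp add: hardy_bounded_def)
  have fh: "f \<in> hardy" and gh: "g \<in> hardy" using f g by (auto simp: hardy_eigenspace_def)
  note Tf = hardy_operatorD(1)[OF op fh] and Tg = hardy_operatorD(1)[OF op gh]
  have 1: "hardy_inner (T g) (T f) = complex_of_real (x\<^sup>2) * hardy_inner g f"
    using f gh unfolding eigenspace_iff[OF T] by blast
  have 2: "hardy_inner (T f) (T g) = complex_of_real (y\<^sup>2) * hardy_inner f g"
    using g fh unfolding eigenspace_iff[OF T] by blast
  have "hardy_inner (T g) (T f) = complex_of_real (y\<^sup>2) * hardy_inner g f"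
    unfolding hardy_inner_cnj[OF Tf Tg] 2 hardy_inner_cnj[OF fh gh] by simp
  with 1 have "complex_of_real (x\<^sup>2) * hardy_inner g f = complex_of_real (y\<^sup>2) * hardy_inner g f" by (rule subst)
  moreover have "x\<^sup>2 \<noteq> y\<^sup>2" using assms(2-4) by (simp add: power2_eq_iff_nonneg)
  ultimately show ?thesis by (simp del: of_real_power)
qed

text \<open>
  Orthonormal bases of finitely many eigenspaces of \<open>T\<^sup>*T\<close> combine to one orthonormal family, on which
  \<open>\<parallel>T e\<parallel>\<close> is the square root of the eigenvalue. The hypothesis thus bounds \<open>\<Sum>\<^sub>x N(x) x\<^sup>p\<close> over finite sets of
  \<open>x\<close>, with \<open>N(x)\<close> the multiplicity of \<open>x\<^sup>2\<close>, and rearranging the multiplicities in decreasing order yields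
  the sequence of singular numbers. Pairs index the families since an eigenvector is given by \<open>x\<close> and a
  position within the eigenspace.
\<close>

lemma singular_numbers_of_orthonormal_bound:
  assumes T: "hardy_bounded T" and p: "p > 0"
    and bound: "\<And>(J::(real \<times> nat) set) e. finite J \<Longrightarrow> hardy_orthonormal J e \<Longrightarrow> (\<Sum>j\<in>J. hardy_norm (T (e j)) powr p) \<le> S"
  shows "\<exists>s. singular_numbers T s \<and> summable (\<lambda>n. s n powr p)"
proof -
  define V where "V x = hardy_eigenspace (hardy_adjoint T \<circ> T) (complex_of_real (x\<^sup>2))" for x :: real
  define N where "N x = cfun.dim (V x)" for x
  have "\<exists>e. hardy_orthonormal {..<N x} e \<and> (\<forall>i<N x. e i \<in> V x)" for x
  proof -
    obtain B where B: "B \<subseteq> V x" "cfun.independent B" "card B = cfun.dim (V x)"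
      using cfun.basis_exists by metis
    show ?thesis
      by (rule gram_schmidt_in_subspace[OF _ _ B(1,2)])
         (auto simp: V_def N_def B(3)[unfolded V_def] subspace_eigenspace[OF T] simp del: of_real_power, auto simp: hardy_eigenspace_def)
  qed
  then obtain e where e: "\<And>x. hardy_orthonormal {..<N x} (e x)" "\<And>x i. i < N x \<Longrightarrow> e x i \<in> V x"
    by metis
  have bd: "(\<Sum>x\<in>X. real (N x) * x powr p) \<le> S" if X: "finite X" "X \<subseteq> {0<..}" for X
  proof -
    define J where "J = (SIGMA x:X. {..<N x})"
    have J: "finite J" using X by (simp add: J_def)
    have on: "hardy_orthonormal J (\<lambda>(x, i). e x i)"
      unfolding hardy_orthonormal_def
    proof (intro conjI ballI)
      fix i assume "i \<in> J" then show "(case i of (x, i) \<Rightarrow> e x i) \<in> hardy"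
        using e(2) by (auto simp: J_def V_def hardy_eigenspace_def)
    next
      fix i j assume i: "i \<in> J" and j: "j \<in> J"
      obtain x k y l where ij: "i = (x, k)" "j = (y, l)" by force
      then have *: "x \<in> X" "y \<in> X" "k < N x" "l < N y" using i j by (auto simp: J_def)
      show "hardy_inner (case i of (x, i) \<Rightarrow> e x i) (case j of (x, i) \<Rightarrow> e x i) = (if i = j then 1 else 0)"
      proof (cases "x = y")
        case True
        then show ?thesis using e(1)[of x] * by (simp add: ij hardy_orthonormal_def)
      next
        case False
        have "hardy_inner (e x k) (e y l) = 0"
          by (rule eigenvectors_orthogonal[OF T, of y x]) (use * X False e(2) in \<open>auto simp: V_def simp del: of_real_power\<close>)
        then show ?thesis using False by (simp add: ij)
      qed
    qed
    have "(\<Sum>x\<in>X. real (N x) * x powr p) = (\<Sum>x\<in>X. \<Sum>i<N x. hardy_norm (T (e x i)) powr p)"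
    proof (rule sum.cong[OF refl])
      fix x assume x: "x \<in> X"
      have "hardy_norm (T (e x i)) = x" if "i < N x" for i
        by (rule hardy_norm_eigenvector[OF T]) (use x X e(1)[of x] e(2)[OF that] that in \<open>auto simp: V_def hardy_orthonormal_def simp del: of_real_power\<close>)
      then show "real (N x) * x powr p = (\<Sum>i<N x. hardy_norm (T (e x i)) powr p)" by simp
    qed
    also have "\<dots> = (\<Sum>j\<in>J. hardy_norm (T ((\<lambda>(x, i). e x i) j)) powr p)"
      unfolding J_def using X by (subst sum.Sigma) (auto simp: case_prod_unfold)
    also have "\<dots> \<le> S" by (rule bound[OF J on])
    finally show ?thesis .
  qed
  obtain s :: "nat \<Rightarrow> real" where "decseq s" "\<And>n. 0 \<le> s n" "\<And>x. x > 0 \<Longrightarrow> finite {n. s n = x} \<and> card {n. s n = x} = N x"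
    "summable (\<lambda>n. s n powr p)"
    using decreasing_rearrangement_of_multiplicities[OF p bd] by metis
  then show ?thesis unfolding singular_numbers_def N_def V_def by blast
qed

section \<open>Non-tangential limits from boundary derivatives\<close>

text \<open>
  Subtracting the reflected kernel, with pole \<open>1 / cnj z\<close> outside the disc, improves the decay of the
  Cauchy kernel \<open>1 / (w - z)\<^sup>2\<close> by the factor \<open>2 (1 - |z|\<^sup>2) / |w - z|\<close>: on the circle \<open>|1 - cnj z w| = |w - z|\<close>, and
  the numerator of the difference factors as \<open>((1 - cnj z w) - cnj z (w - z)) (1 - |z|\<^sup>2)\<close>.
\<close>

lemma reflected_cauchy_kernel_bound:
  fixes z w :: complex
  assumes w: "cmod w = 1" and z: "cmod z < 1"
  shows "cmod (1 / (w - z)\<^sup>2 - (cnj z)\<^sup>2 / (1 - cnj z * w)\<^sup>2) \<le> 2 * (1 - (cmod z)\<^sup>2) / cmod (w - z) ^ 3"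
proof -
  have ww: "w * cnj w = 1" using w by (simp add: complex_norm_square[symmetric])
  have wz: "w - z \<noteq> 0" using w z by auto
  have e1: "1 - cnj z * w = w * cnj (w - z)" using ww by (simp add: algebra_simps)
  have n1: "cmod (1 - cnj z * w) = cmod (w - z)" using w unfolding e1 norm_mult by (simp del: complex_cnj_diff)
  have nz: "1 - cnj z * w \<noteq> 0" using n1 wz by auto
  define x where "x = cnj z"
  have zz: "complex_of_real (1 - (cmod z)\<^sup>2) = 1 - x * z"
    unfolding x_def by (metis complex_norm_square of_real_1 of_real_diff mult.commute)
  have "1 / (w - z)\<^sup>2 - x\<^sup>2 / (1 - x * w)\<^sup>2 = ((1 - x * w) - x * (w - z)) * (1 - x * z) / ((w - z)\<^sup>2 * (1 - x * w)\<^sup>2)"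
    using wz nz unfolding x_def[symmetric] by (simp add: divide_simps) (simp add: algebra_simps power2_eq_square)
  then have "cmod (1 / (w - z)\<^sup>2 - x\<^sup>2 / (1 - x * w)\<^sup>2)
      = cmod ((1 - x * w) - x * (w - z)) * cmod (complex_of_real (1 - (cmod z)\<^sup>2)) / ((cmod (w - z))\<^sup>2 * (cmod (w - z))\<^sup>2)"
    by (simp only: zz norm_divide norm_mult norm_power n1[folded x_def])
  also have "cmod (complex_of_real (1 - (cmod z)\<^sup>2)) = 1 - (cmod z)\<^sup>2"
    unfolding norm_of_real using z by (simp add: abs_square_le_1)
  also have "(cmod (w - z))\<^sup>2 * (cmod (w - z))\<^sup>2 = cmod (w - z) ^ 4" by (simp flip: power_add)
  also have "cmod ((1 - x * w) - x * (w - z)) * (1 - (cmod z)\<^sup>2) / cmod (w - z) ^ 4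
      \<le> (2 * cmod (w - z)) * (1 - (cmod z)\<^sup>2) / (cmod (w - z)) ^ 4"
  proof (intro divide_right_mono mult_right_mono)
    have "cmod ((1 - x * w) - x * (w - z)) \<le> cmod (1 - x * w) + cmod x * cmod (w - z)"
      by (metis norm_mult norm_triangle_ineq4)
    also have "\<dots> \<le> cmod (w - z) + 1 * cmod (w - z)"
      using n1 z unfolding x_def by (intro add_mono mult_right_mono) auto
    finally show "cmod ((1 - x * w) - x * (w - z)) \<le> 2 * cmod (w - z)" by simp
  qed (use z in \<open>auto simp: abs_square_le_1\<close>)
  also have "\<dots> = 2 * (1 - (cmod z)\<^sup>2) / cmod (w - z) ^ 3"
    using wz by (simp add: divide_simps eval_nat_numeral)
  finally show ?thesis unfolding x_def .
qed

lemma has_contour_integral_unit_circle: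
  "(f has_contour_integral I) (circlepath 0 1) \<longleftrightarrow>
   ((\<lambda>t. 2 * of_real pi * \<i> * (f (cis (2 * pi * t)) * cis (2 * pi * t))) has_integral I) {0..1}"
proof -
  have "circlepath 0 1 t = cis (2 * pi * t)" for t
    by (simp add: circlepath cis_conv_exp mult_ac)
  moreover have "exp (2 * complex_of_real pi * \<i> * complex_of_real t) = cis (2 * pi * t)" for t
    by (simp add: cis_conv_exp mult_ac)
  ultimately show ?thesis
    by (subst has_contour_integral) (simp add: vector_derivative_circlepath mult_ac cong: has_integral_cong)
qed

lemma one_minus_cnj_mult_nonzero:
  assumes z: "cmod z < 1" and u: "cmod u \<le> 1"
  shows "1 - cnj z * u \<noteq> 0"
proof
  assume "1 - cnj z * u = 0"
  then have "cmod (cnj z * u) = 1" by (metis eq_iff_diff_eq_0 norm_one)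
  moreover have "cmod (cnj z * u) \<le> cmod z * 1" unfolding norm_mult using mult_left_mono[OF u, of "cmod z"] by simp
  ultimately show False using z by simp
qed

text \<open>
  On the circle \<open>|w - z|\<^sup>2 dw = (w - z) (1 - cnj z w) dw / w\<close>, so this is Cauchy's formula at \<open>z\<close> for the
  function \<open>(1 - |z|\<^sup>2) / (1 - cnj z w)\<close>, whose value at \<open>z\<close> is 1.
\<close>

lemma poisson_kernel_has_integral:
  assumes z: "cmod z < 1"
  shows "((\<lambda>t. (1 - (cmod z)\<^sup>2) / (cmod (cis (2 * pi * t) - z))\<^sup>2) has_integral 1) {0..1}"
proof -
  define P where "P t = (1 - (cmod z)\<^sup>2) / (cmod (cis (2 * pi * t) - z))\<^sup>2" for t
  have zz: "complex_of_real (1 - (cmod z)\<^sup>2) = 1 - z * cnj z"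
    by (metis complex_norm_square of_real_1 of_real_diff mult.commute)
  note nz = one_minus_cnj_mult_nonzero[OF z]
  have "((\<lambda>u. ((1 - z * cnj z) / (1 - cnj z * u)) / (u - z)) has_contour_integral
      (2 * of_real pi * \<i> * ((1 - z * cnj z) / (1 - cnj z * z)))) (circlepath 0 1)"
    by (rule Cauchy_integral_circlepath) (use z nz in \<open>auto intro!: continuous_intros holomorphic_intros\<close>)
  moreover have "1 - cnj z * z \<noteq> 0" using nz z by auto
  ultimately have "((\<lambda>u. ((1 - z * cnj z) / (1 - cnj z * u)) / (u - z)) has_contour_integral (2 * of_real pi * \<i>)) (circlepath 0 1)"
    by (simp add: mult.commute)
  then have "((\<lambda>t. 2 * of_real pi * \<i> * of_real (P t)) has_integral 2 * of_real pi * \<i>) {0..1}"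
    unfolding has_contour_integral_unit_circle
  proof (rule has_integral_eq[rotated])
    fix t :: real
    define w where "w = cis (2 * pi * t)"
    have ww: "w * cnj w = 1" by (simp add: w_def complex_norm_square[symmetric])
    have e1: "1 - cnj z * w = w * cnj (w - z)" using ww by (simp add: algebra_simps)
    have wz: "w - z \<noteq> 0" using z unfolding w_def by auto
    have w0: "w \<noteq> 0" by (simp add: w_def)
    have "(1 - z * cnj z) / (1 - cnj z * w) / (w - z) * w = (1 - z * cnj z) / ((w - z) * cnj (w - z))"
      unfolding e1 using w0 wz by (simp add: divide_simps)
    also have "\<dots> = of_real (P t)"
      unfolding P_def w_def[symmetric] of_real_divide zz complex_norm_square ..
    finally show "2 * of_real pi * \<i> * ((1 - z * cnj z) / (1 - cnj z * cis (2 * pi * t)) / (cis (2 * pi * t) - z) * cis (2 * pi * t)) = 2 * of_real pi * \<i> * of_real (P t)"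
      unfolding w_def by simp
  qed
  from has_integral_mult_right[OF this, of "1 / (2 * of_real pi * \<i>)"]
  have "((\<lambda>t. complex_of_real (P t)) has_integral 1) {0..1}" by simp
  from has_integral_linear[OF this bounded_linear_Re]
  show ?thesis by (simp add: o_def P_def)
qed

text \<open>
  Cauchy's formula for the derivative, from which a vanishing integral is subtracted: the reflected
  kernel is holomorphic in the disc.
\<close>

lemma reflected_cauchy_formula:
  assumes cont: "continuous_on (cball 0 1) \<Psi>" and hol: "\<Psi> holomorphic_on ball 0 1" and z: "cmod z < 1"
  shows "((\<lambda>t. \<Psi> (cis (2 * pi * t)) * (1 / (cis (2 * pi * t) - z)\<^sup>2 - (cnj z)\<^sup>2 / (1 - cnj z * cis (2 * pi * t))\<^sup>2)
           * cis (2 * pi * t)) has_integral deriv \<Psi> z) {0..1}"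
proof -
  note nz = one_minus_cnj_mult_nonzero[OF z]
  have zb: "z \<in> ball 0 1" using z by simp
  note c = Cauchy_derivative_integral_circlepath[OF cont hol zb]
  have "deriv \<Psi> z = 1 / (2 * of_real pi * \<i>) * contour_integral (circlepath 0 1) (\<lambda>u. \<Psi> u / (u - z)\<^sup>2)"
    using c(2) by (rule DERIV_imp_deriv)
  then have 1: "((\<lambda>u. \<Psi> u / (u - z)\<^sup>2) has_contour_integral (2 * of_real pi * \<i> * deriv \<Psi> z)) (circlepath 0 1)"
    using c(1) has_contour_integral_integral by fastforce
  \<comment> \<open>The factor \<open>u\<close> turns a vanishing integral into Cauchy's formula at the centre, where only continuity on the closed disc is required.\<close>
  have "((\<lambda>u. (\<Psi> u * u * (cnj z)\<^sup>2 / (1 - cnj z * u)\<^sup>2) / (u - 0)) has_contour_integral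
      (2 * of_real pi * \<i> * (\<Psi> 0 * 0 * (cnj z)\<^sup>2 / (1 - cnj z * 0)\<^sup>2))) (circlepath 0 1)"
    by (rule Cauchy_integral_circlepath) (use nz in \<open>auto intro!: continuous_intros holomorphic_intros cont hol\<close>)
  then have 2: "((\<lambda>u. (\<Psi> u * u * (cnj z)\<^sup>2 / (1 - cnj z * u)\<^sup>2) / (u - 0)) has_contour_integral 0) (circlepath 0 1)"
    by simp
  have "((\<lambda>u. \<Psi> u / (u - z)\<^sup>2 - (\<Psi> u * u * (cnj z)\<^sup>2 / (1 - cnj z * u)\<^sup>2) / (u - 0)) has_contour_integral
      (2 * of_real pi * \<i> * deriv \<Psi> z)) (circlepath 0 1)"
    using has_contour_integral_diff[OF 1 2] by simp
  then have "((\<lambda>t. 2 * of_real pi * \<i> * (\<Psi> (cis (2 * pi * t)) * (1 / (cis (2 * pi * t) - z)\<^sup>2 - (cnj z)\<^sup>2 / (1 - cnj z * cis (2 * pi * t))\<^sup>2)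
           * cis (2 * pi * t))) has_integral 2 * of_real pi * \<i> * deriv \<Psi> z) {0..1}"
    unfolding has_contour_integral_unit_circle
    by (rule has_integral_eq[rotated]) (simp add: right_diff_distrib left_diff_distrib)
  from has_integral_mult_right[OF this, of "1 / (2 * of_real pi * \<i>)"] show ?thesis
    by simp
qed

text \<open>
  After subtracting the first-order expansion of the primitive at \<open>\<zeta>\<close>, the remainder \<open>\<Psi>\<close> satisfies
  \<open>|\<Psi> w| \<le> \<epsilon> |w - \<zeta>|\<close> near \<open>\<zeta>\<close>, and in a Stolz region \<open>|w - \<zeta>| \<le> (1 + M) |w - z|\<close>. Against the reflected kernel,
  of size \<open>(1 - |z|\<^sup>2) / |w - z|\<^sup>3\<close>, this leaves \<open>\<epsilon>\<close> times the Poisson kernel, which has integral 1. The part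
  of the circle away from \<open>\<zeta>\<close> contributes \<open>O(1 - |z|\<^sup>2)\<close>.
\<close>

lemma nontangential_limit_of_boundary_derivative:
  assumes cont: "continuous_on (cball 0 1) \<Phi>"
    and der: "\<And>z. z \<in> ball 0 1 \<Longrightarrow> (\<Phi> has_field_derivative \<phi> z) (at z)"
    and \<zeta>: "cmod \<zeta> = 1"
    and lim: "((\<lambda>w. (\<Phi> w - \<Phi> \<zeta>) / (w - \<zeta>)) \<longlongrightarrow> \<alpha>) (at \<zeta> within sphere 0 1)"
  shows "has_nontangential_limit \<phi> \<zeta> \<alpha>"
  unfolding has_nontangential_limit_def
proof (intro allI impI)
  fix M :: real assume M: "M > 1"
  define \<Psi> where "\<Psi> u = \<Phi> u - \<Phi> \<zeta> - \<alpha> * (u - \<zeta>)" for u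
  have contP: "continuous_on (cball 0 1) \<Psi>" unfolding \<Psi>_def by (intro continuous_intros cont)
  have derP: "(\<Psi> has_field_derivative \<phi> z - \<alpha>) (at z)" if "z \<in> ball 0 1" for z
    unfolding \<Psi>_def by (rule derivative_eq_intros der that refl | simp)+
  have holP: "\<Psi> holomorphic_on ball 0 1"
    using derP by (meson field_differentiable_at_within field_differentiable_def holomorphic_on_def)
  obtain L where L: "L > 0" "\<And>u. cmod u \<le> 1 \<Longrightarrow> cmod (\<Psi> u) \<le> L"
    using compact_continuous_image[OF contP compact_cball] compact_imp_bounded
    by (metis bounded_pos imageI mem_cball_0)
  have "((\<lambda>z. \<phi> z - \<alpha>) \<longlongrightarrow> 0) (at \<zeta> within stolz_region M \<zeta>)"
  proof (rule tendstoI)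
    fix e :: real assume e: "e > 0"
    define \<epsilon> where "\<epsilon> = e / (4 * (1 + M))"
    have \<epsilon>: "\<epsilon> > 0" using e M by (simp add: \<epsilon>_def)
    obtain \<delta> where \<delta>: "\<delta> > 0" "\<And>w. w \<in> sphere 0 1 \<Longrightarrow> w \<noteq> \<zeta> \<Longrightarrow> dist w \<zeta> < \<delta> \<Longrightarrow> dist ((\<Phi> w - \<Phi> \<zeta>) / (w - \<zeta>)) \<alpha> < \<epsilon>"
      using tendstoD[OF lim \<epsilon>] unfolding eventually_at by blast
    have near: "cmod (\<Psi> w) \<le> \<epsilon> * cmod (w - \<zeta>)" if "cmod w = 1" "cmod (w - \<zeta>) < \<delta>" for w
    proof (cases "w = \<zeta>")
      case False
      then have eq: "\<Psi> w = ((\<Phi> w - \<Phi> \<zeta>) / (w - \<zeta>) - \<alpha>) * (w - \<zeta>)"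
        by (simp add: \<Psi>_def field_simps)
      show ?thesis unfolding eq norm_mult
        using \<delta>(2)[of w] that False by (intro mult_right_mono) (auto simp: dist_norm)
    qed (simp add: \<Psi>_def)
    define C where "C = 2 * L * (1 + M) ^ 3 / \<delta> ^ 3"
    have C: "C \<ge> 0" using L M \<delta> by (simp add: C_def)
    have main: "cmod (\<phi> z - \<alpha>) \<le> e / 2 + C * (1 - (cmod z)\<^sup>2)" if zs: "z \<in> stolz_region M \<zeta>" for z
    proof -
      have z: "cmod z < 1" and zM: "cmod (z - \<zeta>) < M * (1 - cmod z)"
        using zs by (auto simp: stolz_region_def)
      define p where "p = 1 - (cmod z)\<^sup>2"
      have p: "p \<ge> 0" using z by (simp add: p_def abs_square_le_1)
      have pt: "cmod (\<Psi> w * (1 / (w - z)\<^sup>2 - (cnj z)\<^sup>2 / (1 - cnj z * w)\<^sup>2) * w) \<le> (e / 2) * (p / (cmod (w - z))\<^sup>2) + C * p"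
        if w: "cmod w = 1" for w
      proof -
        have wz0: "cmod (w - z) > 0" using w z by auto
        have "cmod (w - \<zeta>) \<le> cmod (w - z) + cmod (z - \<zeta>)"
          by (metis norm_triangle_ineq diff_add_cancel add_diff_eq)
        also have "cmod (z - \<zeta>) \<le> M * cmod (w - z)"
        proof -
          have "1 - cmod z \<le> cmod (w - z)" using norm_triangle_ineq2[of w z] w by simp
          then have "M * (1 - cmod z) \<le> M * cmod (w - z)" using M by simp
          then show ?thesis using zM by simp
        qed
        finally have wz: "cmod (w - \<zeta>) \<le> (1 + M) * cmod (w - z)" by (simp add: algebra_simps)
        have k: "cmod (\<Psi> w * (1 / (w - z)\<^sup>2 - (cnj z)\<^sup>2 / (1 - cnj z * w)\<^sup>2) * w) \<le> cmod (\<Psi> w) * (2 * p / cmod (w - z) ^ 3)"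
          unfolding norm_mult w p_def mult_1_right by (rule mult_left_mono[OF reflected_cauchy_kernel_bound[OF w z]]) simp
        show ?thesis
        proof (cases "cmod (w - \<zeta>) < \<delta>")
          case True
          have "cmod (\<Psi> w) \<le> \<epsilon> * ((1 + M) * cmod (w - z))"
            using near[OF w True] mult_left_mono[OF wz, of \<epsilon>] \<epsilon> by linarith
          then have "cmod (\<Psi> w) * (2 * p / cmod (w - z) ^ 3) \<le> \<epsilon> * ((1 + M) * cmod (w - z)) * (2 * p / cmod (w - z) ^ 3)"
            using p by (intro mult_right_mono) auto
          also have "\<dots> = (e / 2) * (p / (cmod (w - z))\<^sup>2)"
            using wz0 M by (simp add: \<epsilon>_def eval_nat_numeral divide_simps)
          finally show ?thesis using k mult_nonneg_nonneg[OF C p] by linarith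
        next
          case False
          then have "\<delta> / (1 + M) \<le> cmod (w - z)" using wz M by (simp add: divide_simps mult.commute)
          then have "(\<delta> / (1 + M)) ^ 3 \<le> cmod (w - z) ^ 3" using \<delta> M by (intro power_mono) auto
          then have "2 * p / cmod (w - z) ^ 3 \<le> 2 * p / (\<delta> / (1 + M)) ^ 3"
            using p \<delta>(1) M wz0 by (intro divide_left_mono mult_pos_pos zero_less_power divide_pos_pos) auto
          then have "cmod (\<Psi> w) * (2 * p / cmod (w - z) ^ 3) \<le> L * (2 * p / (\<delta> / (1 + M)) ^ 3)"
            using L(2)[of w] w p wz0 L(1) by (intro mult_mono) auto
          also have "\<dots> = C * p" using \<delta> M by (simp add: C_def power_divide)
          moreover have "0 \<le> (e / 2) * (p / (cmod (w - z))\<^sup>2)" using e p by simp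
          ultimately show ?thesis using k by linarith
        qed
      qed
      have I1: "((\<lambda>t. \<Psi> (cis (2 * pi * t)) * (1 / (cis (2 * pi * t) - z)\<^sup>2 - (cnj z)\<^sup>2 / (1 - cnj z * cis (2 * pi * t))\<^sup>2)
           * cis (2 * pi * t)) has_integral (\<phi> z - \<alpha>)) {0..1}"
        using reflected_cauchy_formula[OF contP holP z] DERIV_imp_deriv[OF derP] z by simp
      have I2: "((\<lambda>t. (e / 2) * (p / (cmod (cis (2 * pi * t) - z))\<^sup>2) + C * p) has_integral ((e / 2) * 1 + C * p)) {0..1}"
        unfolding p_def by (intro has_integral_add has_integral_mult_right poisson_kernel_has_integral z) (use has_integral_const_real[of _ 0 1] in auto)
      have "norm (integral {0..1} (\<lambda>t. \<Psi> (cis (2 * pi * t)) * (1 / (cis (2 * pi * t) - z)\<^sup>2 - (cnj z)\<^sup>2 / (1 - cnj z * cis (2 * pi * t))\<^sup>2)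
           * cis (2 * pi * t))) \<le> integral {0..1} (\<lambda>t. (e / 2) * (p / (cmod (cis (2 * pi * t) - z))\<^sup>2) + C * p)"
        by (rule integral_norm_bound_integral) (use I1 I2 pt in \<open>auto simp: has_integral_integrable\<close>)
      then show ?thesis using integral_unique[OF I1] integral_unique[OF I2] by (simp add: p_def)
    qed
    have "((\<lambda>z. e / 2 + C * (1 - (cmod z)\<^sup>2)) \<longlongrightarrow> e / 2 + C * (1 - (cmod \<zeta>)\<^sup>2)) (at \<zeta> within stolz_region M \<zeta>)"
      by (intro tendsto_intros)
    then have "\<forall>\<^sub>F z in at \<zeta> within stolz_region M \<zeta>. e / 2 + C * (1 - (cmod z)\<^sup>2) < e"
      by (rule order_tendstoD(2)) (use e \<zeta> in simp)
    then show "\<forall>\<^sub>F z in at \<zeta> within stolz_region M \<zeta>. dist (\<phi> z - \<alpha>) 0 < e"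
      unfolding dist_norm diff_zero eventually_at_filter by eventually_elim (use main in force)
  qed
  then show "(\<phi> \<longlongrightarrow> \<alpha>) (at \<zeta> within stolz_region M \<zeta>)"
    by (simp add: LIM_zero_iff)
qed

section \<open>Parseval on circles and radial limits along a sequence\<close>

abbreviation circle_lebesgue :: "real measure" where
  "circle_lebesgue \<equiv> lebesgue_on {0..2 * pi}"

lemma finite_measure_circle_lebesgue: "finite_measure circle_lebesgue"
  by (rule finite_measure_lebesgue_on) auto

lemma cis_has_integral:
  "((\<lambda>t. cis (of_int k * t)) has_integral (if k = 0 then 2 * of_real pi else 0)) {0..2 * pi}"
proof (cases "k = 0")
  case True
  then show ?thesis using has_integral_const_real[of "1::complex" 0 "2 * pi"] by (simp add: scaleR_conv_of_real)
next
  case False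
  have "((\<lambda>t. cis (of_int k * t)) has_integral
      cis (of_int k * (2 * pi)) / (\<i> * of_int k) - cis (of_int k * 0) / (\<i> * of_int k)) {0..2 * pi}"
  proof (rule fundamental_theorem_of_calculus)
    fix t assume "t \<in> {0..2 * pi}"
    have "((\<lambda>z. exp (\<i> * of_int k * z) / (\<i> * of_int k)) has_field_derivative exp (\<i> * of_int k * of_real t)) (at (of_real t))"
      using False by (auto intro!: derivative_eq_intros)
    from has_vector_derivative_real_field[OF this]
    have "((\<lambda>t. exp (\<i> * of_int k * of_real t) / (\<i> * of_int k)) has_vector_derivative exp (\<i> * of_int k * of_real t)) (at t within {0..2 * pi})"
      by simp
    then show "((\<lambda>t. cis (of_int k * t) / (\<i> * of_int k)) has_vector_derivative cis (of_int k * t)) (at t within {0..2 * pi})"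
      using False by (simp add: cis_conv_exp mult_ac)
  qed simp
  moreover have "cis (of_int k * (2 * pi)) = 1" by (metis cis_multiple_2pi Ints_of_int mult.commute)
  ultimately show ?thesis using False by simp
qed

lemma parseval_trigonometric_polynomial:
  "((\<lambda>t. (cmod (\<Sum>n<N. c n * cis (real n * t)))\<^sup>2) has_integral 2 * pi * (\<Sum>n<N. (cmod (c n))\<^sup>2)) {0..2 * pi}"
proof -
  let ?f = "\<lambda>t. \<Sum>n<N. \<Sum>m<N. (c n * cnj (c m)) * cis (of_int (int n - int m) * t)"
  have "(?f has_integral (\<Sum>n<N. \<Sum>m<N. (c n * cnj (c m)) * (if int n - int m = 0 then 2 * of_real pi else 0))) {0..2 * pi}"
    by (intro has_integral_sum has_integral_mult_right cis_has_integral) auto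
  also have "(\<Sum>n<N. \<Sum>m<N. (c n * cnj (c m)) * (if int n - int m = 0 then 2 * of_real pi else 0))
      = (\<Sum>n<N. c n * cnj (c n) * (2 * of_real pi))"
    by (intro sum.cong refl) (simp add: if_distrib[of "\<lambda>x. _ * x"] sum.delta cong: if_cong)
  also have "\<dots> = of_real (2 * pi * (\<Sum>n<N. (cmod (c n))\<^sup>2))"
    unfolding of_real_mult of_real_sum complex_norm_square sum_distrib_left by (intro sum.cong) auto
  finally have *: "(?f has_integral of_real (2 * pi * (\<Sum>n<N. (cmod (c n))\<^sup>2))) {0..2 * pi}" .
  have "?f t = of_real ((cmod (\<Sum>n<N. c n * cis (real n * t)))\<^sup>2)" for t
  proof -
    have "cis (of_int (int n - int m) * t) = cis (real n * t) * cnj (cis (real m * t))" for n m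
      by (simp add: cis_cnj cis_mult left_diff_distrib)
    then show ?thesis
      unfolding complex_norm_square by (simp add: sum_product cnj_sum mult_ac)
  qed
  then have "((\<lambda>t. complex_of_real ((cmod (\<Sum>n<N. c n * cis (real n * t)))\<^sup>2)) has_integral of_real (2 * pi * (\<Sum>n<N. (cmod (c n))\<^sup>2))) {0..2 * pi}"
    using * by simp
  from has_integral_linear[OF this bounded_linear_Re] show ?thesis by (simp add: o_def)
qed

lemma integral_circle_eq:
  fixes f :: "real \<Rightarrow> 'b::euclidean_space"
  assumes "continuous_on {0..2 * pi} f" "(f has_integral I) {0..2 * pi}"
  shows "integrable circle_lebesgue f" "integral\<^sup>L circle_lebesgue f = I"
  using continuous_imp_integrable_real[OF assms(1)] assms(2) lebesgue_integral_eq_integral[of "{0..2 * pi}" f]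
  by (auto simp: integral_unique)

lemma parseval_trigonometric_series:
  assumes c: "summable (\<lambda>n. cmod (c n))"
  shows "integrable circle_lebesgue (\<lambda>t. (cmod (\<Sum>n. c n * cis (real n * t)))\<^sup>2)"
    and "(\<lambda>n. 2 * pi * (cmod (c n))\<^sup>2) sums (\<integral>t. (cmod (\<Sum>n. c n * cis (real n * t)))\<^sup>2 \<partial>circle_lebesgue)"
proof -
  define s where "s N t = (cmod (\<Sum>n<N. c n * cis (real n * t)))\<^sup>2" for N t
  define f where "f t = (cmod (\<Sum>n. c n * cis (real n * t)))\<^sup>2" for t
  define C where "C = (\<Sum>n. cmod (c n))"
  have s_int: "integrable circle_lebesgue (s N)" "integral\<^sup>L circle_lebesgue (s N) = 2 * pi * (\<Sum>n<N. (cmod (c n))\<^sup>2)" for N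
  proof -
    have "continuous_on {0..2 * pi} (s N)" unfolding s_def[abs_def] by (intro continuous_intros)
    from integral_circle_eq[OF this] parseval_trigonometric_polynomial[where N = N and c = c]
    show "integrable circle_lebesgue (s N)" "integral\<^sup>L circle_lebesgue (s N) = 2 * pi * (\<Sum>n<N. (cmod (c n))\<^sup>2)"
      by (simp_all add: s_def[abs_def])
  qed
  have sm: "summable (\<lambda>n. c n * cis (real n * t))" for t
    by (rule summable_norm_cancel) (simp add: norm_mult c)
  have lim: "(\<lambda>N. s N t) \<longlonglongrightarrow> f t" for t
    unfolding s_def f_def by (intro tendsto_intros) (use summable_LIMSEQ[OF sm] in simp)
  have bd: "norm (s N t) \<le> C\<^sup>2" for N t
  proof -
    have "cmod (\<Sum>n<N. c n * cis (real n * t)) \<le> (\<Sum>n<N. cmod (c n))"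
      by (rule order_trans[OF norm_sum]) (simp add: norm_mult)
    also have "\<dots> \<le> C" unfolding C_def by (intro sum_le_suminf c) auto
    finally show ?thesis unfolding s_def by (simp add: power_mono)
  qed
  have fm: "f \<in> borel_measurable circle_lebesgue"
    by (rule borel_measurable_LIMSEQ_real[of _ s]) (use lim s_int in auto)
  have ci: "integrable circle_lebesgue (\<lambda>_. C\<^sup>2)"
    by (rule finite_measure.integrable_const[OF finite_measure_circle_lebesgue])
  have "integrable circle_lebesgue f" "(\<lambda>N. integral\<^sup>L circle_lebesgue (s N)) \<longlonglongrightarrow> integral\<^sup>L circle_lebesgue f"
    by (rule integrable_dominated_convergence[OF fm _ ci, of s] integral_dominated_convergence[OF fm _ ci, of s];
        use s_int lim bd in \<open>auto simp: borel_measurable_integrable\<close>)+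
  then show "integrable circle_lebesgue (\<lambda>t. (cmod (\<Sum>n. c n * cis (real n * t)))\<^sup>2)"
    and "(\<lambda>n. 2 * pi * (cmod (c n))\<^sup>2) sums (\<integral>t. (cmod (\<Sum>n. c n * cis (real n * t)))\<^sup>2 \<partial>circle_lebesgue)"
    unfolding s_int by (auto simp: f_def[abs_def] sums_def sum_distrib_left)
qed

lemma circle_series:
  assumes g: "g holomorphic_on unit_disc" and r: "0 \<le> r" "r < 1"
  shows "summable (\<lambda>n. cmod (taylor_coeff g n * of_real (r ^ n)))"
    and "g (of_real r * cis t) = (\<Sum>n. (taylor_coeff g n * of_real (r ^ n)) * cis (real n * t))"
    and "summable (\<lambda>n. (taylor_coeff g n * of_real (r ^ n)) * cis (real n * t))"
proof -
  obtain r' where r': "r < r'" "r' < 1" using r dense by blast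
  have "summable (\<lambda>n. taylor_coeff g n * of_real r' ^ n)"
    using taylor_series_sums[OF g, of "of_real r'"] r r' by (auto simp: sums_iff)
  from powser_insidea[OF this, of "of_real r"] r r'
  show s: "summable (\<lambda>n. cmod (taylor_coeff g n * of_real (r ^ n)))" by simp
  show "summable (\<lambda>n. (taylor_coeff g n * of_real (r ^ n)) * cis (real n * t))"
    by (rule summable_norm_cancel) (use s in \<open>simp add: norm_mult\<close>)
  have "(\<lambda>n. taylor_coeff g n * (of_real r * cis t) ^ n) sums g (of_real r * cis t)"
    using r by (intro taylor_series_sums[OF g]) (simp add: norm_mult)
  then show "g (of_real r * cis t) = (\<Sum>n. (taylor_coeff g n * of_real (r ^ n)) * cis (real n * t))"
    by (simp add: sums_iff power_mult_distrib Complex.DeMoivre mult.assoc)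
qed

lemma parseval_circle:
  assumes g: "g holomorphic_on unit_disc" and r: "0 \<le> r" "r < 1"
  shows "integrable circle_lebesgue (\<lambda>t. (cmod (g (of_real r * cis t)))\<^sup>2)"
    and "(\<lambda>n. 2 * pi * ((cmod (taylor_coeff g n))\<^sup>2 * (r ^ n)\<^sup>2)) sums (\<integral>t. (cmod (g (of_real r * cis t)))\<^sup>2 \<partial>circle_lebesgue)"
  using parseval_trigonometric_series[OF circle_series(1)[OF assms]] r
  unfolding circle_series(2)[OF assms, symmetric] by (simp_all add: norm_mult power_mult_distrib norm_power)

text \<open>
  Parseval for the difference of the restrictions to two circles, the tool for Cauchy estimates in the mean.
\<close>

lemma parseval_two_circles:
  assumes g: "g holomorphic_on unit_disc" and r: "0 \<le> r" "r < 1" and q: "0 \<le> q" "q < 1"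
  shows "integrable circle_lebesgue (\<lambda>t. (cmod (g (of_real r * cis t) - g (of_real q * cis t)))\<^sup>2)"
    and "(\<lambda>n. 2 * pi * ((cmod (taylor_coeff g n))\<^sup>2 * (r ^ n - q ^ n)\<^sup>2)) sums
      (\<integral>t. (cmod (g (of_real r * cis t) - g (of_real q * cis t)))\<^sup>2 \<partial>circle_lebesgue)"
proof -
  let ?c = "\<lambda>n. taylor_coeff g n * of_real (r ^ n) - taylor_coeff g n * of_real (q ^ n)"
  have c: "summable (\<lambda>n. cmod (?c n))"
    by (rule summable_comparison_test'[OF summable_add[OF circle_series(1)[OF g r] circle_series(1)[OF g q]], of 0])
       (use norm_triangle_ineq4 in auto)
  have e: "g (of_real r * cis t) - g (of_real q * cis t) = (\<Sum>n. ?c n * cis (real n * t))" for t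
    unfolding circle_series(2)[OF g r] circle_series(2)[OF g q]
    by (subst suminf_diff[OF circle_series(3)[OF g r] circle_series(3)[OF g q]]) (simp add: left_diff_distrib)
  have n: "(cmod (?c n))\<^sup>2 = (cmod (taylor_coeff g n))\<^sup>2 * (r ^ n - q ^ n)\<^sup>2" for n
  proof -
    have "?c n = taylor_coeff g n * of_real (r ^ n - q ^ n)" by (simp add: right_diff_distrib)
    then show ?thesis by (simp only: norm_mult norm_of_real power_mult_distrib power2_abs)
  qed
  show "integrable circle_lebesgue (\<lambda>t. (cmod (g (of_real r * cis t) - g (of_real q * cis t)))\<^sup>2)"
    unfolding e by (rule parseval_trigonometric_series(1)[OF c])
  show "(\<lambda>n. 2 * pi * ((cmod (taylor_coeff g n))\<^sup>2 * (r ^ n - q ^ n)\<^sup>2)) sums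
      (\<integral>t. (cmod (g (of_real r * cis t) - g (of_real q * cis t)))\<^sup>2 \<partial>circle_lebesgue)"
    unfolding e using parseval_trigonometric_series(2)[OF c] unfolding n .
qed

text \<open>
  By Parseval the sums \<open>\<Sum> |a\<^sub>n|\<^sup>2 r\<^sup>2\<^sup>n\<close> are at most \<open>C\<^sup>2\<close>; then let \<open>r\<close> tend to 1.
\<close>

lemma bounded_imp_square_summable_taylor:
  assumes g: "g holomorphic_on unit_disc" and C: "\<And>z. z \<in> unit_disc \<Longrightarrow> cmod (g z) \<le> C"
  shows "square_summable (taylor_coeff g)"
  unfolding square_summable_def
proof (rule bounded_imp_summable)
  fix N
  have "(\<Sum>n\<le>N. (cmod (taylor_coeff g n))\<^sup>2 * (r ^ n)\<^sup>2) \<le> C\<^sup>2" if r: "0 \<le> r" "r < 1" for r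
  proof -
    note P = parseval_circle[OF g r]
    have "(\<Sum>n\<le>N. 2 * pi * ((cmod (taylor_coeff g n))\<^sup>2 * (r ^ n)\<^sup>2)) \<le> (\<integral>t. (cmod (g (of_real r * cis t)))\<^sup>2 \<partial>circle_lebesgue)"
      unfolding sums_unique[OF P(2)] by (intro sum_le_suminf sums_summable[OF P(2)]) auto
    also have "\<dots> \<le> (\<integral>t. C\<^sup>2 \<partial>circle_lebesgue)"
    proof (rule integral_mono[OF P(1)])
      show "integrable circle_lebesgue (\<lambda>t. C\<^sup>2)"
        by (rule finite_measure.integrable_const[OF finite_measure_circle_lebesgue])
      show "(cmod (g (of_real r * cis t)))\<^sup>2 \<le> C\<^sup>2" for t
        by (intro power_mono C) (use r in \<open>auto simp: norm_mult\<close>)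
    qed
    also have "\<dots> = 2 * pi * C\<^sup>2" by (simp add: measure_restrict_space)
    finally show ?thesis by (simp flip: sum_distrib_left)
  qed
  then have "\<forall>\<^sub>F r in at_left 1. (\<Sum>n\<le>N. (cmod (taylor_coeff g n))\<^sup>2 * (r ^ n)\<^sup>2) \<le> C\<^sup>2"
    by (intro eventually_at_leftI[of 0]) auto
  moreover have "((\<lambda>r. \<Sum>n\<le>N. (cmod (taylor_coeff g n))\<^sup>2 * (r ^ n)\<^sup>2) \<longlongrightarrow> (\<Sum>n\<le>N. (cmod (taylor_coeff g n))\<^sup>2 * (1 ^ n)\<^sup>2)) (at_left (1::real))"
    by (intro tendsto_intros)
  ultimately show "(\<Sum>n\<le>N. (cmod (taylor_coeff g n))\<^sup>2) \<le> C\<^sup>2"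
    using tendsto_upperbound[of _ _ "at_left (1::real)"] by fastforce
qed simp

lemma radius_with_small_defect:
  assumes a: "square_summable a" and e: "e > 0" and d: "d < 1"
  shows "\<exists>r. d < r \<and> 0 < r \<and> r < 1 \<and> (\<Sum>n. (cmod (a n))\<^sup>2 * (1 - (r ^ n)\<^sup>2)) < e"
proof -
  define A where "A = (\<Sum>n. (cmod (a n))\<^sup>2)"
  have sA: "summable (\<lambda>n. (cmod (a n))\<^sup>2)" using a by (simp add: square_summable_def)
  have "(\<lambda>N. \<Sum>n<N. (cmod (a n))\<^sup>2) \<longlonglongrightarrow> A"
    unfolding A_def by (rule summable_LIMSEQ[OF sA])
  then have "\<forall>\<^sub>F N in sequentially. A - e < (\<Sum>n<N. (cmod (a n))\<^sup>2)"
    using e by (intro order_tendstoD) auto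
  then obtain N where N: "A - e < (\<Sum>n<N. (cmod (a n))\<^sup>2)" by (auto simp: eventually_sequentially)
  have "((\<lambda>r. \<Sum>n<N. (cmod (a n))\<^sup>2 * (r ^ n)\<^sup>2) \<longlongrightarrow> (\<Sum>n<N. (cmod (a n))\<^sup>2 * (1 ^ n)\<^sup>2)) (at_left (1::real))"
    by (intro tendsto_intros)
  then have "\<forall>\<^sub>F r in at_left (1::real). A - e < (\<Sum>n<N. (cmod (a n))\<^sup>2 * (r ^ n)\<^sup>2)"
    using N by (intro order_tendstoD(1)) auto
  moreover have "\<forall>\<^sub>F r in at_left (1::real). max 0 d < r \<and> r < 1"
    by (intro eventually_at_leftI[of "max 0 d"]) (use d in auto)
  ultimately have "\<forall>\<^sub>F r in at_left (1::real). (A - e < (\<Sum>n<N. (cmod (a n))\<^sup>2 * (r ^ n)\<^sup>2)) \<and> max 0 d < r \<and> r < 1"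
    by (rule eventually_conj)
  then obtain r where r: "A - e < (\<Sum>n<N. (cmod (a n))\<^sup>2 * (r ^ n)\<^sup>2)" "0 < r" "d < r" "r < 1"
    using eventually_happens[of _ "at_left (1::real)"] by (auto simp: trivial_limit_at_left_real)
  have rn: "(r ^ n)\<^sup>2 \<le> 1" for n using r by (simp add: power_le_one flip: power_mult)
  have s1: "summable (\<lambda>n. (cmod (a n))\<^sup>2 * (r ^ n)\<^sup>2)"
    by (rule summable_comparison_test'[OF sA, of 0]) (use rn in \<open>auto simp: mult_left_le\<close>)
  have "(\<Sum>n<N. (cmod (a n))\<^sup>2 * (r ^ n)\<^sup>2) \<le> (\<Sum>n. (cmod (a n))\<^sup>2 * (r ^ n)\<^sup>2)"
    by (intro sum_le_suminf s1) auto
  moreover have "(\<Sum>n. (cmod (a n))\<^sup>2 * (1 - (r ^ n)\<^sup>2)) = A - (\<Sum>n. (cmod (a n))\<^sup>2 * (r ^ n)\<^sup>2)"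
    unfolding A_def using suminf_diff[OF sA s1] by (simp add: right_diff_distrib)
  ultimately show ?thesis using r by (intro exI[of _ r]) auto
qed

lemma power_diff_sq_le:
  fixes x y :: real
  assumes "0 \<le> x" "x \<le> 1" "0 \<le> y" "y \<le> 1"
  shows "(x - y)\<^sup>2 \<le> (1 - x\<^sup>2) + (1 - y\<^sup>2)"
proof -
  have "(x + y) * (x + y) \<le> 2 * (x + y)" using assms by (intro mult_right_mono) auto
  moreover have "(1 - x) * (1 - y) \<ge> 0" using assms by simp
  moreover have "x * x \<le> x" "y * y \<le> y" using assms by (auto simp: mult_left_le)
  ultimately show ?thesis using assms by (simp add: power2_eq_square algebra_simps)
qed

text \<open>
  Choose radii so close to 1 that consecutive restrictions \<open>d\<^sub>k\<close> satisfy \<open>\<integral> |d\<^sub>k|\<^sup>2 = O(8\<^sup>-\<^sup>k)\<close>. Then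
  \<open>\<Sum> 2\<^sup>k |d\<^sub>k|\<^sup>2\<close> is integrable, hence finite almost everywhere, and \<open>|d\<^sub>k| \<le> 2\<^sup>k |d\<^sub>k|\<^sup>2 + 2\<^sup>-\<^sup>k\<close> makes the
  telescoping series of the \<open>d\<^sub>k\<close> absolutely convergent.
\<close>

lemma radial_subsequence_converges_ae:
  assumes g: "g holomorphic_on unit_disc" and a: "square_summable (taylor_coeff g)"
  obtains r :: "nat \<Rightarrow> real" where "\<And>k. 0 < r k" "\<And>k. r k < 1" "r \<longlonglongrightarrow> 1"
    "AE t in circle_lebesgue. convergent (\<lambda>k. g (of_real (r k) * cis t))"
proof -
  define D where "D r = (\<Sum>n. (cmod (taylor_coeff g n))\<^sup>2 * (1 - (r ^ n)\<^sup>2))" for r :: real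
  have "\<exists>r. 1 - 1 / real (Suc k) < r \<and> 0 < r \<and> r < 1 \<and> D r < (1 / 8) ^ k" for k
    unfolding D_def by (rule radius_with_small_defect[OF a]) auto
  then obtain r where r: "\<And>k. 1 - 1 / real (Suc k) < r k" "\<And>k. 0 < r k" "\<And>k. r k < 1" "\<And>k. D (r k) < (1 / 8) ^ k"
    by metis
  have "(\<lambda>k. 1 - 1 / real (Suc k)) \<longlonglongrightarrow> 1 - 0"
    by (intro tendsto_intros LIMSEQ_Suc[OF lim_1_over_n])
  then have rlim: "r \<longlonglongrightarrow> 1"
    by (intro tendsto_sandwich[of "\<lambda>k. 1 - 1 / real (Suc k)" r sequentially "\<lambda>_. 1"] always_eventually)
       (use r in \<open>auto intro: less_imp_le\<close>)
  define d where "d k t = g (of_real (r (Suc k)) * cis t) - g (of_real (r k) * cis t)" for k t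
  have sA: "summable (\<lambda>n. (cmod (taylor_coeff g n))\<^sup>2)" using a by (simp add: square_summable_def)
  have int_d: "integrable circle_lebesgue (\<lambda>t. (cmod (d k t))\<^sup>2)" for k
    unfolding d_def by (rule parseval_two_circles(1)[OF g]) (use r in \<open>auto intro: less_imp_le\<close>)
  have d_le: "(\<integral>t. (cmod (d k t))\<^sup>2 \<partial>circle_lebesgue) \<le> 4 * pi * (1 / 8) ^ k" for k
  proof -
    have r1: "(r j ^ n)\<^sup>2 \<le> 1" "r j ^ n \<le> 1" for j n
      using r(2,3)[of j] by (auto simp: power_le_one less_imp_le simp flip: power_mult)
    have sD: "summable (\<lambda>n. (cmod (taylor_coeff g n))\<^sup>2 * (1 - (r j ^ n)\<^sup>2))" for j
      by (rule summable_comparison_test'[OF sA, of 0]) (use r1 in \<open>auto simp: mult_left_le\<close>)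
    note s = parseval_two_circles(2)[OF g, of "r (Suc k)" "r k"]
    have "(\<integral>t. (cmod (d k t))\<^sup>2 \<partial>circle_lebesgue) \<le> 2 * pi * (D (r (Suc k)) + D (r k))"
    proof (rule sums_le[of "\<lambda>n. 2 * pi * ((cmod (taylor_coeff g n))\<^sup>2 * (r (Suc k) ^ n - r k ^ n)\<^sup>2)"])
      show "(\<lambda>n. 2 * pi * ((cmod (taylor_coeff g n))\<^sup>2 * (r (Suc k) ^ n - r k ^ n)\<^sup>2)) sums (\<integral>t. (cmod (d k t))\<^sup>2 \<partial>circle_lebesgue)"
        unfolding d_def using s r by (simp add: less_imp_le)
      show "(\<lambda>n. 2 * pi * ((cmod (taylor_coeff g n))\<^sup>2 * (1 - (r (Suc k) ^ n)\<^sup>2) + (cmod (taylor_coeff g n))\<^sup>2 * (1 - (r k ^ n)\<^sup>2)))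
          sums (2 * pi * (D (r (Suc k)) + D (r k)))"
        unfolding D_def by (intro sums_mult sums_add summable_sums sD)
      show "2 * pi * ((cmod (taylor_coeff g n))\<^sup>2 * (r (Suc k) ^ n - r k ^ n)\<^sup>2) \<le>
        2 * pi * ((cmod (taylor_coeff g n))\<^sup>2 * (1 - (r (Suc k) ^ n)\<^sup>2) + (cmod (taylor_coeff g n))\<^sup>2 * (1 - (r k ^ n)\<^sup>2))" for n
        unfolding distrib_left[symmetric]
        by (intro mult_left_mono power_diff_sq_le r1) (use r(2) in \<open>auto intro: less_imp_le\<close>)
    qed
    also have "\<dots> \<le> 2 * pi * ((1 / 8) ^ k + (1 / 8) ^ k)"
    proof -
      have "(1 / 8 :: real) ^ Suc k \<le> (1 / 8) ^ k" by simp
      then have "D (r (Suc k)) \<le> (1 / 8) ^ k" using r(4)[of "Suc k"] by linarith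
      then show ?thesis using r(4)[of k] by (intro mult_left_mono add_mono) auto
    qed
    finally show ?thesis by simp
  qed
  have meas: "(\<lambda>t. ennreal (2 ^ k * (cmod (d k t))\<^sup>2)) \<in> borel_measurable circle_lebesgue" for k
    using borel_measurable_integrable[OF int_d[of k]] by measurable
  have "(\<integral>\<^sup>+t. (\<Sum>k. ennreal (2 ^ k * (cmod (d k t))\<^sup>2)) \<partial>circle_lebesgue) = (\<Sum>k. \<integral>\<^sup>+t. ennreal (2 ^ k * (cmod (d k t))\<^sup>2) \<partial>circle_lebesgue)"
    by (rule nn_integral_suminf[OF meas])
  also have "\<dots> \<le> (\<Sum>k. ennreal (4 * pi * (1 / 4) ^ k))"
  proof (intro suminf_le)
    fix k
    have "(\<integral>\<^sup>+t. ennreal (2 ^ k * (cmod (d k t))\<^sup>2) \<partial>circle_lebesgue) = ennreal (\<integral>t. 2 ^ k * (cmod (d k t))\<^sup>2 \<partial>circle_lebesgue)"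
      by (intro nn_integral_eq_integral integrable_mult_right int_d) auto
    also have "\<dots> \<le> ennreal (4 * pi * (1 / 4) ^ k)"
    proof (rule ennreal_leI)
      have "(\<integral>t. 2 ^ k * (cmod (d k t))\<^sup>2 \<partial>circle_lebesgue) = 2 ^ k * (\<integral>t. (cmod (d k t))\<^sup>2 \<partial>circle_lebesgue)"
        by simp
      also have "\<dots> \<le> 2 ^ k * (4 * pi * (1 / 8) ^ k)" by (intro mult_left_mono d_le) auto
      also have "\<dots> = 4 * pi * (1 / 4) ^ k" by (simp flip: power_mult_distrib)
      finally show "(\<integral>t. 2 ^ k * (cmod (d k t))\<^sup>2 \<partial>circle_lebesgue) \<le> 4 * pi * (1 / 4) ^ k" .
    qed
    finally show "(\<integral>\<^sup>+t. ennreal (2 ^ k * (cmod (d k t))\<^sup>2) \<partial>circle_lebesgue) \<le> ennreal (4 * pi * (1 / 4) ^ k)" .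
  qed auto
  also have "\<dots> < \<infinity>"
  proof -
    have "summable (\<lambda>k. 4 * pi * (1 / 4) ^ k :: real)" by (intro summable_mult summable_geometric) auto
    then have "(\<Sum>k. ennreal (4 * pi * (1 / 4) ^ k)) = ennreal (\<Sum>k. 4 * pi * (1 / 4) ^ k)"
      by (intro suminf_ennreal2) auto
    then show ?thesis by simp
  qed
  finally have "AE t in circle_lebesgue. (\<Sum>k. ennreal (2 ^ k * (cmod (d k t))\<^sup>2)) \<noteq> \<infinity>"
    by (intro nn_integral_PInf_AE) (use meas in auto)
  then have "AE t in circle_lebesgue. convergent (\<lambda>k. g (of_real (r k) * cis t))"
  proof eventually_elim
    case (elim t)
    have "summable (\<lambda>k. 2 ^ k * (cmod (d k t))\<^sup>2)"
      by (rule summable_suminf_not_top) (use elim in auto)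
    then have "summable (\<lambda>k. 2 ^ k * (cmod (d k t))\<^sup>2 + (1 / 2) ^ k)"
      by (intro summable_add summable_geometric) auto
    then have "summable (\<lambda>k. d k t)"
    proof (rule summable_comparison_test'[of _ 0])
      fix k
      define x where "x = (2::real) ^ k"
      have x: "x > 0" by (simp add: x_def)
      have "0 \<le> (x * cmod (d k t) - 1)\<^sup>2" by simp
      then have "2 * (x * cmod (d k t)) \<le> x * (x * (cmod (d k t))\<^sup>2) + 1"
        by (simp add: power2_eq_square algebra_simps)
      moreover have "x * (x * (cmod (d k t))\<^sup>2 + 1 / x) = x * (x * (cmod (d k t))\<^sup>2) + 1"
        using x by (simp add: distrib_left)
      ultimately have "x * (2 * cmod (d k t)) \<le> x * (x * (cmod (d k t))\<^sup>2 + 1 / x)"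
        by (metis mult.left_commute)
      then have "2 * cmod (d k t) \<le> x * (cmod (d k t))\<^sup>2 + 1 / x" using x by (rule mult_left_le_imp_le)
      then have "cmod (d k t) \<le> x * (cmod (d k t))\<^sup>2 + 1 / x" using norm_ge_zero[of "d k t"] by linarith
      then show "norm (d k t) \<le> 2 ^ k * (cmod (d k t))\<^sup>2 + (1 / 2) ^ k" by (simp add: x_def power_one_over)
    qed
    then have "(\<lambda>K. \<Sum>k<K. d k t) \<longlonglongrightarrow> (\<Sum>k. d k t)" by (rule summable_LIMSEQ)
    then have "(\<lambda>K. g (of_real (r K) * cis t) - g (of_real (r 0) * cis t)) \<longlonglongrightarrow> (\<Sum>k. d k t)"
      unfolding d_def sum_lessThan_telescope[of "\<lambda>k. g (of_real (r k) * cis t)"] .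
    from tendsto_add[OF this tendsto_const[of "g (of_real (r 0) * cis t)"]]
    show ?case by (auto simp: convergent_def)
  qed
  then show ?thesis using that r rlim by blast
qed

section \<open>The theorem of Fatou\<close>

lemma reflected_integral:
  fixes K :: "real \<Rightarrow> 'a::euclidean_space"
  shows "integral {x - h..x} K = integral {-x..-x + h} (\<lambda>u. K (- u))"
  using Henstock_Kurzweil_Integration.integral_reflect_real[of x "x - h" K] by (simp add: algebra_simps)

text \<open>
  The one-sided differentiation theorem, applied to \<open>K\<close> for increments to the right and to the reflection of
  \<open>K\<close> for increments to the left.
\<close>

lemma lebesgue_differentiation_real:
  fixes K :: "real \<Rightarrow> 'a::euclidean_space"
  assumes K: "\<And>a b. K integrable_on {a..b}"
  obtains N where "negligible N"
    "\<And>x c. x \<notin> N \<Longrightarrow> c < x \<Longrightarrow> ((\<lambda>t. integral {c..t} K) has_vector_derivative K x) (at x)"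
proof -
  obtain N1 where N1: "negligible N1" "\<And>x e. x \<notin> N1 \<Longrightarrow> 0 < e \<Longrightarrow>
      \<exists>d>0. \<forall>h. 0 < h \<and> h < d \<longrightarrow> norm (integral {x..x + h} K /\<^sub>R h - K x) < e"
    using integrable_ccontinuous_explicit[of K] K by (auto simp: cbox_interval)
  have K': "(\<lambda>u. K (- u)) integrable_on {a..b}" for a b
    using Henstock_Kurzweil_Integration.integrable_reflect_real[of K "-a" "-b"] K by simp
  obtain N2 where N2: "negligible N2" "\<And>x e. x \<notin> N2 \<Longrightarrow> 0 < e \<Longrightarrow>
      \<exists>d>0. \<forall>h. 0 < h \<and> h < d \<longrightarrow> norm (integral {x..x + h} (\<lambda>u. K (- u)) /\<^sub>R h - K (- x)) < e"
    using integrable_ccontinuous_explicit[of "\<lambda>u. K (- u)"] K' by (auto simp: cbox_interval)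
  define N where "N = N1 \<union> uminus ` N2"
  have neg: "negligible N" unfolding N_def
    by (intro negligible_Un N1 negligible_differentiable_image_negligible N2) (auto simp: differentiable_on_def intro!: derivative_intros)
  have "((\<lambda>t. integral {c..t} K) has_vector_derivative K x) (at x)" if x: "x \<notin> N" and c: "c < x" for x c
    unfolding has_vector_derivative_def has_derivative_at_alt
  proof (intro conjI allI impI)
    show "bounded_linear (\<lambda>h. h *\<^sub>R K x)" by (rule bounded_linear_scaleR_left)
    fix e :: real assume e: "e > 0"
    have x1: "x \<notin> N1" and x2: "- x \<notin> N2" using x unfolding N_def by force+
    obtain d1 where d1: "d1 > 0" "\<And>h. 0 < h \<Longrightarrow> h < d1 \<Longrightarrow> norm (integral {x..x + h} K /\<^sub>R h - K x) < e"
      using N1(2)[OF x1 e] by blast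
    obtain d2 where d2: "d2 > 0" "\<And>h. 0 < h \<Longrightarrow> h < d2 \<Longrightarrow> norm (integral {x - h..x} K /\<^sub>R h - K x) < e"
      using N2(2)[OF x2 e] unfolding reflected_integral by auto
    have scale: "norm (I - h *\<^sub>R K x) \<le> e * h" if "norm (I /\<^sub>R h - K x) < e" "h > 0" for I and h :: real
    proof -
      have "I - h *\<^sub>R K x = h *\<^sub>R (I /\<^sub>R h - K x)" using that by (simp add: scaleR_diff_right)
      then have "norm (I - h *\<^sub>R K x) = h * norm (I /\<^sub>R h - K x)" using that by simp
      also have "\<dots> \<le> h * e" using that by (intro mult_left_mono) auto
      finally show ?thesis by (simp add: mult.commute)
    qed
    show "\<exists>d>0. \<forall>y. norm (y - x) < d \<longrightarrow>
        norm (integral {c..y} K - integral {c..x} K - (y - x) *\<^sub>R K x) \<le> e * norm (y - x)"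
    proof (intro exI[of _ "min (min d1 d2) (x - c)"] conjI allI impI)
      fix y assume y: "norm (y - x) < min (min d1 d2) (x - c)"
      consider "y = x" | "y > x" | "y < x" by linarith
      then show "norm (integral {c..y} K - integral {c..x} K - (y - x) *\<^sub>R K x) \<le> e * norm (y - x)"
      proof cases
        case 2
        have "integral {c..x} K + integral {x..y} K = integral {c..y} K"
          by (rule Henstock_Kurzweil_Integration.integral_combine) (use 2 c K in auto)
        then have "integral {c..y} K - integral {c..x} K = integral {x..x + (y - x)} K" by (simp add: algebra_simps)
        then show ?thesis using scale[OF d1(2)[of "y - x"]] y 2 by simp
      next
        case 3
        have "integral {c..y} K + integral {y..x} K = integral {c..x} K"
          by (rule Henstock_Kurzweil_Integration.integral_combine) (use 3 y c K in auto)
        then have "integral {c..y} K - integral {c..x} K - (y - x) *\<^sub>R K x = - (integral {x - (x - y)..x} K - (x - y) *\<^sub>R K x)"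
          by (simp add: algebra_simps)
        then show ?thesis using scale[OF d2(2)[of "x - y"]] y 3 by (simp add: norm_minus_commute)
      qed simp
    qed (use d1 d2 c in simp)
  qed
  with neg show ?thesis using that by blast
qed

text \<open>
  A derivative in the angle is a derivative along the circle: the angle of \<open>w\<close> is recovered from
  \<open>Arg (w / cis t)\<close>, which is continuous near \<open>cis t\<close>, and the difference quotient in \<open>w\<close> is a quotient of two
  difference quotients in the angle.
\<close>

lemma boundary_derivative_transfer:
  assumes D: "((\<lambda>s. \<Phi> (cis s)) has_vector_derivative d * (\<i> * cis t)) (at t)"
  shows "((\<lambda>w. (\<Phi> w - \<Phi> (cis t)) / (w - cis t)) \<longlongrightarrow> d) (at (cis t) within sphere 0 1)"
proof -
  define s where "s w = t + Arg (w / cis t)" for w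
  have cs: "cis (s w) = w" if "cmod w = 1" for w
  proof -
    have "cis (Arg (w / cis t)) = w / cis t" using that
      by (subst cis_Arg) (auto simp: sgn_div_norm norm_divide)
    then show ?thesis by (simp add: s_def flip: cis_mult)
  qed
  have quot: "((\<lambda>x. (f x - f t) / complex_of_real (x - t)) \<longlongrightarrow> f') (at t)"
    if "(f has_vector_derivative f') (at t)" for f f'
  proof -
    have "((\<lambda>x. (1 / norm (x - t)) *\<^sub>R (f x - (f t + (x - t) *\<^sub>R f'))) \<longlongrightarrow> 0) (at t)"
      using that unfolding has_vector_derivative_def has_derivative_within by simp
    then have "((\<lambda>x. norm ((f x - f t) / complex_of_real (x - t) - f')) \<longlongrightarrow> 0) (at t)"
    proof (rule Lim_transform_eventually[OF tendsto_norm_zero])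
      have "norm ((1 / norm (x - t)) *\<^sub>R (f x - (f t + (x - t) *\<^sub>R f'))) = norm ((f x - f t) / complex_of_real (x - t) - f')"
        if "x \<noteq> t" for x
      proof -
        have "(f x - f t) / complex_of_real (x - t) - f' = (f x - (f t + (x - t) *\<^sub>R f')) / complex_of_real (x - t)"
          using that by (simp add: field_simps scaleR_conv_of_real)
        then show ?thesis by (simp add: norm_divide del: of_real_diff)
      qed
      then show "\<forall>\<^sub>F x in at t. norm ((1 / norm (x - t)) *\<^sub>R (f x - (f t + (x - t) *\<^sub>R f'))) = norm ((f x - f t) / complex_of_real (x - t) - f')"
        by (auto simp: eventually_at_filter)
    qed
    then show ?thesis by (rule LIM_zero_cancel[OF tendsto_norm_zero_cancel])
  qed
  have dc: "(cis has_vector_derivative \<i> * cis t) (at t)"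
  proof -
    have "((\<lambda>z. exp (\<i> * z)) has_field_derivative exp (\<i> * of_real t) * \<i>) (at (of_real t))"
      by (auto intro!: derivative_eq_intros)
    from has_vector_derivative_real_field[OF this] show ?thesis by (simp add: cis_conv_exp[abs_def] mult.commute)
  qed
  have "((\<lambda>x. ((\<Phi> (cis x) - \<Phi> (cis t)) / complex_of_real (x - t)) / ((cis x - cis t) / complex_of_real (x - t)))
      \<longlongrightarrow> d * (\<i> * cis t) / (\<i> * cis t)) (at t)"
    by (intro tendsto_divide quot[OF D] quot[OF dc]) simp
  then have "((\<lambda>x. ((\<Phi> (cis x) - \<Phi> (cis t)) / complex_of_real (x - t)) / ((cis x - cis t) / complex_of_real (x - t))) \<longlongrightarrow> d) (at t)"
    by simp
  then have L: "((\<lambda>x. (\<Phi> (cis x) - \<Phi> (cis t)) / (cis x - cis t)) \<longlongrightarrow> d) (at t)"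
    by (rule Lim_transform_eventually) (auto simp: eventually_at_filter)
  have lim: "(s \<longlongrightarrow> t) (at (cis t) within sphere 0 1)"
  proof -
    have "isCont Arg (cis t / cis t)" by (rule continuous_at_Arg) simp
    moreover have "((\<lambda>w. w / cis t) \<longlongrightarrow> cis t / cis t) (at (cis t) within sphere 0 1)"
      by (intro tendsto_intros) simp
    ultimately have "((\<lambda>w. Arg (w / cis t)) \<longlongrightarrow> Arg (cis t / cis t)) (at (cis t) within sphere 0 1)"
      by (rule isCont_tendsto_compose)
    then have "((\<lambda>w. t + Arg (w / cis t)) \<longlongrightarrow> t + Arg (cis t / cis t)) (at (cis t) within sphere 0 1)"
      by (rule tendsto_add[OF tendsto_const])
    then show ?thesis by (simp add: s_def[abs_def])
  qed
  have "filterlim s (at t) (at (cis t) within sphere 0 1)"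
    unfolding filterlim_at using lim
  proof (intro conjI)
    show "\<forall>\<^sub>F w in at (cis t) within sphere 0 1. s w \<in> UNIV \<and> s w \<noteq> t"
      unfolding eventually_at_filter using cs by (intro always_eventually) force
  qed
  from filterlim_compose[OF L this]
  have "((\<lambda>w. (\<Phi> (cis (s w)) - \<Phi> (cis t)) / (cis (s w) - cis t)) \<longlongrightarrow> d) (at (cis t) within sphere 0 1)" .
  then show ?thesis
    by (rule Lim_transform_eventually) (use cs in \<open>auto simp: eventually_at_filter\<close>)
qed

text \<open>
  Let \<open>\<Phi>\<close> be a primitive of \<open>\<phi>\<close>. It is Lipschitz, so it extends continuously to the closed disc. Along radii
  \<open>r\<^sub>k \<rightarrow> 1\<close> for which \<open>\<phi> (r\<^sub>k cis u)\<close> converges almost everywhere to some \<open>G u\<close>, dominated convergence yields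
  \<open>\<Phi> (cis t) = \<Phi> 1 + \<integral>\<^sub>0\<^sup>t G u \<i> cis u du\<close>. By Lebesgue's differentiation theorem the boundary function of \<open>\<Phi>\<close> is
  differentiable with derivative \<open>G t\<close> along the circle for almost every \<open>t\<close>, and there \<open>G t\<close> is the
  non-tangential limit of \<open>\<phi>\<close>.
\<close>

theorem fatou_nontangential_limits:
  assumes hol: "\<phi> holomorphic_on unit_disc" and bd: "\<And>z. z \<in> unit_disc \<Longrightarrow> cmod (\<phi> z) \<le> C"
  shows "AE t in circle_lebesgue. \<exists>w. has_nontangential_limit \<phi> (cis t) w"
proof -
  obtain \<Phi>0 where \<Phi>0: "\<And>z. z \<in> unit_disc \<Longrightarrow> (\<Phi>0 has_field_derivative \<phi> z) (at z within unit_disc)"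
    using holomorphic_convex_primitive'[OF convex_ball open_ball hol] by metis
  have C0: "C \<ge> 0" using bd[of 0] norm_ge_zero[of "\<phi> 0"] by (simp del: norm_ge_zero)
  have lip: "C-lipschitz_on unit_disc \<Phi>0"
    by (rule lipschitz_onI[OF _ C0], unfold dist_norm)
       (rule field_differentiable_bound[OF convex_ball \<Phi>0 bd], auto)
  obtain \<Phi> where uc: "uniformly_continuous_on (closure unit_disc) \<Phi>" and eq: "\<And>z. z \<in> unit_disc \<Longrightarrow> \<Phi>0 z = \<Phi> z"
    using uniformly_continuous_on_extension_on_closure[OF lipschitz_on_uniformly_continuous[OF lip]] by metis
  have cont: "continuous_on (cball 0 1) \<Phi>" using uniformly_continuous_imp_continuous[OF uc] by simp
  have der: "(\<Phi> has_field_derivative \<phi> z) (at z)" if z: "z \<in> unit_disc" for z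
  proof -
    have "(\<Phi>0 has_field_derivative \<phi> z) (at z)" using \<Phi>0[OF z] unfolding at_within_open[OF z open_ball] .
    then show ?thesis by (rule has_field_derivative_transform_within_open[of _ _ _ unit_disc]) (use z eq in auto)
  qed
  obtain r :: "nat \<Rightarrow> real" where r: "\<And>k. 0 < r k" "\<And>k. r k < 1" "r \<longlonglongrightarrow> 1"
    and ae: "AE t in circle_lebesgue. convergent (\<lambda>k. \<phi> (of_real (r k) * cis t))"
    using radial_subsequence_converges_ae[OF hol bounded_imp_square_summable_taylor[OF hol bd]] by metis
  define f where "f k u = \<phi> (of_real (r k) * cis u) * (of_real (r k) * (\<i> * cis u))" for k u
  define G where "G u = lim (\<lambda>k. \<phi> (of_real (r k) * cis u))" for u
  define K where "K u = (if u \<in> {0..2 * pi} then G u * (\<i> * cis u) else 0)" for u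
  have disc: "of_real (r k) * cis u \<in> unit_disc" for k u using r(1,2)[of k] by (simp add: norm_mult)
  have cont\<phi>: "continuous_on S (\<lambda>u. \<phi> (of_real (r k) * cis u))" for S k
    by (rule continuous_on_compose2[OF holomorphic_on_imp_continuous_on[OF hol]]) (use disc in \<open>auto intro!: continuous_intros\<close>)
  have contf: "continuous_on S (f k)" for S k
    unfolding f_def[abs_def] by (intro continuous_on_mult cont\<phi> continuous_intros)
  have f_meas: "f k \<in> borel_measurable (lebesgue_on S)" if "S \<in> sets lebesgue" for k S
    by (rule continuous_imp_measurable_on_sets_lebesgue[OF contf that])
  have f_bd: "norm (f k u) \<le> C" for k u
  proof -
    have "norm (f k u) = cmod (\<phi> (of_real (r k) * cis u)) * r k" using r(1)[of k] by (simp add: f_def norm_mult)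
    also have "\<dots> \<le> C * 1" using r(1,2)[of k] C0 by (intro mult_mono bd disc) auto
    finally show ?thesis by simp
  qed
  have f_lim: "AE u in circle_lebesgue. (\<lambda>k. f k u) \<longlonglongrightarrow> K u"
    using ae
  proof (rule AE_mp, intro AE_I2 impI)
    fix u assume u: "u \<in> space circle_lebesgue" and c: "convergent (\<lambda>k. \<phi> (of_real (r k) * cis u))"
    have "(\<lambda>k. f k u) \<longlonglongrightarrow> G u * (of_real 1 * (\<i> * cis u))"
      unfolding f_def G_def using c r(3) by (intro tendsto_intros) (auto simp: convergent_LIMSEQ_iff)
    then show "(\<lambda>k. f k u) \<longlonglongrightarrow> K u" using u by (simp add: K_def)
  qed
  have K_meas: "K \<in> borel_measurable circle_lebesgue"
  proof -
    have "G \<in> borel_measurable circle_lebesgue" unfolding G_def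
      by (rule borel_measurable_lim_metric, rule continuous_imp_measurable_on_sets_lebesgue[OF cont\<phi>]) auto
    then have "(\<lambda>u. G u * (\<i> * cis u)) \<in> borel_measurable circle_lebesgue"
      by (rule borel_measurable_times, intro continuous_imp_measurable_on_sets_lebesgue continuous_intros) auto
    then show ?thesis by (rule measurable_cong[THEN iffD1, rotated]) (simp add: K_def)
  qed
  have K_int: "integrable circle_lebesgue K"
    by (rule integrable_dominated_convergence[OF K_meas _ _ f_lim, of "\<lambda>_. C"])
       (auto simp: f_bd f_meas finite_measure.integrable_const[OF finite_measure_circle_lebesgue])
  have K_HK: "K integrable_on {a..b}" for a b
  proof -
    have "(\<lambda>u. if u \<in> {0..2 * pi} then K u else 0) integrable_on UNIV"
      unfolding integrable_restrict_UNIV by (rule integrable_on_lebesgue_on[OF K_int]) auto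
    also have "(\<lambda>u. if u \<in> {0..2 * pi} then K u else 0) = K" by (auto simp: K_def)
    finally show ?thesis using integrable_on_subcbox[of K UNIV a b] by (simp add: cbox_interval)
  qed
  have prim: "\<Phi> (cis t) = \<Phi> 1 + integral {0..t} K" if t: "t \<in> {0..2 * pi}" for t
  proof -
    have fin: "finite_measure (lebesgue_on {0..t})" by (rule finite_measure_lebesgue_on) auto
    have "(f k has_integral (\<Phi> (of_real (r k) * cis t) - \<Phi> (of_real (r k) * cis 0))) {0..t}" for k
    proof (rule fundamental_theorem_of_calculus)
      fix u assume "u \<in> {0..t}"
      have "((\<lambda>z. \<Phi> (of_real (r k) * exp (\<i> * z))) has_field_derivative \<phi> (of_real (r k) * exp (\<i> * of_real u)) * (of_real (r k) * (exp (\<i> * of_real u) * \<i>))) (at (of_real u))"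
        by (rule DERIV_chain2[OF der]) (use disc[of k u] in \<open>auto simp: cis_conv_exp intro!: derivative_eq_intros\<close>)
      from has_vector_derivative_real_field[OF this]
      show "((\<lambda>u. \<Phi> (of_real (r k) * cis u)) has_vector_derivative f k u) (at u within {0..t})"
        by (simp add: f_def cis_conv_exp mult_ac)
    qed (use t in auto)
    then have fi: "integral\<^sup>L (lebesgue_on {0..t}) (f k) = \<Phi> (of_real (r k) * cis t) - \<Phi> (of_real (r k))" for k
      using lebesgue_integral_eq_integral[OF continuous_imp_integrable_real[OF contf[of "{0..t}" k]]]
      by (simp add: integral_unique)
    have sub: "lebesgue_on {0..t} = restrict_space circle_lebesgue {0..t}"
      using t by (simp add: restrict_restrict_space Int_absorb1)
    have f_lim': "AE u in lebesgue_on {0..t}. (\<lambda>k. f k u) \<longlonglongrightarrow> K u"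
      unfolding sub by (subst AE_restrict_space_iff) (use f_lim t in \<open>auto simp: sets_restrict_space_iff\<close>)
    have K_meas': "K \<in> borel_measurable (lebesgue_on {0..t})"
      unfolding sub by (rule measurable_restrict_space1[OF K_meas])
    have ci: "integrable (lebesgue_on {0..t}) (\<lambda>_. C)" by (rule finite_measure.integrable_const[OF fin])
    have "(\<lambda>k. integral\<^sup>L (lebesgue_on {0..t}) (f k)) \<longlonglongrightarrow> integral\<^sup>L (lebesgue_on {0..t}) K"
      by (rule integral_dominated_convergence[OF K_meas' _ ci f_lim']) (auto simp: f_meas f_bd)
    also have "integral\<^sup>L (lebesgue_on {0..t}) K = integral {0..t} K"
      by (rule lebesgue_integral_eq_integral)
         (auto intro: integrable_dominated_convergence[OF K_meas' _ ci f_lim'] simp: f_meas f_bd)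
    finally have 1: "(\<lambda>k. \<Phi> (of_real (r k) * cis t) - \<Phi> (of_real (r k))) \<longlonglongrightarrow> integral {0..t} K"
      unfolding fi .
    have "(\<lambda>k. \<Phi> (of_real (r k) * cis s)) \<longlonglongrightarrow> \<Phi> (cis s)" for s
    proof (rule continuous_on_tendsto_compose[OF cont])
      have "(\<lambda>k. of_real (r k) * cis s) \<longlonglongrightarrow> of_real 1 * cis s" by (intro tendsto_intros r)
      then show "(\<lambda>k. of_real (r k) * cis s) \<longlonglongrightarrow> cis s" by simp
    qed (use disc in \<open>auto simp: less_imp_le\<close>)
    from tendsto_diff[OF this[of t] this[of 0]]
    have "(\<lambda>k. \<Phi> (of_real (r k) * cis t) - \<Phi> (of_real (r k))) \<longlonglongrightarrow> \<Phi> (cis t) - \<Phi> 1"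
      by simp
    from LIMSEQ_unique[OF 1 this] show ?thesis by (simp add: algebra_simps)
  qed
  obtain N where N: "negligible N"
    "\<And>x c. x \<notin> N \<Longrightarrow> c < x \<Longrightarrow> ((\<lambda>t. integral {c..t} K) has_vector_derivative K x) (at x)"
    using lebesgue_differentiation_real[OF K_HK] by metis
  have good: "has_nontangential_limit \<phi> (cis t) (G t)" if t: "0 < t" "t < 2 * pi" "t \<notin> N" for t
  proof (rule nontangential_limit_of_boundary_derivative[OF cont der _ boundary_derivative_transfer])
    have "((\<lambda>t. \<Phi> 1 + integral {0..t} K) has_vector_derivative K t) (at t)"
      using N(2)[OF t(3,1)] by (auto intro!: derivative_eq_intros)
    then have "((\<lambda>s. \<Phi> (cis s)) has_vector_derivative K t) (at t)"
      by (rule has_vector_derivative_transform_within_open[of _ _ _ "{0<..<2 * pi}"]) (use t prim in auto)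
    then show "((\<lambda>s. \<Phi> (cis s)) has_vector_derivative G t * (\<i> * cis t)) (at t)"
      using t by (simp add: K_def)
  qed auto
  have "AE t in lebesgue. t \<notin> N \<union> {0, 2 * pi}"
    by (rule AE_not_in) (use N(1) in \<open>auto simp: negligible_iff_null_sets[symmetric] intro!: negligible_Un\<close>)
  then have "AE t in lebesgue. t \<in> {0..2 * pi} \<longrightarrow> (\<exists>w. has_nontangential_limit \<phi> (cis t) w)"
  proof eventually_elim
    case (elim t)
    show ?case
    proof
      assume "t \<in> {0..2 * pi}"
      then have "0 < t" "t < 2 * pi" "t \<notin> N" using elim by (auto simp: less_le)
      then show "\<exists>w. has_nontangential_limit \<phi> (cis t) w" using good by blast
    qed
  qed
  then show ?thesis by (subst AE_restrict_space_iff) simp_all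
qed

section \<open>Off-diagonal decay and convexity\<close>

text \<open>
  The distance \<open>|m - n|\<close> as a natural number, so that it can serve as an exponent.
\<close>

definition nat_dist :: "nat \<Rightarrow> nat \<Rightarrow> nat" where
  "nat_dist m n = (m - n) + (n - m)"

lemma nat_dist_commute: "nat_dist m n = nat_dist n m"
  by (simp add: nat_dist_def)

text \<open>
  Each side of the diagonal contributes at most a full geometric series.
\<close>

lemma sum_power_nat_dist_le:
  fixes a :: real
  assumes a: "0 < a" "a < 1"
  shows "(\<Sum>m<M. a ^ nat_dist m n) \<le> 2 / (1 - a)"
proof -
  have geo: "(\<Sum>i<K. a ^ i) \<le> 1 / (1 - a)" for K
    using sum_le_suminf[of "\<lambda>i. a ^ i" "{..<K}"] a suminf_geometric[of a] by (simp add: summable_geometric)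
  have "(\<Sum>m<M. a ^ nat_dist m n) \<le> 1 / (1 - a) + (\<Sum>i<n. a ^ Suc i)"
  proof (induction n arbitrary: M)
    case 0 then show ?case using geo[of M] by (simp add: nat_dist_def)
  next
    case (Suc n)
    show ?case
    proof (cases M)
      case 0
      then show ?thesis using a by (auto intro!: add_nonneg_nonneg sum_nonneg)
    next
      case M: (Suc M')
      have "(\<Sum>m<M. a ^ nat_dist m (Suc n)) = a ^ Suc n + (\<Sum>m<M'. a ^ nat_dist m n)"
        unfolding M by (subst sum.lessThan_Suc_shift) (simp add: nat_dist_def)
      also have "\<dots> \<le> a ^ Suc n + (1 / (1 - a) + (\<Sum>i<n. a ^ Suc i))" using Suc.IH[of M'] by simp
      finally show ?thesis by simp
    qed
  qed
  also have "(\<Sum>i<n. a ^ Suc i) = a * (\<Sum>i<n. a ^ i)" by (simp add: sum_distrib_left)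
  also have "\<dots> \<le> 1 * (1 / (1 - a))" using a geo[of n] by (intro mult_mono sum_nonneg) auto
  finally show ?thesis by simp
qed

lemma summable_power_nat_dist:
  fixes a :: real
  assumes "0 < a" "a < 1"
  shows "summable (\<lambda>n. a ^ nat_dist m n)"
proof (rule bounded_imp_summable)
  show "(\<Sum>n\<le>N. a ^ nat_dist m n) \<le> 2 / (1 - a)" for N
    using sum_power_nat_dist_le[OF assms, where M = "Suc N" and n = m] by (simp only: lessThan_Suc_atMost nat_dist_commute[of m])
qed (use assms in simp)

lemma suminf_power_nat_dist_le:
  fixes a :: real
  assumes "0 < a" "a < 1"
  shows "(\<Sum>n. a ^ nat_dist m n) \<le> 2 / (1 - a)"
  by (rule suminf_le_const[OF summable_power_nat_dist[OF assms]])
     (use sum_power_nat_dist_le[OF assms] in \<open>simp only: nat_dist_commute[of m]\<close>)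

text \<open>
  Convexity of \<open>x\<^sup>q\<close>, with the endpoint \<open>y = 0\<close> checked by hand since the derivative is taken on \<open>{0<..}\<close>.
\<close>

lemma powr_tangent_line:
  fixes y s q :: real
  assumes q: "q \<ge> 1" and y: "y \<ge> 0" and s: "s > 0"
  shows "s powr q + q * s powr (q - 1) * (y - s) \<le> y powr q"
proof (cases "y = 0")
  case True
  have "s powr (q - 1) * s = s powr q" using s by (simp add: powr_mult_base[symmetric] powr_diff)
  then have "s powr q + q * s powr (q - 1) * (0 - s) = (1 - q) * s powr q" by (simp add: algebra_simps)
  also have "\<dots> \<le> 0" using q by (intro mult_nonpos_nonneg) auto
  finally show ?thesis using True by simp
next
  case False
  then have y: "y > 0" using assms by simp
  have conv: "convex_on {0<..} (\<lambda>x::real. x powr q)"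
  proof (rule f''_ge0_imp_convex)
    show "((\<lambda>x. x powr q) has_real_derivative q * x powr (q - 1)) (at x)" if "x \<in> {0<..}" for x :: real
      using that by (auto intro!: derivative_eq_intros)
    show "((\<lambda>x. q * x powr (q - 1)) has_real_derivative q * ((q - 1) * x powr (q - 1 - 1))) (at x)" if "x \<in> {0<..}" for x :: real
      using that by (auto intro!: derivative_eq_intros)
    show "0 \<le> q * ((q - 1) * x powr (q - 1 - 1))" for x :: real using q by simp
  qed auto
  have "((\<lambda>x. x powr q) has_real_derivative q * s powr (q - 1)) (at s within {0<..})"
    using s by (auto intro!: derivative_eq_intros)
  from convex_on_imp_above_tangent[OF conv _ _ _ this, of y]
  have "q * s powr (q - 1) * (y - s) \<le> y powr q - s powr q" using s y by (simp add: connected_Ioi interior_open)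
  then show ?thesis by simp
qed

text \<open>
  Jensen's inequality for total weight at most 1: summing the tangent line inequality at
  \<open>s = \<Sum> t\<^sub>n y\<^sub>n\<close> leaves the defect \<open>(q - 1) (1 - \<Sum> t\<^sub>n) s\<^sup>q \<ge> 0\<close>.
\<close>

lemma jensen_powr_series:
  fixes t y :: "nat \<Rightarrow> real"
  assumes q: "q \<ge> 1" and t: "\<And>n. t n \<ge> 0" "summable t" "suminf t \<le> 1"
    and y: "\<And>n. y n \<ge> 0" and ty: "summable (\<lambda>n. t n * y n)" and tyq: "summable (\<lambda>n. t n * y n powr q)"
  shows "(\<Sum>n. t n * y n) powr q \<le> (\<Sum>n. t n * y n powr q)"
proof -
  define s where "s = (\<Sum>n. t n * y n)"
  have s0: "s \<ge> 0" unfolding s_def by (intro suminf_nonneg ty) (simp add: t y)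
  show ?thesis
  proof (cases "s = 0")
    case True
    then show ?thesis unfolding s_def[symmetric] by (auto intro!: suminf_nonneg tyq simp: t)
  next
    case False
    then have s: "s > 0" using s0 by simp
    define c where "c = q * s powr (q - 1)"
    have cs: "c * s = q * s powr q" using s by (simp add: c_def powr_diff)
    have "(\<lambda>n. t n * s powr q + c * (t n * y n) - c * s * t n) sums (suminf t * s powr q + c * s - c * s * suminf t)"
      unfolding s_def by (intro sums_add sums_diff sums_mult sums_mult2 summable_sums ty t)
    moreover have "t n * s powr q + c * (t n * y n) - c * s * t n \<le> t n * y n powr q" for n
    proof -
      have "t n * (s powr q + c * (y n - s)) \<le> t n * y n powr q"
        unfolding c_def by (intro mult_left_mono powr_tangent_line q y s t)
      then show ?thesis by (simp add: algebra_simps)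
    qed
    ultimately have "suminf t * s powr q + c * s - c * s * suminf t \<le> (\<Sum>n. t n * y n powr q)"
      using tyq by (intro sums_le[OF _ _ summable_sums]) auto
    moreover have "s powr q \<le> suminf t * s powr q + c * s - c * s * suminf t"
    proof -
      have "0 \<le> (q - 1) * (1 - suminf t) * s powr q" using q t by auto
      then show ?thesis unfolding cs by (simp add: algebra_simps)
    qed
    ultimately show ?thesis unfolding s_def[symmetric] by linarith
  qed
qed

text \<open>
  Young's inequality for convolution with a summable kernel, by Jensen applied to the normalised kernel.
\<close>

lemma convolution_powr_summable:
  fixes x :: "nat \<Rightarrow> real" and a q :: real
  assumes a: "0 < a" "a < 1" and q: "q \<ge> 1" and x: "\<And>n. x n \<ge> 0" and xq: "summable (\<lambda>n. x n powr q)"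
  shows "summable (\<lambda>n. a ^ nat_dist m n * x n)"
    and "summable (\<lambda>m. (\<Sum>n. a ^ nat_dist m n * x n) powr q)"
proof -
  define c where "c = 2 / (1 - a)"
  have c: "c > 0" using a by (simp add: c_def)
  \<comment> \<open>A \<open>q\<close>-summable sequence is bounded, so the convolution converges.\<close>
  have "x n \<le> 1 + x n powr q" for n
  proof (cases "x n \<le> 1")
    case False
    then have "x n powr 1 \<le> x n powr q" using q by (intro powr_mono) auto
    then show ?thesis using x[of n] False by simp
  qed (use powr_ge_zero[of "x n" q] in linarith)
  moreover have "x n powr q \<le> (\<Sum>n. x n powr q)" for n
    using sum_le_suminf[OF xq, of "{n}"] by simp
  ultimately have xb: "x n \<le> 1 + (\<Sum>n. x n powr q)" for n by (meson add_left_mono order_trans)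
  have aq: "a ^ k \<le> 1" "0 \<le> a ^ k" for k using a by (auto simp: power_le_one)
  have s1: "summable (\<lambda>n. a ^ nat_dist m n * x n)" for m
    by (rule summable_comparison_test'[OF summable_mult2[OF summable_power_nat_dist[OF a, of m], of "1 + (\<Sum>n. x n powr q)"], of 0])
       (use xb x aq in \<open>auto simp: abs_mult intro!: mult_left_mono\<close>)
  show "summable (\<lambda>n. a ^ nat_dist m n * x n)" by (rule s1)
  have s2: "summable (\<lambda>n. a ^ nat_dist m n * x n powr q)" for m
    by (rule summable_comparison_test'[OF xq, of 0]) (use aq in \<open>auto simp: mult_left_le_one_le\<close>)
  have conv: "(\<Sum>n. a ^ nat_dist m n * x n) powr q \<le> c powr q / c * (\<Sum>n. a ^ nat_dist m n * x n powr q)" for m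
  proof -
    define t where "t n = a ^ nat_dist m n / c" for n
    have "(\<Sum>n. t n * x n) powr q \<le> (\<Sum>n. t n * x n powr q)"
    proof (rule jensen_powr_series[OF q _ _ _ x])
      show "t n \<ge> 0" for n using aq c by (simp add: t_def)
      show "summable t" unfolding t_def[abs_def] by (intro summable_divide summable_power_nat_dist a)
      show "suminf t \<le> 1"
        unfolding t_def[abs_def] using suminf_power_nat_dist_le[OF a, of m] c
        by (subst suminf_divide) (auto simp: summable_power_nat_dist[OF a] c_def[symmetric])
      show "summable (\<lambda>n. t n * x n)" "summable (\<lambda>n. t n * x n powr q)"
        using summable_divide[OF s1[of m], of c] summable_divide[OF s2[of m], of c] by (simp_all add: t_def)
    qed
    moreover have "(\<Sum>n. t n * x n) = (\<Sum>n. a ^ nat_dist m n * x n) / c"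
      using suminf_divide[OF s1[of m], of c] by (simp add: t_def)
    moreover have "(\<Sum>n. t n * x n powr q) = (\<Sum>n. a ^ nat_dist m n * x n powr q) / c"
      using suminf_divide[OF s2[of m], of c] by (simp add: t_def)
    moreover have "(\<Sum>n. a ^ nat_dist m n * x n) \<ge> 0" by (intro suminf_nonneg s1) (use aq x in auto)
    ultimately show ?thesis using c by (simp add: powr_divide field_simps)
  qed
  show "summable (\<lambda>m. (\<Sum>n. a ^ nat_dist m n * x n) powr q)"
  proof (rule bounded_imp_summable)
    fix M
    have "(\<Sum>m\<le>M. (\<Sum>n. a ^ nat_dist m n * x n) powr q) \<le> (\<Sum>m\<le>M. c powr q / c * (\<Sum>n. a ^ nat_dist m n * x n powr q))"
      by (intro sum_mono conv)
    also have "\<dots> = c powr q / c * (\<Sum>n. \<Sum>m\<le>M. a ^ nat_dist m n * x n powr q)"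
      unfolding sum_distrib_left[symmetric] by (subst suminf_sum) (simp_all add: s2)
    also have "\<dots> \<le> c powr q / c * (\<Sum>n. c * x n powr q)"
    proof (intro mult_left_mono suminf_le summable_sum summable_mult s2 xq)
      show "(\<Sum>m\<le>M. a ^ nat_dist m n * x n powr q) \<le> c * x n powr q" for n
        unfolding sum_distrib_right[symmetric] c_def lessThan_Suc_atMost[symmetric]
        by (intro mult_right_mono sum_power_nat_dist_le a) simp
    qed (use c in simp)
    finally show "(\<Sum>m\<le>M. (\<Sum>n. a ^ nat_dist m n * x n) powr q) \<le> c powr q / c * (\<Sum>n. c * x n powr q)" .
  qed simp
qed

section \<open>Dyadic blocks of a power series\<close>

text \<open>
  The shift by one makes the blocks partition all indices including 0: block 0 is \<open>{0}\<close>.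
\<close>

definition dyadic_block :: "nat \<Rightarrow> nat set" where
  "dyadic_block m = {2 ^ m - 1..<2 ^ Suc m - 1}"

definition block_poly :: "(nat \<Rightarrow> complex) \<Rightarrow> nat \<Rightarrow> complex \<Rightarrow> complex" where
  "block_poly a m z = (\<Sum>k\<in>dyadic_block m. a k * z ^ k)"

definition block_energy :: "(nat \<Rightarrow> complex) \<Rightarrow> nat \<Rightarrow> real" where
  "block_energy a m = (\<Sum>k\<in>dyadic_block m. (cmod (a k))\<^sup>2)"

text \<open>
  The reproducing kernel on the diagonal for polynomials with frequencies in one block, as a function of \<open>|z|\<close>.
\<close>

definition block_kernel :: "nat \<Rightarrow> real \<Rightarrow> real" where
  "block_kernel m r = (\<Sum>k\<in>dyadic_block m. r ^ (2 * k))"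

lemma sum_dyadic_blocks:
  fixes f :: "nat \<Rightarrow> 'a::comm_monoid_add"
  shows "(\<Sum>m<M. \<Sum>k\<in>dyadic_block m. f k) = (\<Sum>k<2 ^ M - 1. f k)"
proof (induction M)
  case (Suc M)
  have "(\<Sum>k<2 ^ Suc M - 1. f k) = (\<Sum>k\<in>{0..<2 ^ M - 1}. f k) + (\<Sum>k\<in>{2 ^ M - 1..<2 ^ Suc M - 1}. f k)"
    unfolding lessThan_atLeast0 by (subst sum.atLeastLessThan_concat) auto
  then show ?case using Suc by (simp add: dyadic_block_def lessThan_atLeast0)
qed simp

lemma block_energy_nonneg: "0 \<le> block_energy a m"
  unfolding block_energy_def by (intro sum_nonneg) auto

lemma finite_dyadic_block [simp]: "finite (dyadic_block m)"
  by (simp add: dyadic_block_def)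

text \<open>
  For \<open>m \<le> n\<close> each of the \<open>2\<^sup>m = 2\<^sup>n 2\<^sup>-\<^sup>(\<^sup>n\<^sup>-\<^sup>m\<^sup>)\<close> terms is at most 1. For \<open>m > n\<close> each term is at most
  \<open>r\<close> to the power \<open>2\<^sup>m\<close>, hence at most \<open>exp (-x)\<close> with \<open>x = 2\<^sup>m\<^sup>-\<^sup>n / 2\<close>, and \<open>exp (-x) \<le> 2 / x\<^sup>2\<close> is more than
  enough to compensate the number of terms.
\<close>

lemma block_kernel_le:
  assumes r: "0 \<le> r" "r < 1 - (1 / 2) ^ Suc n"
  shows "block_kernel m r \<le> 8 * 2 ^ n * (1 / 2) ^ nat_dist m n"
proof (cases "m \<le> n")
  case True
  have "r \<le> 1" using r(2) zero_le_power[of "1 / 2 :: real" "Suc n"] by linarith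
  then have "block_kernel m r \<le> (\<Sum>k\<in>dyadic_block m. 1)"
    unfolding block_kernel_def using r by (intro sum_mono power_le_one) auto
  also have "\<dots> = 2 ^ m" by (simp add: dyadic_block_def of_nat_diff)
  also have "\<dots> = 2 ^ n * (1 / 2) ^ nat_dist m n"
    using True by (simp add: nat_dist_def power_diff power_one_over)
  also have "\<dots> \<le> 8 * 2 ^ n * (1 / 2) ^ nat_dist m n" by simp
  finally show ?thesis .
next
  case False
  define d where "d = m - n"
  have m: "m = n + d" "d > 0" using False by (auto simp: d_def)
  define x :: real where "x = 2 ^ d / 2"
  have x: "x > 0" by (simp add: x_def)
  have r1: "r \<le> 1" using r(2) zero_le_power[of "1 / 2 :: real" "Suc n"] by linarith
  have "(2::nat) ^ m \<ge> 2" using m by (simp add: self_le_power)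
  then have km: "2 ^ m \<le> 2 * k" if "k \<in> dyadic_block m" for k
    using that unfolding dyadic_block_def by auto
  have "block_kernel m r \<le> (\<Sum>k\<in>dyadic_block m. r ^ (2 ^ m))"
    unfolding block_kernel_def using r r1 km by (intro sum_mono power_decreasing) auto
  also have "\<dots> = 2 ^ m * r ^ (2 ^ m)" by (simp add: dyadic_block_def of_nat_diff)
  also have "\<dots> \<le> 2 ^ m * (2 / x\<^sup>2)"
  proof (rule mult_left_mono)
    have "r ^ (2 ^ m) \<le> exp (- ((1 / 2) ^ Suc n)) ^ (2 ^ m)"
      using r exp_ge_add_one_self[of "- ((1 / 2) ^ Suc n)"] by (intro power_mono) auto
    also have "\<dots> = exp (- x)"
      unfolding m(1) x_def by (simp add: power_add power_one_over field_simps flip: exp_of_nat_mult)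
    also have "\<dots> \<le> 2 / x\<^sup>2"
    proof -
      have "x\<^sup>2 / 2 \<le> exp x" using exp_lower_Taylor_quadratic[of x] x by simp
      then show ?thesis using x by (simp add: exp_minus field_simps)
    qed
    finally show "r ^ (2 ^ m) \<le> 2 / x\<^sup>2" .
  qed simp
  also have "(2::real) ^ m * (2 / x\<^sup>2) = 8 * 2 ^ n * (1 / 2) ^ nat_dist m n"
    unfolding m(1) x_def nat_dist_def
    by (simp add: power_add power2_eq_square power_one_over field_simps)
  finally show ?thesis by simp
qed

text \<open>
  Cauchy-Schwarz with weights \<open>(2/3)\<^sup>|\<^sup>m\<^sup>-\<^sup>n\<^sup>|\<close>, whose sum is at most 6. The loss \<open>(3/2)\<^sup>|\<^sup>m\<^sup>-\<^sup>n\<^sup>|\<close> is smaller than the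
  gain \<open>2\<^sup>|\<^sup>m\<^sup>-\<^sup>n\<^sup>|\<close> provided by \<open>block_kernel_le\<close>.
\<close>

lemma sum_blocks_sq_le:
  fixes f :: "nat \<Rightarrow> complex"
  shows "(cmod (\<Sum>m<M. f m))\<^sup>2 \<le> 6 * (\<Sum>m<M. (3 / 2) ^ nat_dist m n * (cmod (f m))\<^sup>2)"
proof -
  define u :: "nat \<Rightarrow> real" where "u m = sqrt ((2 / 3) ^ nat_dist m n)" for m
  have u: "u m > 0" "(u m)\<^sup>2 = (2 / 3) ^ nat_dist m n" for m by (auto simp: u_def)
  have "(cmod (\<Sum>m<M. f m))\<^sup>2 \<le> (\<Sum>m<M. cmod (f m))\<^sup>2"
    by (intro power_mono norm_sum) simp
  also have "(\<Sum>m<M. cmod (f m)) = (\<Sum>m<M. u m * (cmod (f m) / u m))"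
    using u(1) by (intro sum.cong refl) (simp add: less_imp_neq[symmetric])
  also have "(\<Sum>m<M. u m * (cmod (f m) / u m))\<^sup>2 \<le> (\<Sum>m<M. (u m)\<^sup>2) * (\<Sum>m<M. (cmod (f m) / u m)\<^sup>2)"
    by (rule Cauchy_Schwarz_ineq_sum)
  also have "\<dots> \<le> 6 * (\<Sum>m<M. (cmod (f m) / u m)\<^sup>2)"
    unfolding u(2) using sum_power_nat_dist_le[of "2/3" n M] by (intro mult_right_mono sum_nonneg) auto
  also have "(\<Sum>m<M. (cmod (f m) / u m)\<^sup>2) = (\<Sum>m<M. (3 / 2) ^ nat_dist m n * (cmod (f m))\<^sup>2)"
    by (intro sum.cong refl) (simp add: power_divide u(2) field_simps)
  finally show ?thesis .
qed

lemma block_poly_sq_le: "(cmod (block_poly a m z))\<^sup>2 \<le> block_energy a m * block_kernel m (cmod z)"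
proof -
  have "cmod (block_poly a m z) \<le> (\<Sum>k\<in>dyadic_block m. cmod (a k) * cmod z ^ k)"
    unfolding block_poly_def by (rule order_trans[OF norm_sum]) (simp add: norm_mult norm_power)
  then have "(cmod (block_poly a m z))\<^sup>2 \<le> (\<Sum>k\<in>dyadic_block m. cmod (a k) * cmod z ^ k)\<^sup>2"
    by (intro power_mono) auto
  also have "\<dots> \<le> (\<Sum>k\<in>dyadic_block m. (cmod (a k))\<^sup>2) * (\<Sum>k\<in>dyadic_block m. (cmod z ^ k)\<^sup>2)"
    by (rule Cauchy_Schwarz_ineq_sum)
  finally show ?thesis by (simp add: block_energy_def block_kernel_def power_mult[symmetric] mult.commute)
qed

text \<open>
  Bessel's inequality for a finitely supported vector, by duality: with \<open>c\<^sub>j\<close> the coefficient against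
  \<open>e\<^sub>j\<close>, the vector \<open>v = \<Sum> cnj c\<^sub>j e\<^sub>j\<close> has norm squared \<open>S = \<Sum> |c\<^sub>j|\<^sup>2\<close> and pairs with \<open>u\<close> to \<open>S\<close>.
\<close>

lemma hardy_bessel_finite:
  assumes J: "finite J" and e: "hardy_orthonormal J e" and I: "finite I"
  shows "(\<Sum>j\<in>J. (cmod (\<Sum>k\<in>I. taylor_coeff (e j) k * u k))\<^sup>2) \<le> (\<Sum>k\<in>I. (cmod (u k))\<^sup>2)"
proof -
  have eh: "e j \<in> hardy" if "j \<in> J" for j using e that by (simp add: hardy_orthonormal_def)
  define c where "c j = (\<Sum>k\<in>I. taylor_coeff (e j) k * u k)" for j
  define v where "v = (\<Sum>j\<in>J. cscale (cnj (c j)) (e j))"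
  have vh: "v \<in> hardy" unfolding v_def using eh by (auto intro!: hardy_sum_closed hardy_cscale_closed)
  have vc: "taylor_coeff v k = (\<Sum>j\<in>J. cnj (c j) * taylor_coeff (e j) k)" for k
    unfolding v_def by (rule hardy_sum_coeff[OF eh])
  define S where "S = (\<Sum>j\<in>J. (cmod (c j))\<^sup>2)"
  have S0: "S \<ge> 0" unfolding S_def by (intro sum_nonneg) auto
  have "hardy_inner v v = of_real S"
  proof -
    have ev: "hardy_inner (e j) v = c j" if j: "j \<in> J" for j
    proof -
      have "hardy_inner v (e j) = (\<Sum>i\<in>J. cnj (c i) * hardy_inner (e i) (e j))"
        unfolding v_def by (rule hardy_inner_sum_left) (use eh j in auto)
      also have "\<dots> = (\<Sum>i\<in>J. cnj (c i) * (if i = j then 1 else 0))"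
        using e j by (intro sum.cong refl) (auto simp: hardy_orthonormal_def)
      also have "\<dots> = cnj (c j)" using j J by (simp add: if_distrib sum.delta cong: if_cong)
      finally show ?thesis using hardy_inner_cnj[OF vh eh[OF j]] by simp
    qed
    have "hardy_inner v v = (\<Sum>j\<in>J. cnj (c j) * hardy_inner (e j) v)"
      by (subst (1) v_def) (rule hardy_inner_sum_left[OF eh vh])
    also have "\<dots> = (\<Sum>j\<in>J. cnj (c j) * c j)" by (intro sum.cong refl) (simp add: ev)
    also have "\<dots> = of_real S" unfolding S_def of_real_sum complex_norm_square by (simp add: mult.commute)
    finally show ?thesis .
  qed
  then have vS: "(hardy_norm v)\<^sup>2 = S" unfolding hardy_inner_self[OF vh] of_real_eq_iff .
  have "complex_of_real S = (\<Sum>k\<in>I. taylor_coeff v k * u k)"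
  proof -
    have "complex_of_real S = (\<Sum>j\<in>J. cnj (c j) * c j)"
      unfolding S_def of_real_sum complex_norm_square by (simp add: mult.commute)
    also have "\<dots> = (\<Sum>j\<in>J. \<Sum>k\<in>I. cnj (c j) * taylor_coeff (e j) k * u k)"
      by (subst (2) c_def) (simp add: sum_distrib_left mult.assoc)
    also have "\<dots> = (\<Sum>k\<in>I. \<Sum>j\<in>J. cnj (c j) * taylor_coeff (e j) k * u k)" by (rule sum.swap)
    finally show ?thesis by (simp add: vc sum_distrib_right)
  qed
  then have "S = cmod (\<Sum>k\<in>I. taylor_coeff v k * u k)" using S0 by (metis abs_of_nonneg norm_of_real)
  also have "\<dots> \<le> (\<Sum>k\<in>I. cmod (taylor_coeff v k) * cmod (u k))"
    by (rule order_trans[OF norm_sum]) (simp add: norm_mult)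
  finally have "S\<^sup>2 \<le> (\<Sum>k\<in>I. cmod (taylor_coeff v k) * cmod (u k))\<^sup>2"
    using S0 by (intro power_mono) auto
  also have "\<dots> \<le> (\<Sum>k\<in>I. (cmod (taylor_coeff v k))\<^sup>2) * (\<Sum>k\<in>I. (cmod (u k))\<^sup>2)"
    by (rule Cauchy_Schwarz_ineq_sum)
  also have "\<dots> \<le> S * (\<Sum>k\<in>I. (cmod (u k))\<^sup>2)"
  proof (intro mult_right_mono sum_nonneg)
    show "(\<Sum>k\<in>I. (cmod (taylor_coeff v k))\<^sup>2) \<le> S"
      unfolding vS[symmetric] by (rule hardy_partial_energy_le[OF vh I])
  qed auto
  finally have "S * S \<le> S * (\<Sum>k\<in>I. (cmod (u k))\<^sup>2)" by (simp add: power2_eq_square)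
  then have "S \<le> (\<Sum>k\<in>I. (cmod (u k))\<^sup>2)" using S0 by (cases "S = 0") (auto intro!: sum_nonneg)
  then show ?thesis unfolding S_def c_def .
qed

text \<open>
  Bessel's inequality for point evaluation at \<open>z\<close> on one block.
\<close>

lemma sum_block_poly_orthonormal_le:
  assumes "finite J" "hardy_orthonormal J e"
  shows "(\<Sum>j\<in>J. (cmod (block_poly (taylor_coeff (e j)) m z))\<^sup>2) \<le> block_kernel m (cmod z)"
  using hardy_bessel_finite[OF assms finite_dyadic_block, where u = "\<lambda>k. z ^ k"]
  by (simp add: block_poly_def block_kernel_def norm_power power_mult[symmetric] mult.commute)

section \<open>Boundary values, level sets and compositions\<close>

lemma nontangential_imp_radial_limit:
  assumes nt: "has_nontangential_limit \<phi> \<zeta> w" and \<zeta>: "cmod \<zeta> = 1"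
    and r: "\<And>k. 0 < r k" "\<And>k. r k < 1" "r \<longlonglongrightarrow> 1"
  shows "(\<lambda>k. \<phi> (of_real (r k) * \<zeta>)) \<longlonglongrightarrow> w"
proof -
  have lim: "(\<phi> \<longlongrightarrow> w) (at \<zeta> within stolz_region 2 \<zeta>)"
    using nt by (simp add: has_nontangential_limit_def)
  have "(\<lambda>k. of_real (r k) * \<zeta>) \<longlonglongrightarrow> of_real 1 * \<zeta>" by (intro tendsto_intros r)
  moreover have "of_real (r k) * \<zeta> \<in> stolz_region 2 \<zeta> \<and> of_real (r k) * \<zeta> \<noteq> \<zeta>" for k
  proof -
    have n: "cmod (of_real (r k) * \<zeta>) = r k" using r(1)[of k] \<zeta> by (simp add: norm_mult)
    have "of_real (r k) * \<zeta> - \<zeta> = of_real (r k - 1) * \<zeta>" by (simp add: algebra_simps)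
    then have "cmod (of_real (r k) * \<zeta> - \<zeta>) = 1 - r k"
      using r(2)[of k] \<zeta> by (simp add: norm_mult del: of_real_diff)
    then show ?thesis using n r(2)[of k] \<zeta> by (auto simp: stolz_region_def)
  qed
  ultimately have "filterlim (\<lambda>k. of_real (r k) * \<zeta>) (at \<zeta> within stolz_region 2 \<zeta>) sequentially"
    by (simp add: filterlim_at)
  from filterlim_compose[OF lim this] show ?thesis .
qed

lemma radii_tending_to_1:
  obtains r :: "nat \<Rightarrow> real" where "\<And>k. 0 < r k" "\<And>k. r k < 1" "r \<longlonglongrightarrow> 1"
proof
  have "(\<lambda>k. 1 - 1 / real (Suc (Suc k))) \<longlonglongrightarrow> 1 - 0"
    by (intro tendsto_intros LIMSEQ_Suc[OF LIMSEQ_Suc[OF lim_1_over_n]])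
  then show "(\<lambda>k. 1 - 1 / real (Suc (Suc k))) \<longlonglongrightarrow> 1" by simp
qed auto

text \<open>
  Taking the limit along a fixed sequence of radii makes the boundary function measurable.
\<close>

lemma boundary_function:
  assumes hol: "\<phi> holomorphic_on unit_disc" and bd: "\<And>z. z \<in> unit_disc \<Longrightarrow> cmod (\<phi> z) \<le> C"
  obtains \<psi> :: "real \<Rightarrow> complex" where "\<psi> \<in> borel_measurable circle_lebesgue"
    "AE t in circle_lebesgue. has_nontangential_limit \<phi> (cis t) (\<psi> t)"
proof -
  obtain r :: "nat \<Rightarrow> real" where r: "\<And>k. 0 < r k" "\<And>k. r k < 1" and rl: "r \<longlonglongrightarrow> 1"
    using radii_tending_to_1 by blast
  define \<psi> where "\<psi> t = lim (\<lambda>k. \<phi> (of_real (r k) * cis t))" for t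
  have "\<psi> \<in> borel_measurable circle_lebesgue"
    unfolding \<psi>_def
  proof (rule borel_measurable_lim_metric, rule continuous_imp_measurable_on_sets_lebesgue)
    show "continuous_on {0..2 * pi} (\<lambda>t. \<phi> (of_real (r k) * cis t))" for k
      by (rule continuous_on_compose2[OF holomorphic_on_imp_continuous_on[OF hol]])
         (use r(1)[of k] r(2)[of k] in \<open>auto intro!: continuous_intros simp: norm_mult\<close>)
  qed auto
  moreover have "AE t in circle_lebesgue. has_nontangential_limit \<phi> (cis t) (\<psi> t)"
  proof -
    have "AE t in circle_lebesgue. \<exists>w. has_nontangential_limit \<phi> (cis t) w"
      by (rule fatou_nontangential_limits[OF hol bd])
    then show ?thesis
    proof eventually_elim
      case (elim t)
      then obtain w where w: "has_nontangential_limit \<phi> (cis t) w" by blast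
      have "(\<lambda>k. \<phi> (of_real (r k) * cis t)) \<longlonglongrightarrow> w"
        by (rule nontangential_imp_radial_limit[OF w _ r rl]) simp
      then have "\<psi> t = w" unfolding \<psi>_def by (rule limI)
      with w show ?case by simp
    qed
  qed
  ultimately show ?thesis using that by blast
qed

lemma nontangential_limit_unique:
  assumes "has_nontangential_limit \<phi> \<zeta> w" "has_nontangential_limit \<phi> \<zeta> w'" "cmod \<zeta> = 1"
  shows "w = w'"
proof -
  obtain r :: "nat \<Rightarrow> real" where r: "\<And>k. 0 < r k" "\<And>k. r k < 1" and rl: "r \<longlonglongrightarrow> 1"
    using radii_tending_to_1 by blast
  show ?thesis
    using nontangential_imp_radial_limit[OF assms(1,3) r rl] nontangential_imp_radial_limit[OF assms(2,3) r rl]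
    by (rule LIMSEQ_unique)
qed

text \<open>
  The level set is defined through the existence of a non-tangential limit; it agrees with a superlevel set
  of \<open>|\<psi>|\<close> up to a null set and is therefore Lebesgue measurable, by completeness.
\<close>

lemma circle_measure_level_set:
  assumes \<psi>: "\<psi> \<in> borel_measurable circle_lebesgue"
    and nt: "AE t in circle_lebesgue. has_nontangential_limit \<phi> (cis t) (\<psi> t)"
  shows "circle_measure (level_set \<phi> s) = measure circle_lebesgue {t \<in> {0..2 * pi}. s \<le> cmod (\<psi> t)} / (2 * pi)"
proof -
  define B where "B = {t \<in> {0..2 * pi}. s \<le> cmod (\<psi> t)}"
  define A where "A = {t \<in> {0..<2 * pi}. cis t \<in> level_set \<phi> s}"
  have "{t \<in> space circle_lebesgue. s \<le> cmod (\<psi> t)} \<in> sets circle_lebesgue"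
    using \<psi> by measurable
  then have Bm: "B \<in> sets circle_lebesgue" by (simp add: B_def)
  then have Bl: "B \<in> sets lebesgue" by (auto simp: sets_restrict_space_iff)
  have "AE t in lebesgue. t \<in> {0..2 * pi} \<longrightarrow> has_nontangential_limit \<phi> (cis t) (\<psi> t)"
    using nt by (subst (asm) AE_restrict_space_iff) simp_all
  then obtain N where N: "N \<in> null_sets lebesgue" "\<And>t. t \<in> {0..2 * pi} \<Longrightarrow> t \<notin> N \<Longrightarrow> has_nontangential_limit \<phi> (cis t) (\<psi> t)"
    unfolding eventually_ae_filter by auto
  define N' where "N' = N \<union> {2 * pi}"
  have neg: "negligible N'" unfolding N'_def by (intro negligible_Un negligible_sing) (use N(1) in \<open>simp add: negligible_iff_null_sets\<close>)
  have AB: "t \<in> A \<longleftrightarrow> t \<in> B" if t: "t \<notin> N'" for t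
  proof (cases "t \<in> {0..<2 * pi}")
    case True
    then have nt: "has_nontangential_limit \<phi> (cis t) (\<psi> t)"
      by (intro N(2)) (use t in \<open>auto simp: N'_def\<close>)
    have "cis t \<in> level_set \<phi> s \<longleftrightarrow> s \<le> cmod (\<psi> t)"
    proof
      assume "cis t \<in> level_set \<phi> s"
      then obtain w where w: "has_nontangential_limit \<phi> (cis t) w" "s \<le> cmod w"
        unfolding level_set_def by blast
      have "\<psi> t = w" by (rule nontangential_limit_unique[OF nt w(1)]) simp
      with w(2) show "s \<le> cmod (\<psi> t)" by simp
    next
      assume "s \<le> cmod (\<psi> t)"
      with nt show "cis t \<in> level_set \<phi> s" unfolding level_set_def mem_Collect_eq by (intro conjI exI) simp_all
    qed
    then show ?thesis using True by (auto simp: A_def B_def)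
  next
    case False
    then show ?thesis using t by (auto simp: A_def B_def N'_def)
  qed
  have sub: "negligible (A \<inter> N')" "negligible (B \<inter> N')" by (auto intro: negligible_subset[OF neg])
  have "A = (B - N') \<union> (A \<inter> N')" using AB by auto
  moreover have "B - N' \<in> sets lebesgue" "A \<inter> N' \<in> sets lebesgue"
    using Bl neg sub by (auto simp: negligible_iff_null_sets intro: null_setsD2)
  ultimately have Al: "A \<in> sets lebesgue" by (metis sets.Un)
  have "measure lebesgue A = measure lebesgue B"
  proof (rule measure_eq_AE[OF _ Al Bl])
    show "AE t in lebesgue. t \<in> A \<longleftrightarrow> t \<in> B"
      using AE_not_in[OF neg[unfolded negligible_iff_null_sets]] by eventually_elim (rule AB)
  qed
  also have "measure lebesgue B = measure circle_lebesgue B"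
    by (rule measure_restrict_space[symmetric]) (auto simp: B_def)
  finally show ?thesis unfolding circle_measure_def A_def[symmetric] B_def[symmetric] by simp
qed

text \<open>
  The inequality between the Hardy norm and the boundary norm for bounded functions: Parseval on circles,
  followed by dominated convergence.
\<close>

lemma taylor_energy_le_boundary_integral:
  assumes g: "g holomorphic_on unit_disc" and C: "\<And>z. z \<in> unit_disc \<Longrightarrow> cmod (g z) \<le> C"
    and r: "\<And>k. 0 < r k" "\<And>k. r k < 1" "r \<longlonglongrightarrow> 1"
    and \<gamma>: "\<gamma> \<in> borel_measurable circle_lebesgue"
    and lim: "AE t in circle_lebesgue. (\<lambda>k. g (of_real (r k) * cis t)) \<longlonglongrightarrow> \<gamma> t"
  shows "ennreal (2 * pi * (\<Sum>n<N. (cmod (taylor_coeff g n))\<^sup>2)) \<le> (\<integral>\<^sup>+t. ennreal ((cmod (\<gamma> t))\<^sup>2) \<partial>circle_lebesgue)"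
proof -
  have r': "0 \<le> r k" for k using r(1)[of k] by simp
  note P = parseval_circle[OF g r' r(2)]
  have lim2: "AE t in circle_lebesgue. (\<lambda>k. (cmod (g (of_real (r k) * cis t)))\<^sup>2) \<longlonglongrightarrow> (cmod (\<gamma> t))\<^sup>2"
    using lim by eventually_elim (intro tendsto_intros)
  have bound: "norm ((cmod (g (of_real (r k) * cis t)))\<^sup>2) \<le> C\<^sup>2" for k t
    using C[of "of_real (r k) * cis t"] r(1)[of k] r(2)[of k] by (simp add: norm_mult power_mono)
  have \<gamma>2: "(\<lambda>t. (cmod (\<gamma> t))\<^sup>2) \<in> borel_measurable circle_lebesgue"
    using \<gamma> by measurable
  have ci: "integrable circle_lebesgue (\<lambda>_. C\<^sup>2)"
    by (rule finite_measure.integrable_const[OF finite_measure_circle_lebesgue])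
  have meas: "(\<lambda>t. (cmod (g (of_real (r k) * cis t)))\<^sup>2) \<in> borel_measurable circle_lebesgue" for k
    by (rule borel_measurable_integrable[OF P(1)])
  have int\<gamma>: "integrable circle_lebesgue (\<lambda>t. (cmod (\<gamma> t))\<^sup>2)"
    by (rule integrable_dominated_convergence[OF \<gamma>2 meas ci lim2]) (use bound in auto)
  have conv: "(\<lambda>k. \<integral>t. (cmod (g (of_real (r k) * cis t)))\<^sup>2 \<partial>circle_lebesgue) \<longlonglongrightarrow> (\<integral>t. (cmod (\<gamma> t))\<^sup>2 \<partial>circle_lebesgue)"
    by (rule integral_dominated_convergence[OF \<gamma>2 meas ci lim2]) (use bound in auto)
  have "(\<lambda>k. \<Sum>n<N. 2 * pi * ((cmod (taylor_coeff g n))\<^sup>2 * (r k ^ n)\<^sup>2)) \<longlonglongrightarrow> (\<Sum>n<N. 2 * pi * ((cmod (taylor_coeff g n))\<^sup>2 * (1 ^ n)\<^sup>2))"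
    by (intro tendsto_intros r)
  then have "(\<Sum>n<N. 2 * pi * ((cmod (taylor_coeff g n))\<^sup>2 * (1 ^ n)\<^sup>2)) \<le> (\<integral>t. (cmod (\<gamma> t))\<^sup>2 \<partial>circle_lebesgue)"
  proof (rule LIMSEQ_le[OF _ conv], intro exI[of _ 0] allI impI)
    fix k
    show "(\<Sum>n<N. 2 * pi * ((cmod (taylor_coeff g n))\<^sup>2 * (r k ^ n)\<^sup>2)) \<le> (\<integral>t. (cmod (g (of_real (r k) * cis t)))\<^sup>2 \<partial>circle_lebesgue)"
      unfolding sums_unique[OF P(2)] by (intro sum_le_suminf sums_summable[OF P(2)]) auto
  qed
  then have "2 * pi * (\<Sum>n<N. (cmod (taylor_coeff g n))\<^sup>2) \<le> (\<integral>t. (cmod (\<gamma> t))\<^sup>2 \<partial>circle_lebesgue)"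
    by (simp add: sum_distrib_left)
  then show ?thesis
    by (subst nn_integral_eq_integral[OF int\<gamma>]) (auto intro: ennreal_leI)
qed

text \<open>
  On a small disc \<open>\<phi>\<close> stays in a compact subset of the unit disc, where the partial sums of \<open>f\<close> converge
  uniformly. This reduces estimates for \<open>f \<circ> \<phi>\<close> to polynomials \<open>f\<close>, whose compositions are bounded.
\<close>

lemma taylor_coeff_composition_limit:
  assumes hol: "\<phi> holomorphic_on unit_disc" and self: "\<phi> ` unit_disc \<subseteq> unit_disc" and f: "f \<in> hardy"
  shows "composition_operator \<phi> f holomorphic_on unit_disc"
    and "(\<lambda>N. taylor_coeff (\<lambda>z. \<Sum>k<N. taylor_coeff f k * \<phi> z ^ k) n) \<longlonglongrightarrow> taylor_coeff (composition_operator \<phi> f) n"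
proof -
  have "(f \<circ> \<phi>) holomorphic_on unit_disc"
    by (rule holomorphic_on_compose_gen[OF hol hardy_holomorphic[OF f] self])
  then show holc: "composition_operator \<phi> f holomorphic_on unit_disc"
    by (rule holomorphic_transform) (simp add: composition_operator_def)
  let ?A = "ball (0::complex) (1/2)"
  have "compact (\<phi> ` cball 0 (1/2))"
    by (intro compact_continuous_image holomorphic_on_imp_continuous_on holomorphic_on_subset[OF hol]) auto
  moreover have sub: "\<phi> ` cball 0 (1/2) \<subseteq> unit_disc" using self by auto
  ultimately obtain z0 where z0: "z0 \<in> \<phi> ` cball 0 (1/2)" "\<And>w. w \<in> \<phi> ` cball 0 (1/2) \<Longrightarrow> cmod w \<le> cmod z0"
    using continuous_attains_sup[of "\<phi> ` cball 0 (1/2)" cmod] by (force intro: continuous_intros)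
  define \<rho> where "\<rho> = cmod z0"
  have \<rho>: "0 \<le> \<rho>" "\<rho> < 1" using z0(1) sub by (auto simp: \<rho>_def)
  have \<phi>\<rho>: "cmod (\<phi> z) \<le> \<rho>" if "z \<in> ?A" for z using z0(2)[of "\<phi> z"] that by (auto simp: \<rho>_def)
  have ul: "uniform_limit ?A (\<lambda>N z. \<Sum>k<N. taylor_coeff f k * \<phi> z ^ k) (\<lambda>z. \<Sum>k. taylor_coeff f k * \<phi> z ^ k) sequentially"
  proof (rule Weierstrass_m_test)
    show "summable (\<lambda>k. cmod (taylor_coeff f k) * \<rho> ^ k)"
      by (rule square_summable_imp_abs_summable[OF square_summable_taylor[OF f] \<rho>])
    show "norm (taylor_coeff f k * \<phi> z ^ k) \<le> cmod (taylor_coeff f k) * \<rho> ^ k" if "z \<in> ?A" for k z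
      using \<phi>\<rho>[OF that] by (simp add: norm_mult norm_power mult_left_mono power_mono)
  qed
  have "uniform_limit ?A (\<lambda>N z. \<Sum>k<N. taylor_coeff f k * \<phi> z ^ k) (composition_operator \<phi> f) sequentially"
  proof (rule uniform_limit_cong'[THEN iffD1, OF _ _ ul])
    fix z :: complex assume "z \<in> ?A"
    then have zd: "z \<in> unit_disc" by auto
    then have "\<phi> z \<in> unit_disc" using self by blast
    then show "(\<Sum>k. taylor_coeff f k * \<phi> z ^ k) = composition_operator \<phi> f z"
      using zd hardy_sums[OF f] by (simp add: composition_operator_def sums_iff)
  qed simp
  then have "(\<lambda>N. (deriv ^^ n) (\<lambda>z. \<Sum>k<N. taylor_coeff f k * \<phi> z ^ k) 0) \<longlonglongrightarrow> (deriv ^^ n) (composition_operator \<phi> f) 0"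
    by (rule higher_deriv_complex_uniform_limit)
       (auto intro!: always_eventually holomorphic_intros holomorphic_on_subset[OF hol])
  then show "(\<lambda>N. taylor_coeff (\<lambda>z. \<Sum>k<N. taylor_coeff f k * \<phi> z ^ k) n) \<longlonglongrightarrow> taylor_coeff (composition_operator \<phi> f) n"
    unfolding taylor_coeff_def by (intro tendsto_intros) simp_all
qed

definition dyadic_annulus :: "nat \<Rightarrow> real set" where
  "dyadic_annulus n = {1 - (1 / 2) ^ n..<1 - (1 / 2) ^ Suc n}"

text \<open>
  Equals \<open>(3/2)\<^sup>|\<^sup>m\<^sup>-\<^sup>n\<^sup>|\<close> on the \<open>n\<close>-th annulus. Written as a series of indicator functions it is visibly
  measurable and can be integrated term by term.
\<close>

definition annulus_weight :: "nat \<Rightarrow> real \<Rightarrow> ennreal" where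
  "annulus_weight m r = (\<Sum>n. ennreal ((3 / 2) ^ nat_dist m n) * indicator (dyadic_annulus n) r)"

lemma annulus_weight_measurable [measurable]: "annulus_weight m \<in> borel_measurable borel"
  unfolding annulus_weight_def[abs_def] dyadic_annulus_def by measurable

lemma dyadic_annulus_exists:
  assumes "0 \<le> r" "r < 1"
  shows "\<exists>n. r \<in> dyadic_annulus n"
proof -
  obtain n where "(1 / 2) ^ n < 1 - r" using real_arch_pow_inv[of "1 - r" "1 / 2"] assms by auto
  then have ex: "r < 1 - (1 / 2) ^ n" by simp
  define l where "l = (LEAST n. r < 1 - (1 / 2) ^ n)"
  have l: "r < 1 - (1 / 2) ^ l" unfolding l_def by (rule LeastI[of "\<lambda>n. r < 1 - (1 / 2) ^ n", OF ex])
  then obtain k where k: "l = Suc k" using assms by (cases l) auto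
  have "\<not> r < 1 - (1 / 2) ^ k" using not_less_Least[of k "\<lambda>n. r < 1 - (1 / 2) ^ n"] k by (simp add: l_def)
  then show ?thesis using l k by (intro exI[of _ k]) (simp add: dyadic_annulus_def)
qed

lemma sum_block_poly_sq_le_weighted:
  assumes z: "cmod z < 1"
  shows "ennreal ((cmod (\<Sum>m<M. block_poly a m z))\<^sup>2) \<le> 6 * (\<Sum>m<M. annulus_weight m (cmod z) * ennreal ((cmod (block_poly a m z))\<^sup>2))"
proof -
  obtain n where n: "cmod z \<in> dyadic_annulus n" using dyadic_annulus_exists[of "cmod z"] z by auto
  have w: "ennreal ((3 / 2) ^ nat_dist m n) \<le> annulus_weight m (cmod z)" for m
    using sum_le_suminf[of "\<lambda>n. ennreal ((3 / 2) ^ nat_dist m n) * indicator (dyadic_annulus n) (cmod z)" "{n}"] n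
    by (simp add: annulus_weight_def)
  have "ennreal ((cmod (\<Sum>m<M. block_poly a m z))\<^sup>2) \<le> ennreal (6 * (\<Sum>m<M. (3 / 2) ^ nat_dist m n * (cmod (block_poly a m z))\<^sup>2))"
    by (intro ennreal_leI sum_blocks_sq_le)
  also have "\<dots> = 6 * (\<Sum>m<M. ennreal ((3 / 2) ^ nat_dist m n) * ennreal ((cmod (block_poly a m z))\<^sup>2))"
    by (simp add: ennreal_mult sum_nonneg flip: sum_ennreal)
  also have "\<dots> \<le> 6 * (\<Sum>m<M. annulus_weight m (cmod z) * ennreal ((cmod (block_poly a m z))\<^sup>2))"
    by (intro mult_left_mono sum_mono mult_right_mono w) auto
  finally show ?thesis .
qed

text \<open>
  The decay left after separating the blocks: \<open>(3/2) (1/2) = 3/4\<close>. Enlarging each annulus to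
  \<open>{1 - (1/2)\<^sup>n..}\<close> brings in the level sets.
\<close>

lemma weighted_block_kernel_le:
  assumes r: "0 \<le> r"
  shows "annulus_weight m r * ennreal (block_kernel m r) \<le>
    (\<Sum>n. ennreal (8 * 2 ^ n * (3 / 4) ^ nat_dist m n) * indicator {1 - (1 / 2) ^ n..} r)"
proof -
  have "annulus_weight m r * ennreal (block_kernel m r)
      = (\<Sum>n. ennreal ((3 / 2) ^ nat_dist m n) * indicator (dyadic_annulus n) r * ennreal (block_kernel m r))"
    unfolding annulus_weight_def by (rule ennreal_suminf_multc[symmetric])
  also have "\<dots> \<le> (\<Sum>n. ennreal (8 * 2 ^ n * (3 / 4) ^ nat_dist m n) * indicator {1 - (1 / 2) ^ n..} r)"
  proof (intro suminf_le)
    fix n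
    show "ennreal ((3 / 2) ^ nat_dist m n) * indicator (dyadic_annulus n) r * ennreal (block_kernel m r)
        \<le> ennreal (8 * 2 ^ n * (3 / 4) ^ nat_dist m n) * indicator {1 - (1 / 2) ^ n..} r"
    proof (cases "r \<in> dyadic_annulus n")
      case True
      then have "block_kernel m r \<le> 8 * 2 ^ n * (1 / 2) ^ nat_dist m n"
        using r by (intro block_kernel_le) (auto simp: dyadic_annulus_def)
      then have "(3 / 2) ^ nat_dist m n * block_kernel m r \<le> (3 / 2) ^ nat_dist m n * (8 * 2 ^ n * (1 / 2) ^ nat_dist m n)"
        by (intro mult_left_mono) auto
      also have "\<dots> = 8 * 2 ^ n * (3 / 4) ^ nat_dist m n" by (simp flip: power_mult_distrib)
      finally have "ennreal ((3 / 2) ^ nat_dist m n) * ennreal (block_kernel m r) \<le> ennreal (8 * 2 ^ n * (3 / 4) ^ nat_dist m n)"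
        by (simp add: ennreal_leI flip: ennreal_mult')
      then show ?thesis using True by (simp add: dyadic_annulus_def)
    qed simp
  qed auto
  finally show ?thesis .
qed

section \<open>The block estimate for composition operators\<close>

text \<open>
  The mass of the \<open>n\<close>-th dyadic level set relative to the width \<open>2\<^sup>-\<^sup>n\<close> of the corresponding annulus.
\<close>

definition level_mass :: "(complex \<Rightarrow> complex) \<Rightarrow> nat \<Rightarrow> real" where
  "level_mass \<phi> n = 2 ^ n * circle_measure (level_set \<phi> (1 - (1 / 2) ^ n))"

text \<open>
  The constant 48 is the product of 6 from \<open>sum_blocks_sq_le\<close> and 8 from \<open>block_kernel_le\<close>.
\<close>

definition block_bound :: "(complex \<Rightarrow> complex) \<Rightarrow> nat \<Rightarrow> real" where
  "block_bound \<phi> m = 48 * (\<Sum>n. (3 / 4) ^ nat_dist m n * level_mass \<phi> n)"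

lemma circle_measure_nonneg: "0 \<le> circle_measure E"
  by (simp add: circle_measure_def)

lemma level_mass_nonneg: "0 \<le> level_mass \<phi> n"
  by (simp add: level_mass_def circle_measure_nonneg)

lemma block_energy_summable:
  assumes "f \<in> hardy"
  shows "summable (block_energy (taylor_coeff f))" "suminf (block_energy (taylor_coeff f)) \<le> (hardy_norm f)\<^sup>2"
proof -
  have le: "(\<Sum>m<M. block_energy (taylor_coeff f) m) \<le> (hardy_norm f)\<^sup>2" for M
    unfolding block_energy_def sum_dyadic_blocks by (rule hardy_partial_energy_le[OF assms]) simp
  show s: "summable (block_energy (taylor_coeff f))"
  proof (rule bounded_imp_summable)
    show "(\<Sum>m\<le>M. block_energy (taylor_coeff f) m) \<le> (hardy_norm f)\<^sup>2" for M
      using le[of "Suc M"] by (simp only: lessThan_Suc_atMost)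
  qed (rule block_energy_nonneg)
  show "suminf (block_energy (taylor_coeff f)) \<le> (hardy_norm f)\<^sup>2"
    by (rule suminf_le_const[OF s le])
qed

text \<open>
  For a polynomial, \<open>\<parallel>f \<circ> \<phi>\<parallel>\<^sup>2\<close> is at most the mean of \<open>|f \<circ> \<psi>|\<^sup>2\<close> over the circle, where \<open>\<psi>\<close> is the boundary function of
  \<open>\<phi>\<close>. The pointwise separation of blocks splits this mean into contributions \<open>Q\<^sub>m\<close> of the single blocks, and
  integrating the pointwise bounds on the block polynomials gives the bounds on \<open>Q\<^sub>m\<close>. A general \<open>f\<close> is
  reached through its partial sums of length \<open>2\<^sup>M - 1\<close>, whose blocks are the first \<open>M\<close> blocks of \<open>f\<close>.
\<close>

lemma composition_block_estimate:
  assumes hol: "\<phi> holomorphic_on unit_disc" and self: "\<phi> ` unit_disc \<subseteq> unit_disc"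
    and sx: "\<And>m. summable (\<lambda>n. (3 / 4) ^ nat_dist m n * level_mass \<phi> n)"
    and K: "\<And>m. block_bound \<phi> m \<le> K"
  obtains Q :: "(nat \<Rightarrow> complex) \<Rightarrow> nat \<Rightarrow> real" where
    "\<And>a m. 0 \<le> Q a m" "\<And>a m. Q a m \<le> block_bound \<phi> m * block_energy a m"
    "\<And>f. f \<in> hardy \<Longrightarrow> composition_operator \<phi> f \<in> hardy"
    "\<And>f. f \<in> hardy \<Longrightarrow> (hardy_norm (composition_operator \<phi> f))\<^sup>2 \<le> (\<Sum>m. Q (taylor_coeff f) m)"
    "\<And>(J :: (real \<times> nat) set) e m. finite J \<Longrightarrow> hardy_orthonormal J e \<Longrightarrow> (\<Sum>j\<in>J. Q (taylor_coeff (e j)) m) \<le> block_bound \<phi> m"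
proof -
  interpret circ: finite_measure circle_lebesgue by (rule finite_measure_circle_lebesgue)
  have bd: "cmod (\<phi> z) \<le> 1" if "z \<in> unit_disc" for z
  proof -
    have "\<phi> z \<in> unit_disc" using self that by blast
    then show ?thesis by simp
  qed
  obtain \<psi> where \<psi> [measurable]: "\<psi> \<in> borel_measurable circle_lebesgue"
    and nt: "AE t in circle_lebesgue. has_nontangential_limit \<phi> (cis t) (\<psi> t)"
    using boundary_function[OF hol bd] by metis
  define E where "E n = {t \<in> {0..2 * pi}. 1 - (1 / 2) ^ n \<le> cmod (\<psi> t)}" for n :: nat
  have E_sets: "E n \<in> sets circle_lebesgue" for n
  proof -
    have "{t \<in> space circle_lebesgue. 1 - (1 / 2) ^ n \<le> cmod (\<psi> t)} \<in> sets circle_lebesgue"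
      by measurable
    then show ?thesis by (simp add: E_def)
  qed
  have E_mass: "2 ^ n * measure circle_lebesgue (E n) = 2 * pi * level_mass \<phi> n" for n
    unfolding level_mass_def circle_measure_level_set[OF \<psi> nt] E_def by simp
  \<comment> \<open>Summability forces \<open>level_mass \<phi> n = o((4/3)\<^sup>n)\<close>, so the level sets shrink to a null set.\<close>
  have lt1: "AE t in circle_lebesgue. cmod (\<psi> t) < 1"
  proof -
    define F where "F = {t \<in> space circle_lebesgue. \<not> cmod (\<psi> t) < 1}"
    have Fs: "F \<in> sets circle_lebesgue" unfolding F_def by measurable
    have "measure circle_lebesgue F \<le> measure circle_lebesgue (E n)" for n
    proof (rule circ.finite_measure_mono[OF _ E_sets])
      have "1 - (1 / 2) ^ n \<le> (1::real)" by simp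
      then have "1 - (1 / 2) ^ n \<le> x" if "\<not> x < 1" for x :: real using that by linarith
      then show "F \<subseteq> E n" by (auto simp: F_def E_def)
    qed
    also have "measure circle_lebesgue (E n) = 2 * pi * ((2 / 3) ^ n * ((3 / 4) ^ nat_dist 0 n * level_mass \<phi> n))" for n
    proof -
      have "measure circle_lebesgue (E n) = 2 * pi * (level_mass \<phi> n / 2 ^ n)"
        using E_mass[of n] by (simp add: field_simps)
      also have "level_mass \<phi> n / 2 ^ n = (2 / 3) ^ n * ((3 / 4) ^ nat_dist 0 n * level_mass \<phi> n)"
      proof -
        have "(2 / 3 :: real) ^ n * (3 / 4) ^ n = 1 / 2 ^ n" by (simp add: power_one_over flip: power_mult_distrib)
        then show ?thesis by (simp add: nat_dist_def flip: mult.assoc)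
      qed
      finally show ?thesis .
    qed
    finally have le: "measure circle_lebesgue F \<le> 2 * pi * ((2 / 3) ^ n * ((3 / 4) ^ nat_dist 0 n * level_mass \<phi> n))" for n .
    have "(\<lambda>n. 2 * pi * ((2 / 3) ^ n * ((3 / 4) ^ nat_dist 0 n * level_mass \<phi> n))) \<longlonglongrightarrow> 2 * pi * (0 * 0)"
      by (intro tendsto_intros summable_LIMSEQ_zero[OF sx] LIMSEQ_power_zero) simp
    then have "measure circle_lebesgue F \<le> 2 * pi * (0 * 0)"
      by (rule LIMSEQ_le_const) (use le in blast)
    then have "measure circle_lebesgue F = 0" using measure_nonneg[of circle_lebesgue F] by simp
    then have "emeasure circle_lebesgue F = 0" by (simp add: circ.emeasure_eq_measure)
    then show ?thesis using Fs unfolding F_def by (subst AE_iff_measurable) auto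
  qed
  define q where "q a m = (\<integral>\<^sup>+t. annulus_weight m (cmod (\<psi> t)) * ennreal ((cmod (block_poly a m (\<psi> t)))\<^sup>2) \<partial>circle_lebesgue)" for a m
  define k where "k m = (\<integral>\<^sup>+t. annulus_weight m (cmod (\<psi> t)) * ennreal (block_kernel m (cmod (\<psi> t))) \<partial>circle_lebesgue)" for m
  have bp_meas [measurable]: "(\<lambda>t. block_poly a m (\<psi> t)) \<in> borel_measurable circle_lebesgue" for a m
    unfolding block_poly_def by measurable
  have bk_meas [measurable]: "(\<lambda>t. block_kernel m (cmod (\<psi> t))) \<in> borel_measurable circle_lebesgue" for m
    unfolding block_kernel_def by measurable
  have k_le: "k m \<le> ennreal (2 * pi * block_bound \<phi> m / 6)" for m
  proof -
    have "k m \<le> (\<integral>\<^sup>+t. (\<Sum>n. ennreal (8 * 2 ^ n * (3 / 4) ^ nat_dist m n) * indicator {1 - (1 / 2) ^ n..} (cmod (\<psi> t))) \<partial>circle_lebesgue)"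
      unfolding k_def by (intro nn_integral_mono weighted_block_kernel_le) auto
    also have "\<dots> = (\<integral>\<^sup>+t. (\<Sum>n. ennreal (8 * 2 ^ n * (3 / 4) ^ nat_dist m n) * indicator (E n) t) \<partial>circle_lebesgue)"
      by (intro nn_integral_cong suminf_cong) (auto simp: E_def indicator_def)
    also have "\<dots> = (\<Sum>n. \<integral>\<^sup>+t. ennreal (8 * 2 ^ n * (3 / 4) ^ nat_dist m n) * indicator (E n) t \<partial>circle_lebesgue)"
      by (rule nn_integral_suminf) (use E_sets in measurable)
    also have "\<dots> = (\<Sum>n. ennreal (8 * 2 * pi * ((3 / 4) ^ nat_dist m n * level_mass \<phi> n)))"
    proof (rule suminf_cong)
      fix n
      have "(\<integral>\<^sup>+t. ennreal (8 * 2 ^ n * (3 / 4) ^ nat_dist m n) * indicator (E n) t \<partial>circle_lebesgue)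
          = ennreal (8 * 2 ^ n * (3 / 4) ^ nat_dist m n) * ennreal (measure circle_lebesgue (E n))"
        by (subst nn_integral_cmult_indicator[OF E_sets]) (simp add: circ.emeasure_eq_measure)
      also have "\<dots> = ennreal (8 * 2 ^ n * (3 / 4) ^ nat_dist m n * measure circle_lebesgue (E n))"
        by (rule ennreal_mult[symmetric]) auto
      also have "8 * 2 ^ n * (3 / 4) ^ nat_dist m n * measure circle_lebesgue (E n) = 8 * 2 * pi * ((3 / 4) ^ nat_dist m n * level_mass \<phi> n)"
        using E_mass[of n] by (simp add: mult_ac)
      finally show "(\<integral>\<^sup>+t. ennreal (8 * 2 ^ n * (3 / 4) ^ nat_dist m n) * indicator (E n) t \<partial>circle_lebesgue)
          = ennreal (8 * 2 * pi * ((3 / 4) ^ nat_dist m n * level_mass \<phi> n))" .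
    qed
    also have "\<dots> = ennreal (\<Sum>n. 8 * 2 * pi * ((3 / 4) ^ nat_dist m n * level_mass \<phi> n))"
      by (intro suminf_ennreal2 summable_mult sx) (simp add: level_mass_nonneg)
    also have "(\<Sum>n. 8 * 2 * pi * ((3 / 4) ^ nat_dist m n * level_mass \<phi> n)) = 2 * pi * block_bound \<phi> m / 6"
      by (subst suminf_mult[OF sx]) (simp add: block_bound_def)
    finally show ?thesis .
  qed
  have B0: "0 \<le> block_bound \<phi> m" for m
    unfolding block_bound_def by (intro mult_nonneg_nonneg suminf_nonneg sx) (auto simp: level_mass_nonneg)
  have q_le: "q a m \<le> ennreal (block_energy a m * (2 * pi * block_bound \<phi> m / 6))" for a m
  proof -
    have "q a m \<le> (\<integral>\<^sup>+t. ennreal (block_energy a m) * (annulus_weight m (cmod (\<psi> t)) * ennreal (block_kernel m (cmod (\<psi> t)))) \<partial>circle_lebesgue)"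
      unfolding q_def
    proof (intro nn_integral_mono)
      fix t
      have "ennreal ((cmod (block_poly a m (\<psi> t)))\<^sup>2) \<le> ennreal (block_energy a m) * ennreal (block_kernel m (cmod (\<psi> t)))"
        unfolding ennreal_mult'[OF block_energy_nonneg, symmetric] by (intro ennreal_leI block_poly_sq_le)
      from mult_left_mono[OF this, of "annulus_weight m (cmod (\<psi> t))"]
      show "annulus_weight m (cmod (\<psi> t)) * ennreal ((cmod (block_poly a m (\<psi> t)))\<^sup>2)
        \<le> ennreal (block_energy a m) * (annulus_weight m (cmod (\<psi> t)) * ennreal (block_kernel m (cmod (\<psi> t))))"
        by (simp add: mult_ac)
    qed
    also have "\<dots> = ennreal (block_energy a m) * k m"
      unfolding k_def by (rule nn_integral_cmult) measurable
    also have "\<dots> \<le> ennreal (block_energy a m) * ennreal (2 * pi * block_bound \<phi> m / 6)"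
      by (intro mult_left_mono k_le) auto
    finally show ?thesis unfolding ennreal_mult'[OF block_energy_nonneg, symmetric] .
  qed
  \<comment> \<open>The factor 6 comes from separating the blocks, \<open>2 * pi\<close> from the normalisation of the circle.\<close>
  define Q where "Q a m = 6 * enn2real (q a m) / (2 * pi)" for a m
  have q_fin: "q a m = ennreal (2 * pi / 6 * Q a m)" for a m
  proof -
    have "q a m < \<infinity>" using q_le[of a m] by (rule le_less_trans) simp
    then show ?thesis by (simp add: Q_def)
  qed
  have Q0: "0 \<le> Q a m" for a m by (simp add: Q_def)
  have Q_le: "Q a m \<le> block_bound \<phi> m * block_energy a m" for a m
  proof -
    have "2 * pi / 6 * Q a m \<le> block_energy a m * (2 * pi * block_bound \<phi> m / 6)"
      using q_le[of a m] unfolding q_fin using B0[of m] block_energy_nonneg[of a m] by (subst (asm) ennreal_le_iff) auto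
    then show ?thesis by (simp add: field_simps)
  qed
  have Q_sum: "(\<Sum>j\<in>J. Q (taylor_coeff (e j)) m) \<le> block_bound \<phi> m"
    if J: "finite J" "hardy_orthonormal J e" for J :: "(real \<times> nat) set" and e m
  proof -
    have "(\<Sum>j\<in>J. q (taylor_coeff (e j)) m)
      = (\<integral>\<^sup>+t. (\<Sum>j\<in>J. annulus_weight m (cmod (\<psi> t)) * ennreal ((cmod (block_poly (taylor_coeff (e j)) m (\<psi> t)))\<^sup>2)) \<partial>circle_lebesgue)"
      unfolding q_def by (rule nn_integral_sum[symmetric]) measurable
    also have "\<dots> \<le> k m"
      unfolding k_def sum_distrib_left[symmetric]
      by (intro nn_integral_mono mult_left_mono) (auto simp: sum_ennreal intro!: ennreal_leI sum_block_poly_orthonormal_le J)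
    also have "\<dots> \<le> ennreal (2 * pi * block_bound \<phi> m / 6)" by (rule k_le)
    also have "(\<Sum>j\<in>J. q (taylor_coeff (e j)) m) = ennreal (\<Sum>j\<in>J. 2 * pi / 6 * Q (taylor_coeff (e j)) m)"
      unfolding q_fin by (rule sum_ennreal) (simp add: Q0)
    finally have "(\<Sum>j\<in>J. 2 * pi / 6 * Q (taylor_coeff (e j)) m) \<le> 2 * pi * block_bound \<phi> m / 6"
      using B0[of m] by (subst (asm) ennreal_le_iff) auto
    then show ?thesis unfolding sum_distrib_left[symmetric] by (simp add: field_simps)
  qed
  obtain r :: "nat \<Rightarrow> real" where r: "\<And>k. 0 < r k" "\<And>k. r k < 1" and rl: "r \<longlonglongrightarrow> 1"
    using radii_tending_to_1 by blast
  have comp: "(\<Sum>n<N. (cmod (taylor_coeff (composition_operator \<phi> f) n))\<^sup>2) \<le> (\<Sum>m. Q (taylor_coeff f) m)"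
    if f: "f \<in> hardy" for f N
  proof -
    define a where "a = taylor_coeff f"
    have "summable (\<lambda>m. K * block_energy a m)" unfolding a_def by (intro summable_mult block_energy_summable f)
    then have sQ: "summable (Q a)"
      by (rule summable_comparison_test'[of _ 0])
         (use Q0 Q_le K block_energy_nonneg in \<open>auto intro: order_trans[OF Q_le mult_right_mono]\<close>)
    define P where "P M z = (\<Sum>k<2 ^ M - 1. a k * z ^ k)" for M :: nat and z :: complex
    have P_blocks: "P M z = (\<Sum>m<M. block_poly a m z)" for M z
      unfolding P_def block_poly_def sum_dyadic_blocks ..
    have main: "(\<Sum>n<N. (cmod (taylor_coeff (\<lambda>z. P M (\<phi> z)) n))\<^sup>2) \<le> (\<Sum>m. Q a m)" for M
    proof -
      have "ennreal (2 * pi * (\<Sum>n<N. (cmod (taylor_coeff (\<lambda>z. P M (\<phi> z)) n))\<^sup>2))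
          \<le> (\<integral>\<^sup>+t. ennreal ((cmod (P M (\<psi> t)))\<^sup>2) \<partial>circle_lebesgue)"
      proof (rule taylor_energy_le_boundary_integral[OF _ _ r rl])
        show "(\<lambda>z. P M (\<phi> z)) holomorphic_on unit_disc"
          unfolding P_def by (intro holomorphic_intros hol)
        show "cmod (P M (\<phi> z)) \<le> (\<Sum>k<2 ^ M - 1. cmod (a k))" if "z \<in> unit_disc" for z
          unfolding P_def
        proof (rule order_trans[OF norm_sum sum_mono])
          fix k
          have "cmod (\<phi> z) ^ k \<le> 1" using bd[OF that] by (intro power_le_one) auto
          then show "norm (a k * \<phi> z ^ k) \<le> cmod (a k)" by (simp add: norm_mult norm_power mult_left_le)
        qed
        show "(\<lambda>t. P M (\<psi> t)) \<in> borel_measurable circle_lebesgue" unfolding P_def by measurable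
        show "AE t in circle_lebesgue. (\<lambda>k. P M (\<phi> (of_real (r k) * cis t))) \<longlonglongrightarrow> P M (\<psi> t)"
          using nt
        proof eventually_elim
          case (elim t)
          have "(\<lambda>k. \<phi> (of_real (r k) * cis t)) \<longlonglongrightarrow> \<psi> t"
            by (rule nontangential_imp_radial_limit[OF elim _ r rl]) simp
          then show ?case unfolding P_def by (intro tendsto_intros)
        qed
      qed
      also have "\<dots> \<le> (\<integral>\<^sup>+t. 6 * (\<Sum>m<M. annulus_weight m (cmod (\<psi> t)) * ennreal ((cmod (block_poly a m (\<psi> t)))\<^sup>2)) \<partial>circle_lebesgue)"
      proof (rule nn_integral_mono_AE)
        show "AE t in circle_lebesgue. ennreal ((cmod (P M (\<psi> t)))\<^sup>2) \<le> 6 * (\<Sum>m<M. annulus_weight m (cmod (\<psi> t)) * ennreal ((cmod (block_poly a m (\<psi> t)))\<^sup>2))"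
          using lt1 unfolding P_blocks by eventually_elim (rule sum_block_poly_sq_le_weighted)
      qed
      also have "\<dots> = 6 * (\<Sum>m<M. q a m)"
        unfolding q_def by (subst nn_integral_cmult, measurable, subst nn_integral_sum, measurable)
      also have "\<dots> = ennreal (2 * pi * (\<Sum>m<M. Q a m))"
      proof -
        have "(\<Sum>m<M. q a m) = ennreal (\<Sum>m<M. 2 * pi / 6 * Q a m)"
          unfolding q_fin by (rule sum_ennreal) (simp add: Q0)
        then have "6 * (\<Sum>m<M. q a m) = ennreal 6 * ennreal (\<Sum>m<M. 2 * pi / 6 * Q a m)" by simp
        also have "\<dots> = ennreal (6 * (\<Sum>m<M. 2 * pi / 6 * Q a m))"
          by (rule ennreal_mult[symmetric]) (auto intro!: sum_nonneg simp: Q0)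
        also have "6 * (\<Sum>m<M. 2 * pi / 6 * Q a m) = 2 * pi * (\<Sum>m<M. Q a m)"
          unfolding sum_distrib_left[symmetric] by simp
        finally show ?thesis .
      qed
      finally have "2 * pi * (\<Sum>n<N. (cmod (taylor_coeff (\<lambda>z. P M (\<phi> z)) n))\<^sup>2) \<le> 2 * pi * (\<Sum>m<M. Q a m)"
        by (subst (asm) ennreal_le_iff) (intro mult_nonneg_nonneg sum_nonneg Q0, simp_all)
      then have "(\<Sum>n<N. (cmod (taylor_coeff (\<lambda>z. P M (\<phi> z)) n))\<^sup>2) \<le> (\<Sum>m<M. Q a m)"
        by simp
      also have "\<dots> \<le> (\<Sum>m. Q a m)" by (intro sum_le_suminf sQ) (auto simp: Q0)
      finally show ?thesis .
    qed
    have fl: "filterlim (\<lambda>M. 2 ^ M - 1 :: nat) at_top sequentially"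
    proof (rule filterlim_at_top_mono[OF filterlim_ident])
      have "M < 2 ^ M" for M :: nat by (rule less_exp)
      then have "M \<le> 2 ^ M - 1" for M :: nat using le_diff_conv2 by (simp add: Suc_leI less_eq_Suc_le)
      then show "\<forall>\<^sub>F M in sequentially. M \<le> 2 ^ M - 1" by (intro always_eventually allI)
    qed
    have "(\<lambda>M. taylor_coeff (\<lambda>z. P M (\<phi> z)) n) \<longlonglongrightarrow> taylor_coeff (composition_operator \<phi> f) n" for n
      unfolding P_def a_def by (rule filterlim_compose[OF taylor_coeff_composition_limit(2)[OF hol self f] fl])
    then have "(\<lambda>M. \<Sum>n<N. (cmod (taylor_coeff (\<lambda>z. P M (\<phi> z)) n))\<^sup>2) \<longlonglongrightarrow> (\<Sum>n<N. (cmod (taylor_coeff (composition_operator \<phi> f) n))\<^sup>2)"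
      by (intro tendsto_intros)
    then show ?thesis unfolding a_def[symmetric] by (rule LIMSEQ_le_const2) (use main in blast)
  qed
  have in_hardy: "composition_operator \<phi> f \<in> hardy" if f: "f \<in> hardy" for f
  proof -
    have "summable (\<lambda>n. (cmod (taylor_coeff (composition_operator \<phi> f) n))\<^sup>2)"
    proof (rule bounded_imp_summable)
      show "(\<Sum>n\<le>N. (cmod (taylor_coeff (composition_operator \<phi> f) n))\<^sup>2) \<le> (\<Sum>m. Q (taylor_coeff f) m)" for N
        using comp[OF f, of "Suc N"] by (simp only: lessThan_Suc_atMost)
    qed simp
    then show ?thesis using taylor_coeff_composition_limit(1)[OF hol self f]
      by (auto simp: hardy_def composition_operator_def)
  qed
  have "(hardy_norm (composition_operator \<phi> f))\<^sup>2 \<le> (\<Sum>m. Q (taylor_coeff f) m)" if f: "f \<in> hardy" for f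
  proof (rule LIMSEQ_le_const2)
    show "(\<lambda>N. \<Sum>n<N. (cmod (taylor_coeff (composition_operator \<phi> f) n))\<^sup>2) \<longlonglongrightarrow> (hardy_norm (composition_operator \<phi> f))\<^sup>2"
      using hardy_norm_sq_sums[OF in_hardy[OF f]] by (simp add: sums_def)
  qed (use comp[OF f] in blast)
  with Q0 Q_le in_hardy Q_sum show ?thesis using that by blast
qed

section \<open>Compactness and the Schatten class\<close>

text \<open>
  On the interval from \<open>1 - 2\<^sup>-\<^sup>n\<close> to \<open>1 - 2\<^sup>-\<^sup>n\<^sup>-\<^sup>1\<close>, of length \<open>2\<^sup>-\<^sup>n\<^sup>-\<^sup>1\<close>, monotonicity bounds the integrand from below by
  \<open>|E(1 - 2\<^sup>-\<^sup>n\<^sup>-\<^sup>1)|\<^sup>q 2\<^sup>n\<^sup>(\<^sup>1\<^sup>+\<^sup>q\<^sup>)\<close>, so the integral over this interval dominates a fixed multiple of the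
  \<open>q\<close>-th power of \<open>level_mass \<phi> (Suc n)\<close>.
\<close>

lemma level_mass_powr_summable:
  assumes q: "q > 0" and hol: "\<phi> holomorphic_on unit_disc" and self: "\<phi> ` unit_disc \<subseteq> unit_disc"
    and fin: "(\<integral>\<^sup>+s\<in>{0<..<1}. ennreal (circle_measure (level_set \<phi> s) powr q / (1 - s) powr (1 + q)) \<partial>lborel) < \<infinity>"
  shows "summable (\<lambda>n. level_mass \<phi> n powr q)"
proof -
  interpret circ: finite_measure circle_lebesgue by (rule finite_measure_circle_lebesgue)
  define \<epsilon> where "\<epsilon> s = circle_measure (level_set \<phi> s)" for s
  have bd: "cmod (\<phi> z) \<le> 1" if "z \<in> unit_disc" for z
  proof -
    have "\<phi> z \<in> unit_disc" using self that by blast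
    then show ?thesis by simp
  qed
  obtain \<psi> where \<psi> [measurable]: "\<psi> \<in> borel_measurable circle_lebesgue"
    and nt: "AE t in circle_lebesgue. has_nontangential_limit \<phi> (cis t) (\<psi> t)"
    using boundary_function[OF hol bd] by metis
  have anti: "\<epsilon> s' \<le> \<epsilon> s" if "s \<le> s'" for s s'
  proof -
    have "{t \<in> space circle_lebesgue. s \<le> cmod (\<psi> t)} \<in> sets circle_lebesgue" by measurable
    then have "{t \<in> {0..2 * pi}. s \<le> cmod (\<psi> t)} \<in> sets circle_lebesgue" by simp
    then have "measure circle_lebesgue {t \<in> {0..2 * pi}. s' \<le> cmod (\<psi> t)} \<le> measure circle_lebesgue {t \<in> {0..2 * pi}. s \<le> cmod (\<psi> t)}"
      by (rule circ.finite_measure_mono[rotated]) (use that in auto)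
    then show ?thesis unfolding \<epsilon>_def circle_measure_level_set[OF \<psi> nt] by (intro divide_right_mono) auto
  qed
  have \<epsilon>0: "0 \<le> \<epsilon> s" for s by (simp add: \<epsilon>_def circle_measure_nonneg)
  define r where "r n = 1 - (1 / 2 :: real) ^ n" for n
  define I where "I n = {r n<..<r (Suc n)}" for n
  define c where "c n = \<epsilon> (r (Suc n)) powr q * (2 ^ n) powr (1 + q)" for n
  have c0: "0 \<le> c n" for n by (simp add: c_def)
  have r01: "0 \<le> r n" "r n < 1" for n by (auto simp: r_def power_le_one)
  have r_mono: "r m \<le> r n" if "m \<le> n" for m n using that by (simp add: r_def power_decreasing)
  have disj: "disjoint_family I"
    unfolding disjoint_family_on_def
  proof (intro ballI impI)
    fix m n :: nat assume "m \<noteq> n"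
    then show "I m \<inter> I n = {}"
      using r_mono[of "Suc m" n] r_mono[of "Suc n" m] by (cases "m < n") (auto simp: I_def)
  qed
  have cm: "ennreal (c n) * ennreal ((1 / 2) ^ Suc n) = ennreal (c n * (1 / 2) ^ Suc n)" for n
    by (rule ennreal_mult[symmetric]) (auto simp: c0)
  have "(\<Sum>n. ennreal (c n) * ennreal ((1 / 2) ^ Suc n)) = (\<Sum>n. \<integral>\<^sup>+s. ennreal (c n) * indicator (I n) s \<partial>lborel)"
  proof (rule suminf_cong)
    fix n
    have "emeasure lborel (I n) = ennreal (r (Suc n) - r n)"
      unfolding I_def by (rule emeasure_lborel_Ioo) (rule r_mono, simp)
    also have "r (Suc n) - r n = (1 / 2) ^ Suc n" by (simp add: r_def)
    finally show "ennreal (c n) * ennreal ((1 / 2) ^ Suc n) = (\<integral>\<^sup>+s. ennreal (c n) * indicator (I n) s \<partial>lborel)"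
      by (subst nn_integral_cmult_indicator) (auto simp: I_def)
  qed
  also have "\<dots> = (\<integral>\<^sup>+s. (\<Sum>n. ennreal (c n) * indicator (I n) s) \<partial>lborel)"
    by (rule nn_integral_suminf[symmetric]) (simp add: I_def)
  also have "\<dots> \<le> (\<integral>\<^sup>+s\<in>{0<..<1}. ennreal (\<epsilon> s powr q / (1 - s) powr (1 + q)) \<partial>lborel)"
  proof (rule nn_integral_mono)
    fix s :: real
    show "(\<Sum>n. ennreal (c n) * indicator (I n) s) \<le> ennreal (\<epsilon> s powr q / (1 - s) powr (1 + q)) * indicator {0<..<1} s"
    proof (cases "\<exists>n. s \<in> I n")
      case True
      then obtain n where n: "s \<in> I n" by blast
      then have s: "r n < s" "s < r (Suc n)" by (auto simp: I_def)
      then have s01: "0 < s" "s < 1" using r01[of n] r01[of "Suc n"] by auto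
      have "(1 - s) powr (1 + q) \<le> ((1 / 2) ^ n) powr (1 + q)"
        using s(1) s01 q by (intro powr_mono2) (auto simp: r_def)
      also have "\<dots> = 1 / (2 ^ n) powr (1 + q)" by (simp add: power_one_over powr_divide)
      finally have "(2 ^ n) powr (1 + q) \<le> 1 / (1 - s) powr (1 + q)"
        using s01 by (simp add: field_simps)
      moreover have "\<epsilon> (r (Suc n)) powr q \<le> \<epsilon> s powr q"
        using anti[of s "r (Suc n)"] s \<epsilon>0 q by (intro powr_mono2) auto
      ultimately have "c n \<le> \<epsilon> s powr q * (1 / (1 - s) powr (1 + q))"
        unfolding c_def by (intro mult_mono) auto
      then have "ennreal (c n) \<le> ennreal (\<epsilon> s powr q / (1 - s) powr (1 + q))" by (intro ennreal_leI) simp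
      moreover have "(\<Sum>n. ennreal (c n) * indicator (I n) s) = ennreal (c n)"
        by (rule suminf_cmult_indicator[OF disj n])
      ultimately show ?thesis using s01 by simp
    next
      case False
      then have "(\<Sum>n. ennreal (c n) * indicator (I n) s) = 0" by simp
      then show ?thesis by simp
    qed
  qed
  also have "\<dots> < \<infinity>" using fin by (simp add: \<epsilon>_def)
  finally have "(\<Sum>n. ennreal (c n * (1 / 2) ^ Suc n)) < \<infinity>" unfolding cm .
  then have "summable (\<lambda>n. c n * (1 / 2) ^ Suc n)"
    by (intro summable_suminf_not_top) (auto simp: c0)
  then have "summable (\<lambda>n. 2 * 2 powr q * (c n * (1 / 2) ^ Suc n))" by (rule summable_mult)
  also have "(\<lambda>n. 2 * 2 powr q * (c n * (1 / 2) ^ Suc n)) = (\<lambda>n. level_mass \<phi> (Suc n) powr q)"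
  proof
    fix n
    have "level_mass \<phi> (Suc n) powr q = 2 powr q * (2 ^ n) powr q * \<epsilon> (r (Suc n)) powr q"
      using \<epsilon>0[of "r (Suc n)"] by (simp add: level_mass_def \<epsilon>_def r_def powr_mult circle_measure_nonneg)
    moreover have "(2 ^ n :: real) powr (1 + q) = 2 ^ n * (2 ^ n) powr q" by (simp add: powr_add)
    ultimately show "2 * 2 powr q * (c n * (1 / 2) ^ Suc n) = level_mass \<phi> (Suc n) powr q"
      by (simp add: c_def power_one_over)
  qed
  finally show ?thesis by (rule summable_Suc_iff[THEN iffD1])
qed

lemma composition_operator_linear:
  assumes "\<And>f. f \<in> hardy \<Longrightarrow> composition_operator \<phi> f \<in> hardy"
  shows "hardy_operator (composition_operator \<phi>)"
  unfolding hardy_operator_def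
  using assms by (auto simp: composition_operator_def cscale_def fun_eq_iff)

text \<open>
  From a bounded sequence extract a subsequence whose Taylor coefficients converge; the limit is again in the
  Hardy space. For the differences, finitely many blocks have energies tending to 0, and the remaining
  blocks carry small factors \<open>B m\<close>.
\<close>

lemma compact_of_block_domination:
  assumes T: "hardy_operator T"
    and B0: "\<And>m. 0 \<le> B m" and B: "B \<longlonglongrightarrow> 0"
    and le: "\<And>f. f \<in> hardy \<Longrightarrow> (hardy_norm (T f))\<^sup>2 \<le> (\<Sum>m. B m * block_energy (taylor_coeff f) m)"
  shows "hardy_compact T"
  unfolding hardy_compact_def
proof (intro conjI T allI impI)
  fix F :: "nat \<Rightarrow> complex \<Rightarrow> complex" assume F: "\<forall>n. F n \<in> hardy \<and> hardy_norm (F n) \<le> 1"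
  then have Fh: "F n \<in> hardy" and Fn: "(hardy_norm (F n))\<^sup>2 \<le> 1" for n
    using hardy_norm_nonneg by (auto simp: power_le_one)
  have part: "(\<Sum>k<N. (cmod (taylor_coeff (F n) k))\<^sup>2) \<le> 1" for n N
  proof -
    have "(\<Sum>k<N. (cmod (taylor_coeff (F n) k))\<^sup>2) \<le> (hardy_norm (F n))\<^sup>2"
      by (rule hardy_partial_energy_le[OF Fh]) simp
    then show ?thesis using Fn[of n] by linarith
  qed
  have coeff1: "cmod (taylor_coeff (F n) k) \<le> 1" for n k
  proof -
    have "(cmod (taylor_coeff (F n) k))\<^sup>2 \<le> (\<Sum>k<Suc k. (cmod (taylor_coeff (F n) k))\<^sup>2)"
      by (simp add: sum_nonneg)
    then have "(cmod (taylor_coeff (F n) k))\<^sup>2 \<le> 1" using part[of n "Suc k"] by linarith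
    then show ?thesis by (simp add: abs_square_le_1)
  qed
  obtain r where r: "strict_mono r" and conv: "\<And>k. k \<in> UNIV \<Longrightarrow> \<exists>l. (\<lambda>n. taylor_coeff (F (r n)) k) \<longlonglongrightarrow> l"
    using function_convergent_subsequence[of UNIV "\<lambda>n k. taylor_coeff (F n) k" 1] coeff1 by auto
  then obtain a where a: "\<And>k. (\<lambda>n. taylor_coeff (F (r n)) k) \<longlonglongrightarrow> a k"
    by (metis UNIV_I)
  have a_part: "(\<Sum>k<N. (cmod (a k))\<^sup>2) \<le> 1" for N
  proof (rule LIMSEQ_le_const2)
    show "(\<lambda>n. \<Sum>k<N. (cmod (taylor_coeff (F (r n)) k))\<^sup>2) \<longlonglongrightarrow> (\<Sum>k<N. (cmod (a k))\<^sup>2)"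
      by (intro tendsto_intros a)
  qed (use part in blast)
  have ss: "square_summable a"
    unfolding square_summable_def
  proof (rule bounded_imp_summable)
    show "(\<Sum>k\<le>N. (cmod (a k))\<^sup>2) \<le> 1" for N using a_part[of "Suc N"] by (simp only: lessThan_Suc_atMost)
  qed simp
  define f where "f = of_coeffs a"
  have f: "f \<in> hardy" and fc: "taylor_coeff f k = a k" for k
    using ss by (auto simp: f_def of_coeffs_in_hardy)
  define D where "D n = F (r n) - f" for n
  have D: "D n \<in> hardy" "taylor_coeff (D n) k = taylor_coeff (F (r n)) k - a k" for n k
    using hardy_diff_coeff[OF Fh f] by (auto simp: D_def fc)
  have D_lim: "(\<lambda>n. taylor_coeff (D n) k) \<longlonglongrightarrow> 0" for k
    using tendsto_diff[OF a[of k] tendsto_const[of "a k"]] by (simp add: D(2))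
  have D_norm: "(hardy_norm (D n))\<^sup>2 \<le> 4" for n
  proof (rule LIMSEQ_le_const2)
    show "(\<lambda>N. \<Sum>k<N. (cmod (taylor_coeff (D n) k))\<^sup>2) \<longlonglongrightarrow> (hardy_norm (D n))\<^sup>2"
      using hardy_norm_sq_sums[OF D(1)] by (simp add: sums_def)
    have "(\<Sum>k<N. (cmod (taylor_coeff (D n) k))\<^sup>2) \<le> 4" for N
    proof -
      have "(cmod (x - y))\<^sup>2 \<le> 2 * (cmod x)\<^sup>2 + 2 * (cmod y)\<^sup>2" for x y :: complex
      proof -
        have "(cmod (x - y))\<^sup>2 \<le> (cmod x + cmod y)\<^sup>2" by (intro power_mono norm_triangle_ineq4) auto
        also have "\<dots> \<le> 2 * (cmod x)\<^sup>2 + 2 * (cmod y)\<^sup>2"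
          using sum_squares_bound[of "cmod x" "cmod y"] by (simp add: power2_sum)
        finally show ?thesis .
      qed
      then have "(\<Sum>k<N. (cmod (taylor_coeff (D n) k))\<^sup>2) \<le> (\<Sum>k<N. 2 * (cmod (taylor_coeff (F (r n)) k))\<^sup>2 + 2 * (cmod (a k))\<^sup>2)"
        unfolding D(2) by (intro sum_mono)
      also have "\<dots> = 2 * (\<Sum>k<N. (cmod (taylor_coeff (F (r n)) k))\<^sup>2) + 2 * (\<Sum>k<N. (cmod (a k))\<^sup>2)"
        by (simp add: sum.distrib sum_distrib_left)
      also have "\<dots> \<le> 4" using part[of "r n" N] a_part[of N] by linarith
      finally show ?thesis .
    qed
    then show "\<exists>N. \<forall>m\<ge>N. (\<Sum>k<m. (cmod (taylor_coeff (D n) k))\<^sup>2) \<le> 4" by blast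
  qed
  have "(\<lambda>n. (hardy_norm (T (D n)))\<^sup>2) \<longlonglongrightarrow> 0"
  proof (rule LIMSEQ_I)
    fix e :: real assume e: "e > 0"
    have "\<forall>\<^sub>F m in sequentially. B m < e / 16" using e by (intro order_tendstoD(2)[OF B]) auto
    then obtain M where M: "\<And>m. m \<ge> M \<Longrightarrow> B m < e / 16" by (auto simp: eventually_sequentially)
    let ?E = "\<lambda>n. block_energy (taylor_coeff (D n))"
    have "(\<lambda>n. \<Sum>m<M. B m * ?E n m) \<longlonglongrightarrow> (\<Sum>m<M. B m * (\<Sum>k\<in>dyadic_block m. (cmod 0)\<^sup>2))"
      unfolding block_energy_def by (intro tendsto_intros D_lim)
    then have "\<forall>\<^sub>F n in sequentially. (\<Sum>m<M. B m * ?E n m) < e / 2"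
      using e by (intro order_tendstoD(2)) auto
    then obtain n0 where n0: "\<And>n. n \<ge> n0 \<Longrightarrow> (\<Sum>m<M. B m * ?E n m) < e / 2"
      by (auto simp: eventually_sequentially)
    have "(hardy_norm (T (D n)))\<^sup>2 < e" if n: "n \<ge> n0" for n
    proof -
      note sE = block_energy_summable[OF D(1)[of n]]
      have E0: "0 \<le> ?E n m" for m by (rule block_energy_nonneg)
      obtain K where K: "\<And>m. B m \<le> K"
        using convergent_imp_Bseq[OF convergentI[OF B]] B0 unfolding Bseq_def by (auto simp: abs_le_iff)
      have sB: "summable (\<lambda>m. B m * ?E n m)"
        by (rule summable_comparison_test'[OF summable_mult[OF sE(1), of K], of 0])
           (use B0 E0 K in \<open>auto simp: abs_mult intro!: mult_right_mono\<close>)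
      have "(\<Sum>m. B m * ?E n m) = (\<Sum>m. B (m + M) * ?E n (m + M)) + (\<Sum>m<M. B m * ?E n m)"
        by (rule suminf_split_initial_segment[OF sB])
      also have "(\<Sum>m. B (m + M) * ?E n (m + M)) \<le> (\<Sum>m. e / 16 * ?E n (m + M))"
        by (intro suminf_le summable_mult summable_ignore_initial_segment sB sE mult_right_mono E0)
           (use M in \<open>auto intro: less_imp_le\<close>)
      also have "(\<Sum>m. e / 16 * ?E n (m + M)) = e / 16 * (\<Sum>m. ?E n (m + M))"
        by (intro suminf_mult summable_ignore_initial_segment sE)
      also have "(\<Sum>m. ?E n (m + M)) \<le> suminf (?E n)"
        using suminf_split_initial_segment[OF sE(1), of M] sum_nonneg[of "{..<M}" "?E n"] E0 by simp
      also have "suminf (?E n) \<le> 4" using sE(2) D_norm[of n] by linarith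
      finally have "(\<Sum>m. B m * ?E n m) \<le> e / 16 * 4 + (\<Sum>m<M. B m * ?E n m)" using e by simp
      then show ?thesis using le[OF D(1)[of n]] n0[OF n] e by linarith
    qed
    then show "\<exists>no. \<forall>n\<ge>no. norm ((hardy_norm (T (D n)))\<^sup>2 - 0) < e" by auto
  qed
  then have "(\<lambda>n. sqrt ((hardy_norm (T (D n)))\<^sup>2)) \<longlonglongrightarrow> sqrt 0"
    by (rule tendsto_real_sqrt)
  then have "(\<lambda>n. hardy_norm (T (D n))) \<longlonglongrightarrow> 0"
    by (simp add: hardy_norm_nonneg hardy_operatorD(1)[OF T D(1)])
  moreover have "T (D n) = T (F (r n)) - T f" for n
  proof -
    have "F (r n) = D n + f" by (simp add: D_def)
    then have "T (F (r n)) = T (D n) + T f" using hardy_operatorD(2)[OF T D(1) f] by simp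
    then show ?thesis by simp
  qed
  ultimately show "\<exists>g\<in>hardy. \<exists>r. strict_mono r \<and> (\<lambda>k. hardy_norm (T (F (r k)) - g)) \<longlonglongrightarrow> 0"
    using r hardy_operatorD(1)[OF T f] by auto
qed

text \<open>
  Jensen's inequality with weights \<open>t m\<close> and values \<open>Q m / t m \<le> B m\<close>. Keeping one factor \<open>Q m\<close> on the right-hand
  side preserves the possibility of summing over an orthonormal family by Bessel's inequality.
\<close>

lemma powr_sum_le_of_domination:
  fixes t Q B :: "nat \<Rightarrow> real"
  assumes q: "q \<ge> 1" and t: "\<And>m. 0 \<le> t m" "summable t" "suminf t \<le> 1"
    and Q: "\<And>m. 0 \<le> Q m" "\<And>m. Q m \<le> B m * t m" and B: "\<And>m. 0 \<le> B m" "\<And>m. B m \<le> K"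
  shows "summable Q" "(\<Sum>m. Q m) powr q \<le> (\<Sum>m. B m powr (q - 1) * Q m)" "summable (\<lambda>m. B m powr (q - 1) * Q m)"
proof -
  have Kt: "summable (\<lambda>m. K * t m)" by (intro summable_mult t)
  show sQ: "summable Q"
    by (rule summable_comparison_test'[OF Kt, of 0])
       (use Q B t in \<open>auto intro: order_trans[OF Q(2) mult_right_mono]\<close>)
  show sBQ: "summable (\<lambda>m. B m powr (q - 1) * Q m)"
    by (rule summable_comparison_test'[OF summable_mult[OF sQ, of "K powr (q - 1)"], of 0])
       (use Q B q in \<open>auto intro!: mult_right_mono powr_mono2\<close>)
  \<comment> \<open>If \<open>t m = 0\<close> then \<open>Q m = 0\<close> as well, and the quotient takes the harmless value 0.\<close>
  define y where "y m = Q m / t m" for m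
  have ty: "t m * y m = Q m" for m
    using Q(1)[of m] Q(2)[of m] by (cases "t m = 0") (auto simp: y_def)
  have y0: "0 \<le> y m" for m using Q t by (simp add: y_def)
  have yB: "y m \<le> B m" for m
    using Q(2)[of m] t(1)[of m] B(1)[of m] by (cases "t m = 0") (auto simp: y_def divide_le_eq)
  have tyq: "t m * y m powr q \<le> B m powr (q - 1) * Q m" for m
  proof -
    have "y m powr q = y m powr (q - 1) * y m"
      using y0[of m] by (cases "y m = 0") (auto simp: powr_diff)
    then have "t m * y m powr q = y m powr (q - 1) * Q m" using ty[of m] by (simp add: mult_ac)
    also have "\<dots> \<le> B m powr (q - 1) * Q m"
      using y0 yB q Q by (intro mult_right_mono powr_mono2) auto
    finally show ?thesis .
  qed
  have styq: "summable (\<lambda>m. t m * y m powr q)"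
    by (rule summable_comparison_test'[OF sBQ, of 0]) (use tyq t in \<open>auto simp: abs_mult\<close>)
  have "(\<Sum>m. t m * y m) powr q \<le> (\<Sum>m. t m * y m powr q)"
    by (rule jensen_powr_series[OF q t y0 _ styq]) (simp add: ty sQ)
  also have "\<dots> \<le> (\<Sum>m. B m powr (q - 1) * Q m)" by (intro suminf_le tyq styq sBQ)
  finally show "(\<Sum>m. Q m) powr q \<le> (\<Sum>m. B m powr (q - 1) * Q m)" by (simp add: ty)
qed

theorem proposition3p1:
  fixes p :: real and \<phi> :: "complex \<Rightarrow> complex"
  assumes "p \<ge> 2"
    and "\<phi> holomorphic_on unit_disc"
    and "\<phi> ` unit_disc \<subseteq> unit_disc"
    and "(\<integral>\<^sup>+s\<in>{0<..<1}. ennreal (circle_measure (level_set \<phi> s) powr (p / 2)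
            / (1 - s) powr (1 + p / 2)) \<partial>lborel) < \<infinity>"
  shows "composition_operator \<phi> \<in> schatten p"
proof -
  define q where "q = p / 2"
  have q: "q \<ge> 1" using assms(1) by (simp add: q_def)
  let ?B = "block_bound \<phi>" and ?T = "composition_operator \<phi>"
  have xq: "summable (\<lambda>n. level_mass \<phi> n powr q)"
    by (rule level_mass_powr_summable[OF _ assms(2,3)]) (use q assms(4) in \<open>simp_all add: q_def\<close>)
  note conv = convolution_powr_summable[of "3 / 4", OF _ _ q level_mass_nonneg xq]
  have sx: "summable (\<lambda>n. (3 / 4) ^ nat_dist m n * level_mass \<phi> n)" for m by (rule conv(1)) auto
  have B0: "0 \<le> ?B m" for m
    unfolding block_bound_def by (intro mult_nonneg_nonneg suminf_nonneg sx) (auto simp: level_mass_nonneg)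
  have sB: "summable (\<lambda>m. ?B m powr q)"
  proof -
    have "summable (\<lambda>m. 48 powr q * (\<Sum>n. (3 / 4) ^ nat_dist m n * level_mass \<phi> n) powr q)"
      by (intro summable_mult conv(2)) auto
    moreover have "?B m powr q = 48 powr q * (\<Sum>n. (3 / 4) ^ nat_dist m n * level_mass \<phi> n) powr q" for m
      unfolding block_bound_def by (rule powr_mult)
    ultimately show ?thesis by simp
  qed
  have Blim: "?B \<longlonglongrightarrow> 0"
  proof -
    have "(\<lambda>m. (?B m powr q) powr (1 / q)) \<longlonglongrightarrow> 0 powr (1 / q)"
      by (rule tendsto_powr2[OF summable_LIMSEQ_zero[OF sB] tendsto_const]) (use q in auto)
    then show ?thesis using q B0 by (simp add: powr_powr)
  qed
  obtain K where K: "?B m \<le> K" for m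
    using convergent_imp_Bseq[OF convergentI[OF Blim]] B0 unfolding Bseq_def by (auto simp: abs_le_iff)
  obtain Q :: "(nat \<Rightarrow> complex) \<Rightarrow> nat \<Rightarrow> real" where Q: "\<And>a m. 0 \<le> Q a m" "\<And>a m. Q a m \<le> ?B m * block_energy a m"
    and T_hardy: "\<And>f. f \<in> hardy \<Longrightarrow> ?T f \<in> hardy"
    and T_le: "\<And>f. f \<in> hardy \<Longrightarrow> (hardy_norm (?T f))\<^sup>2 \<le> (\<Sum>m. Q (taylor_coeff f) m)"
    and Q_orth: "\<And>(J :: (real \<times> nat) set) e m. finite J \<Longrightarrow> hardy_orthonormal J e \<Longrightarrow> (\<Sum>j\<in>J. Q (taylor_coeff (e j)) m) \<le> ?B m"
    using composition_block_estimate[OF assms(2,3) sx K] by metis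
  have op: "hardy_operator ?T" by (rule composition_operator_linear[OF T_hardy])
  have sBE: "summable (\<lambda>m. ?B m * block_energy (taylor_coeff f) m)" if f: "f \<in> hardy" for f
    by (rule summable_comparison_test'[OF summable_mult[OF block_energy_summable(1)[OF f], of K], of 0])
       (use B0 K block_energy_nonneg in \<open>auto simp: abs_mult intro!: mult_right_mono\<close>)
  have T_le': "(hardy_norm (?T f))\<^sup>2 \<le> (\<Sum>m. ?B m * block_energy (taylor_coeff f) m)" if f: "f \<in> hardy" for f
  proof -
    have "(\<Sum>m. Q (taylor_coeff f) m) \<le> (\<Sum>m. ?B m * block_energy (taylor_coeff f) m)"
      by (intro suminf_le Q sBE f summable_comparison_test'[OF sBE[OF f], of 0]) (use Q in auto)
    then show ?thesis using T_le[OF f] by linarith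
  qed
  have compact: "hardy_compact ?T" by (rule compact_of_block_domination[OF op B0 Blim T_le'])
  have bounded: "hardy_bounded ?T"
    unfolding hardy_bounded_def
  proof (intro conjI op exI[of _ "sqrt K"] ballI)
    have K0: "0 \<le> K" using B0[of 0] K[of 0] by linarith
    then show "0 \<le> sqrt K" by simp
    fix f assume f: "f \<in> hardy"
    have "(hardy_norm (?T f))\<^sup>2 \<le> (\<Sum>m. K * block_energy (taylor_coeff f) m)"
      using T_le'[OF f] by (rule order_trans)
        (intro suminf_le sBE f summable_mult block_energy_summable mult_right_mono K block_energy_nonneg)
    also have "\<dots> = K * suminf (block_energy (taylor_coeff f))"
      by (rule suminf_mult[OF block_energy_summable(1)[OF f]])
    also have "\<dots> \<le> K * (hardy_norm f)\<^sup>2" by (intro mult_left_mono block_energy_summable f K0)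
    finally have "sqrt ((hardy_norm (?T f))\<^sup>2) \<le> sqrt (K * (hardy_norm f)\<^sup>2)"
      by (rule real_sqrt_le_mono)
    then show "hardy_norm (?T f) \<le> sqrt K * hardy_norm f"
      using f by (simp add: real_sqrt_mult hardy_norm_nonneg T_hardy)
  qed
  have "(\<Sum>j\<in>J. hardy_norm (?T (e j)) powr p) \<le> (\<Sum>m. ?B m powr q)"
    if J: "finite J" "hardy_orthonormal J e" for J :: "(real \<times> nat) set" and e
  proof -
    let ?Q = "\<lambda>j. Q (taylor_coeff (e j))"
    have e: "e j \<in> hardy" "(hardy_norm (e j))\<^sup>2 = 1" if "j \<in> J" for j
    proof -
      show eh: "e j \<in> hardy" using J(2) that by (simp add: hardy_orthonormal_def)
      have "hardy_inner (e j) (e j) = 1" using J(2) that by (simp add: hardy_orthonormal_def)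
      then show "(hardy_norm (e j))\<^sup>2 = 1" unfolding hardy_inner_self[OF eh] of_real_eq_1_iff .
    qed
    have dom: "summable (?Q j)" "(\<Sum>m. ?Q j m) powr q \<le> (\<Sum>m. ?B m powr (q - 1) * ?Q j m)"
      "summable (\<lambda>m. ?B m powr (q - 1) * ?Q j m)" if j: "j \<in> J" for j
      using powr_sum_le_of_domination[OF q block_energy_nonneg block_energy_summable(1)[OF e(1)[OF j]] _ Q B0 K]
        block_energy_summable(2)[OF e(1)[OF j]] e(2)[OF j] by auto
    have "(\<Sum>j\<in>J. hardy_norm (?T (e j)) powr p) \<le> (\<Sum>j\<in>J. \<Sum>m. ?B m powr (q - 1) * ?Q j m)"
    proof (rule sum_mono)
      fix j assume j: "j \<in> J"
      have n0: "0 \<le> hardy_norm (?T (e j))" by (intro hardy_norm_nonneg T_hardy e j)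
      have "hardy_norm (?T (e j)) powr p = ((hardy_norm (?T (e j)))\<^sup>2) powr q"
        using n0 by (simp add: q_def powr_powr flip: powr_numeral)
      also have "\<dots> \<le> (\<Sum>m. ?Q j m) powr q" using T_le[OF e(1)[OF j]] q by (intro powr_mono2) auto
      also have "\<dots> \<le> (\<Sum>m. ?B m powr (q - 1) * ?Q j m)" by (rule dom(2)[OF j])
      finally show "hardy_norm (?T (e j)) powr p \<le> (\<Sum>m. ?B m powr (q - 1) * ?Q j m)" .
    qed
    also have "\<dots> = (\<Sum>m. ?B m powr (q - 1) * (\<Sum>j\<in>J. ?Q j m))"
      unfolding sum_distrib_left by (rule suminf_sum[symmetric]) (rule dom(3))
    also have "\<dots> \<le> (\<Sum>m. ?B m powr q)"
    proof (intro suminf_le sB)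
      fix m
      have "?B m powr (q - 1) * (\<Sum>j\<in>J. ?Q j m) \<le> ?B m powr (q - 1) * ?B m"
        by (intro mult_left_mono Q_orth J) auto
      also have "\<dots> = ?B m powr q" using B0[of m] by (cases "?B m = 0") (auto simp: powr_diff)
      finally show "?B m powr (q - 1) * (\<Sum>j\<in>J. ?Q j m) \<le> ?B m powr q" .
      show "summable (\<lambda>m. ?B m powr (q - 1) * (\<Sum>j\<in>J. ?Q j m))"
        unfolding sum_distrib_left by (rule summable_sum) (rule dom(3))
    qed
    finally show ?thesis .
  qed
  then have "\<exists>s. singular_numbers ?T s \<and> summable (\<lambda>n. s n powr p)"
    using assms(1) by (intro singular_numbers_of_orthonormal_bound[OF bounded]) auto
  with compact show ?thesis by (simp add: schatten_def)
qed

end
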